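(* Let $\phi:\mathbb S^1\to\mathbb R\cup\{+\infty\}$ be lower semicontinuous and finite on at least three points. Suppose $\theta_0\in\mathbb S^1$ is such that $\phi(\theta_0)<+\infty$ and there exist a neighborhood $U$ of $\theta_0$ and constants $\epsilon>0$, $0<\alpha<1$ with $$\phi(\theta)-\phi(\theta_0)>\epsilon|\theta-\theta_0|^{\alpha}$$ for every $\theta\in U\setminus\{\theta_0\}$. If $\Sigma$ is a convex entire spacelike surface in $\mathbb R^{2,1}$ with null support function $\phi$ and curvature bounded above by a negative constant, then $\Sigma$ is incomplete at $\theta_0$.
   Context: $\mathbb R^{2,1}$ is $\mathbb R^3$ with the Lorentzian product $\langle(x,y,z),(x',y',z')\rangle=xx'+yy'-zz'$. A convex entire spacelike surface $\Sigma$ is the graph of a convex function $f:\mathbb R^2\to\mathbb R$ with $\|Df\|<1$ everywhere; surfaces are assumed to be of class $C^2$. Its curvature is the Gaussian curvature of the induced Riemannian metric (first fundamental form). $\mathbb S^1=\mathbb R/2\pi\mathbb Z$, $|\theta-\theta'|$ is the distance in $\mathbb R/2\pi\mathbb Z$, and $\vec\theta=(\cos\theta,\sin\theta,1)$. The null support function of $\Sigma$ is $\phi(\theta)=\sup_{p\in\Sigma}\langle p,\vec\theta\rangle\in\mathbb R\cup\{+\infty\}$. If $\phi(\theta)<+\infty$, the plane $\{p:\langle p,\vec\theta\rangle=\phi(\theta)\}$ is the (unique) null support plane of $\Sigma$ in the direction $\theta$; if $\phi(\theta)=+\infty$ there is none. A curve is asymptotic to an affine subspace $V$ (with parallel linear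 subspace $TV$) if it converges in the quotient $\mathbb R^{2,1}/TV$ to the point corresponding to $V$. $\Sigma$ is incomplete at $\theta$ if there is a proper finite-length geodesic $\gamma:[0,T)\to\Sigma$ (proper as a map into $\Sigma$) asymptotic to a null support plane of $\Sigma$ in the direction $\theta$ (in particular the induced metric on $\Sigma$ is then not complete). *)

theory Defs
  imports "HOL-Analysis.Analysis" "HOL-Library.Real_Mod"
begin

section \<open>Minkowski space\<close>

type_synonym plane = "real \<times> real"
type_synonym mink = "real \<times> real \<times> real"

definition lorentz :: "mink \<Rightarrow> mink \<Rightarrow> real" where
  "lorentz = (\<lambda>(x, y, z) (x', y', z'). x * x' + y * y' - z * z')"

definition null_vec :: "real \<Rightarrow> mink" where
  "null_vec \<theta> = (cos \<theta>, sin \<theta>, 1)"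


section \<open>Entire spacelike graphs\<close>

definition C2 :: "('a::real_normed_vector \<Rightarrow> real) \<Rightarrow> bool" where
  "C2 f \<longleftrightarrow> (\<exists>(f' :: 'a \<Rightarrow> 'a \<Rightarrow>\<^sub>L real) (f'' :: 'a \<Rightarrow> 'a \<Rightarrow>\<^sub>L ('a \<Rightarrow>\<^sub>L real)).
     (\<forall>p. (f has_derivative blinfun_apply (f' p)) (at p)) \<and>
     (\<forall>p. (f' has_derivative blinfun_apply (f'' p)) (at p)) \<and>
     continuous_on UNIV f'')"

definition graph_param :: "(plane \<Rightarrow> real) \<Rightarrow> plane \<Rightarrow> mink" where
  "graph_param f p = (fst p, snd p, f p)"

definition graph_surface :: "(plane \<Rightarrow> real) \<Rightarrow> mink set" where
  "graph_surface f = range (graph_param f)"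

definition convex_entire_spacelike :: "(plane \<Rightarrow> real) \<Rightarrow> bool" where
  "convex_entire_spacelike f \<longleftrightarrow>
     C2 f \<and> convex_on UNIV f \<and> (\<forall>p. onorm (frechet_derivative f (at p)) < 1)"


section \<open>Null support function and null support planes\<close>

text \<open>
  Functions on the circle \<open>\<real>/2\<pi>\<int>\<close> are represented by \<open>2\<pi>\<close>-periodic functions on the line.
\<close>

definition circle_dist :: "real \<Rightarrow> real \<Rightarrow> real" where
  "circle_dist \<theta> \<theta>' = (INF k::int. \<bar>\<theta> - \<theta>' + 2 * pi * of_int k\<bar>)"

definition lower_semicontinuous :: "('a::topological_space \<Rightarrow> ereal) \<Rightarrow> bool" where
  "lower_semicontinuous \<phi> \<longleftrightarrow> (\<forall>a. open {x. a < \<phi> x})"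

definition null_support :: "mink set \<Rightarrow> real \<Rightarrow> ereal" where
  "null_support S \<theta> = (SUP p\<in>S. ereal (lorentz p (null_vec \<theta>)))"

definition is_null_support_plane :: "mink set \<Rightarrow> real \<Rightarrow> mink set \<Rightarrow> bool" where
  "is_null_support_plane S \<theta> P \<longleftrightarrow>
     null_support S \<theta> < \<infinity> \<and> P = {p. ereal (lorentz p (null_vec \<theta>)) = null_support S \<theta>}"


section \<open>Metrics on the plane of class \<open>C\<^sup>1\<close>\<close>

text \<open>
  \<open>g p u v\<close> is the inner product of the tangent vectors \<open>u\<close>, \<open>v\<close> at the point \<open>p\<close>. The metric
  induced on a surface of class \<open>C\<^sup>2\<close> is only of class \<open>C\<^sup>1\<close>.
\<close>

type_synonym metric = "plane \<Rightarrow> plane \<Rightarrow> plane \<Rightarrow> real"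

definition first_fundamental_form :: "(plane \<Rightarrow> real) \<Rightarrow> metric" where
  "first_fundamental_form f p u v =
     (let D = frechet_derivative (graph_param f) (at p) in lorentz (D u) (D v))"

definition metric_deriv :: "metric \<Rightarrow> plane \<Rightarrow> plane \<Rightarrow> plane \<Rightarrow> plane \<Rightarrow> real" where
  "metric_deriv g p u v w = frechet_derivative (\<lambda>q. g q v w) (at p) u"

text \<open>
  By the Koszul formula, \<open>christoffel g p u v\<close> is the Levi-Civita derivative of the constant vector
  field \<open>v\<close> in the direction \<open>u\<close>; its two components are \<open>\<Sum>i j. \<Gamma>\<^sup>k\<^sub>i\<^sub>j u\<^sub>i v\<^sub>j\<close>.
\<close>

definition christoffel :: "metric \<Rightarrow> plane \<Rightarrow> plane \<Rightarrow> plane \<Rightarrow> plane" where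
  "christoffel g p u v = (THE a. \<forall>w.
     2 * g p a w = metric_deriv g p u v w + metric_deriv g p v u w - metric_deriv g p w u v)"

definition geodesic_on :: "metric \<Rightarrow> (real \<Rightarrow> plane) \<Rightarrow> real set \<Rightarrow> bool" where
  "geodesic_on g c I \<longleftrightarrow> (\<exists>c'. \<forall>t\<in>I.
     (c has_vector_derivative c' t) (at t within I) \<and>
     (c' has_vector_derivative - christoffel g (c t) (c' t) (c' t)) (at t within I))"

definition curve_length :: "metric \<Rightarrow> (real \<Rightarrow> plane) \<Rightarrow> real set \<Rightarrow> ennreal" where
  "curve_length g c I =
     (\<integral>\<^sup>+ t\<in>I. (let v = vector_derivative c (at t within I) in ennreal (sqrt (g (c t) v v))) \<partial>lborel)"

definition area_density :: "metric \<Rightarrow> plane \<Rightarrow> real" where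
  "area_density g p =
     sqrt (g p (1, 0) (1, 0) * g p (0, 1) (0, 1) - (g p (1, 0) (0, 1))\<^sup>2)"

text \<open>
  The connection form \<open>\<omega>(u) = g(\<nabla>\<^sub>u e\<^sub>1, e\<^sub>2)\<close> of the positively oriented orthonormal frame
  \<open>e\<^sub>1, e\<^sub>2\<close> with \<open>e\<^sub>1\<close> a positive multiple of the first coordinate field. With \<open>E\<close>, \<open>F\<close>, \<open>G\<close> the
  coefficients of the metric and \<open>D = sqrt (EG - F\<^sup>2)\<close> it is
  \<open>\<omega> = (D / E) (\<Gamma>\<^sup>2\<^sub>1\<^sub>1 dx + \<Gamma>\<^sup>2\<^sub>1\<^sub>2 dy)\<close>.
\<close>

definition connection_form :: "metric \<Rightarrow> plane \<Rightarrow> plane \<Rightarrow> real" where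
  "connection_form g p u =
     area_density g p / g p (1, 0) (1, 0) * snd (christoffel g p u (1, 0))"

text \<open>The integral of a 1-form along the counterclockwise boundary of the square of
  centre \<open>(x, y)\<close> and side \<open>2 r\<close>.\<close>

definition circulation :: "(plane \<Rightarrow> plane \<Rightarrow> real) \<Rightarrow> plane \<Rightarrow> real \<Rightarrow> real" where
  "circulation \<omega> = (\<lambda>(x, y) r.
      integral {-r..r} (\<lambda>s. \<omega> (x + s, y - r) (1, 0))
    + integral {-r..r} (\<lambda>s. \<omega> (x + r, y + s) (0, 1))
    - integral {-r..r} (\<lambda>s. \<omega> (x + s, y + r) (1, 0))
    - integral {-r..r} (\<lambda>s. \<omega> (x - r, y + s) (0, 1)))"

text \<open>
  The Gaussian curvature \<open>K\<close> is characterised by the structure equation \<open>d\<omega> = - K dA\<close>. Since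
  \<open>\<omega>\<close> is merely continuous when the metric is of class \<open>C\<^sup>1\<close>, the exterior derivative at a point
  is taken as the limit of the circulation around shrinking squares divided by their area; that is,
  \<open>K\<close> is the infinitesimal holonomy per unit area. For a metric of class \<open>C\<^sup>2\<close> this is Liouville's
  formula \<open>K = (\<partial>\<^sub>y (D \<Gamma>\<^sup>2\<^sub>1\<^sub>1 / E) - \<partial>\<^sub>x (D \<Gamma>\<^sup>2\<^sub>1\<^sub>2 / E)) / D\<close>. For the metric induced on the graph
  of a spacelike function of class \<open>C\<^sup>2\<close> the limit exists at every point.
\<close>

definition has_gauss_curvature :: "metric \<Rightarrow> plane \<Rightarrow> real \<Rightarrow> bool" where
  "has_gauss_curvature g p K \<longleftrightarrow>
     ((\<lambda>r. - circulation (connection_form g) p r / (area_density g p * (2 * r)\<^sup>2)) \<longlongrightarrow> K) (at_right 0)"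

definition curvature_bounded_above :: "metric \<Rightarrow> real \<Rightarrow> bool" where
  "curvature_bounded_above g C \<longleftrightarrow> (\<forall>p. \<exists>K\<le>C. has_gauss_curvature g p K)"


section \<open>Asymptotic curves and incompleteness at a direction\<close>

definition coset :: "'a::ab_group_add set \<Rightarrow> 'a \<Rightarrow> 'a set" where
  "coset W p = (+) p ` W"

definition quotient_topology :: "'a::real_normed_vector set \<Rightarrow> 'a set topology" where
  "quotient_topology W = topology (\<lambda>U. U \<subseteq> range (coset W) \<and> open (coset W -` U))"

lemma openin_quotient_topology:
  "openin (quotient_topology W) U \<longleftrightarrow> U \<subseteq> range (coset W) \<and> open (coset W -` U)"
proof -
  have "istopology (\<lambda>U. U \<subseteq> range (coset W) \<and> open (coset W -` U))"
    unfolding istopology_def by (auto simp: vimage_Union intro!: open_Int)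
  then show ?thesis
    by (simp add: quotient_topology_def topology_inverse')
qed

text \<open>
  For an affine subspace \<open>V\<close> with parallel linear subspace \<open>W\<close>, the point of the quotient by \<open>W\<close>
  that corresponds to \<open>V\<close> is the coset \<open>V\<close> itself.
\<close>

definition asymptotic_to :: "(real \<Rightarrow> 'a::real_normed_vector) \<Rightarrow> real \<Rightarrow> 'a set \<Rightarrow> bool" where
  "asymptotic_to \<gamma> T V \<longleftrightarrow>
     (let W = {p - q |p q. p \<in> V \<and> q \<in> V}
      in limitin (quotient_topology W) (\<lambda>t. coset W (\<gamma> t)) V (at_left T))"

text \<open>
  Curves on the graph of \<open>f\<close> are written as \<open>graph_param f \<circ> c\<close>. A geodesic is affinely
  parametrised, and a proper one is not constant, so that finite length forces \<open>T\<close> to be finite.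
\<close>

definition incomplete_at :: "(plane \<Rightarrow> real) \<Rightarrow> real \<Rightarrow> bool" where
  "incomplete_at f \<theta> \<longleftrightarrow> (\<exists>T>0. \<exists>c P.
     geodesic_on (first_fundamental_form f) c {0..<T} \<and>
     curve_length (first_fundamental_form f) c {0..<T} < \<infinity> \<and>
     proper_map (top_of_set {0..<T}) (top_of_set (graph_surface f)) (graph_param f \<circ> c) \<and>
     is_null_support_plane (graph_surface f) \<theta> P \<and>
     asymptotic_to (graph_param f \<circ> c) T P)"

end

theory Submission
  imports Defs
begin

text \<open>
  Let \<open>e\<close> be the direction \<open>\<theta>\<^sub>0\<close> and \<open>n\<close> its rotation by a right angle. In the null coordinates
  \<open>u = f - p \<bullet> e + \<phi>(\<theta>\<^sub>0) > 0\<close>, \<open>y = p \<bullet> n\<close> and \<open>F = p \<bullet> e + u/2\<close> the surface is the graph of a convex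
  function \<open>F\<close> of \<open>(u, y)\<close>, the metric is \<open>dy\<^sup>2 - 2 dF du\<close>, and the end at \<open>\<theta>\<^sub>0\<close> is \<open>u \<rightarrow> 0\<close>. As the
  exponent \<open>\<alpha>\<close> is less than 1, every point of the line \<open>u = 0\<close>, \<open>y = y\<^sub>0\<close> of height at least polynomial
  in \<open>y\<^sub>0\<close> is the apex of a light cone that lies in the domain of dependence. Comparison with the
  hyperboloids in these cones gives \<open>F \<le> B (1 + \<bar>y\<bar>)\<^sup>k + 1/(2\<kappa>u)\<close>. This dominates the boundary values
  of the barrier \<open>C cosh (\<mu>y) / sqrt u\<close>, and the maximum principle improves the bound to
  \<open>F \<le> C / sqrt u\<close> on \<open>y = 0\<close>; with this the end can be reached with finite energy.

  The Christoffel symbols are merely continuous, so the geodesic is not obtained by shooting but as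
  a limit of minimisers of the chordal energy \<open>\<Sum>\<bar>q\<^sub>i\<^sub>+\<^sub>1 - q\<^sub>i\<bar>\<^sup>2\<close>. Along a minimiser \<open>u\<close> and \<open>F\<close> are convex,
  which together with the energy bound keeps it in a compact set as long as \<open>u\<close> stays away from 0.
\<close>

section \<open>Gradient and Hessian of a spacelike graph\<close>

text \<open>The bound of order \<open>1/u\<close> does not suffice: if \<open>F\<close> behaves like
  \<open>1/u\<close> on \<open>y = 0\<close>, the length element there is of order
  \<open>du/u\<close>, which is not integrable. With \<open>1 / sqrt u\<close> it is of order
  \<open>u\<close> to the power \<open>-3/4\<close>, and the end is at finite distance. The barrier
  has this shape because the main terms on both sides of its curvature inequality are quadratic in
  \<open>C\<close> and carry the same power of \<open>s\<close>, so that only the ratio of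
  \<open>\<mu>\<^sup>2\<close> to \<kappa> decides. The comparison takes place on a region bounded
  by \<open>cosh (\<mu> y) * sqrt u = Q\<close>, where the barrier has the size of
  \<open>cosh\<close> squared; this is why a polynomial bound for the apexes is enough. Chords of
  Minkowski space, instead of distances in the surface, make the discrete equation algebraic: the
  second difference is an exact multiple of \<open>(grad, 1)\<close>, and the multiple is
  nonnegative as \<open>f\<close> is convex. Thus \<open>u\<close> and \<open>F\<close> are convex
  before any limit is taken, without error terms. Minimality serves only for this equation and for
  the energy bound.\<close>

lemma second_derivative_symmetric:
  fixes f :: "'a::real_inner \<Rightarrow> real" and grad :: "'a \<Rightarrow> 'a"
  assumes df: "\<And>q. (f has_derivative (\<lambda>v. grad q \<bullet> v)) (at q)"
    and dg: "(grad has_derivative h) (at p)"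
  shows "h u \<bullet> v = h v \<bullet> u"
proof -
  define D where "D u v t = f (p + t *\<^sub>R u + t *\<^sub>R v) - f (p + t *\<^sub>R u) - f (p + t *\<^sub>R v) + f p" for u v and t :: real
  have bl: "bounded_linear h" using dg has_derivative_bounded_linear by blast
  \<comment> \<open>The mean value theorem in direction \<open>u\<close> turns the mixed difference
    into a difference of gradients at two points, so differentiability of \<open>grad\<close> at the
    single point \<open>p\<close> suffices. \<open>D\<close> is symmetric in its two directions,
    hence so is the limit.\<close>
  have key: "((\<lambda>t. D u v t / t\<^sup>2) \<longlongrightarrow> h v \<bullet> u) (at_right 0)"
    for u v :: 'a
  proof (rule tendstoI)
    fix e :: real assume e: "e > 0"
    \<comment> \<open>Each of the two gradients contributes an error
      \<open>e' * t * (norm u + norm v)\<close>, and the pairing with \<open>u\<close> a factor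
      \<open>norm u\<close>; the summand 1 keeps \<open>M\<close> positive and the final estimate
      strict.\<close>
    define M where "M = 2 * (norm u + norm v) * norm u + 1"
    have M: "M > 0" unfolding M_def by (simp add: add_nonneg_pos)
    define e' where "e' = e / M"
    have e': "e' > 0" using e M by (simp add: e'_def)
    obtain d where d: "d > 0" "\<And>y. norm (y - p) < d \<Longrightarrow> norm (grad y - grad p - h (y - p)) \<le> e' * norm (y - p)"
      using dg e' unfolding has_derivative_at_alt by blast
    define b where "b = d / (norm u + norm v + 1)"
    have b: "b > 0" using d by (simp add: b_def add_nonneg_pos)
    have "dist (D u v t / t\<^sup>2) (h v \<bullet> u) < e"
      if t: "0 < t" "t < b" for t
    proof -
      have "\<exists>s. 0 < s \<and> s < t \<and> (f (p + t *\<^sub>R u + t *\<^sub>R v) - f (p + t *\<^sub>R u)) - (f (p + 0 *\<^sub>R u + t *\<^sub>R v) - f (p + 0 *\<^sub>R u))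
          = (t - 0) * (grad (p + s *\<^sub>R u + t *\<^sub>R v) \<bullet> u - grad (p + s *\<^sub>R u) \<bullet> u)"
      proof (rule MVT2)
        show "0 < t" by (fact t)
        fix s :: real
        show "((\<lambda>s. f (p + s *\<^sub>R u + t *\<^sub>R v) - f (p + s *\<^sub>R u)) has_real_derivative
           grad (p + s *\<^sub>R u + t *\<^sub>R v) \<bullet> u - grad (p + s *\<^sub>R u) \<bullet> u) (at s)"
          unfolding has_field_derivative_def
          by (auto intro!: derivative_eq_intros has_derivative_compose[OF _ df] simp: algebra_simps)
      qed
      then obtain s where s: "0 < s" "s < t" and eq: "D u v t = t * ((grad (p + s *\<^sub>R u + t *\<^sub>R v) - grad (p + s *\<^sub>R u)) \<bullet> u)"
        by (auto simp: D_def inner_diff_left)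
      define q1 where "q1 = p + s *\<^sub>R u + t *\<^sub>R v"
      define q2 where "q2 = p + s *\<^sub>R u"
      have su: "norm (s *\<^sub>R u) \<le> t * norm u" using s by (simp add: mult_right_mono)
      have n1: "norm (q1 - p) \<le> t * (norm u + norm v)"
        unfolding q1_def using su norm_triangle_ineq[of "s *\<^sub>R u" "t *\<^sub>R v"] t by (simp add: algebra_simps)
      have n2: "norm (q2 - p) \<le> t * (norm u + norm v)"
        unfolding q2_def using su t by (simp add: algebra_simps add_increasing2)
      have "t * (norm u + norm v) < b * (norm u + norm v + 1)"
        using t b by (smt (verit) mult_left_mono mult_strict_right_mono norm_ge_zero)
      also have "\<dots> = d" by (simp add: b_def add_nonneg_eq_0_iff field_simps add_nonneg_pos)
      finally have td: "t * (norm u + norm v) < d" .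
      have r1: "norm (grad q1 - grad p - h (q1 - p)) \<le> e' * (t * (norm u + norm v))"
        using d(2)[of q1] n1 td e' by (smt (verit) mult_left_mono)
      have r2: "norm (grad q2 - grad p - h (q2 - p)) \<le> e' * (t * (norm u + norm v))"
        using d(2)[of q2] n2 td e' by (smt (verit) mult_left_mono)
      have hh: "h (q1 - p) - h (q2 - p) = t *\<^sub>R h v"
        using bl by (simp add: q1_def q2_def linear_simps)
      have "norm (grad q1 - grad q2 - t *\<^sub>R h v) \<le> 2 * e' * (t * (norm u + norm v))"
      proof -
        have "grad q1 - grad q2 - t *\<^sub>R h v = (grad q1 - grad p - h (q1 - p)) - (grad q2 - grad p - h (q2 - p))"
          unfolding hh[symmetric] by simp
        then have "norm (grad q1 - grad q2 - t *\<^sub>R h v) \<le> norm (grad q1 - grad p - h (q1 - p)) + norm (grad q2 - grad p - h (q2 - p))"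
          by (metis norm_triangle_ineq4)
        then show ?thesis using r1 r2 by linarith
      qed
      then have "\<bar>(grad q1 - grad q2 - t *\<^sub>R h v) \<bullet> u\<bar> \<le> 2 * e' * (t * (norm u + norm v)) * norm u"
        using Cauchy_Schwarz_ineq2 order_trans mult_right_mono norm_ge_zero by meson
      also have "\<dots> < t * (e' * M)" using t e' unfolding M_def by (simp add: algebra_simps)
      also have "e' * M = e" using M by (simp add: e'_def)
      finally have lt: "\<bar>(grad q1 - grad q2) \<bullet> u - t * (h v \<bullet> u)\<bar> < t * e"
        by (simp add: inner_diff_left)
      have "D u v t / t\<^sup>2 - h v \<bullet> u = ((grad q1 - grad q2) \<bullet> u - t * (h v \<bullet> u)) / t"
        using eq t unfolding q1_def q2_def by (simp add: field_simps power2_eq_square)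
      then show ?thesis using lt t by (simp add: dist_real_def abs_divide pos_divide_less_eq mult.commute)
    qed
    then show "eventually (\<lambda>t. dist (D u v t / t\<^sup>2) (h v \<bullet> u) < e) (at_right 0)"
      using b unfolding eventually_at_right_field by blast
  qed
  have "((\<lambda>t. D u v t / t\<^sup>2) \<longlongrightarrow> h v \<bullet> u) (at_right 0)" by (rule key)
  moreover have "((\<lambda>t. D u v t / t\<^sup>2) \<longlongrightarrow> h u \<bullet> v) (at_right 0)" using key[of v u]
    by (simp add: D_def algebra_simps)
  ultimately show ?thesis
    using tendsto_unique trivial_limit_at_right_real by blast
qed

text \<open>Convexity enters only through \<open>tangent_le\<close>. Joint continuity in
  \<open>cont_hess\<close> is what gives Hessian bounds on balls and lets both the base point and
  the velocity vary in the limit of accelerations.\<close>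

locale spacelike_graph =
  fixes f :: "plane \<Rightarrow> real" and grad :: "plane \<Rightarrow> plane" and hess :: "plane \<Rightarrow> plane \<Rightarrow> plane"
  assumes deriv_f: "(f has_derivative (\<lambda>v. grad p \<bullet> v)) (at p)"
    and deriv_grad: "(grad has_derivative hess p) (at p)"
    and cont_hess: "continuous_on UNIV (\<lambda>(p, v). hess p v)"
    and spacelike: "norm (grad p) < 1"
    and tangent_le: "f p + grad p \<bullet> (q - p) \<le> f q"

lemma convex_tangent_le:
  fixes f :: "'a::real_normed_vector \<Rightarrow> real"
  assumes conv: "convex_on UNIV f" and df: "(f has_derivative D) (at p)"
  shows "f p + D (q - p) \<le> f q"
proof -
  have "((\<lambda>t. (f (p + t *\<^sub>R (q - p)) - f p) / t) \<longlongrightarrow> D (q - p)) (at_right 0)"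
  proof -
    have bl: "bounded_linear D" using df has_derivative_bounded_linear by blast
    have "((\<lambda>t. f (p + t *\<^sub>R (q - p))) has_real_derivative D (q - p)) (at 0)"
      unfolding has_field_derivative_def
      by (rule has_derivative_eq_rhs[OF has_derivative_compose[of "\<lambda>t. p + t *\<^sub>R (q - p)" "\<lambda>t. t *\<^sub>R (q - p)" 0 UNIV f D]])
         (auto intro!: derivative_eq_intros df simp: linear_simps[OF bl] fun_eq_iff)
    then have "((\<lambda>t. (f (p + t *\<^sub>R (q - p)) - f p) / t) \<longlongrightarrow> D (q - p)) (at 0)"
      by (simp add: DERIV_def)
    then show ?thesis using filterlim_at_split by blast
  qed
  moreover have "eventually (\<lambda>t. (f (p + t *\<^sub>R (q - p)) - f p) / t \<le> f q - f p) (at_right (0::real))"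
  proof -
    have "(f (p + t *\<^sub>R (q - p)) - f p) / t \<le> f q - f p" if "0 < t" "t < 1" for t :: real
    proof -
      have "f ((1 - t) *\<^sub>R p + t *\<^sub>R q) \<le> (1 - t) * f p + t * f q"
        using conv that by (auto simp: convex_on_def)
      moreover have "(1 - t) *\<^sub>R p + t *\<^sub>R q = p + t *\<^sub>R (q - p)" by (simp add: algebra_simps)
      ultimately show ?thesis using that by (simp add: field_simps)
    qed
    then show ?thesis unfolding eventually_at_right_field by (intro exI[of _ 1]) auto
  qed
  ultimately have "D (q - p) \<le> f q - f p"
    using tendsto_upperbound trivial_limit_at_right_real by blast
  then show ?thesis by simp
qed

lemma convex_entire_spacelike_imp:
  assumes "convex_entire_spacelike f"
  obtains grad hess where "spacelike_graph f grad hess"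
proof -
  from assms obtain f' :: "plane \<Rightarrow> plane \<Rightarrow>\<^sub>L real" and f'' :: "plane \<Rightarrow> plane \<Rightarrow>\<^sub>L (plane \<Rightarrow>\<^sub>L real)"
    where f': "\<And>p. (f has_derivative blinfun_apply (f' p)) (at p)"
      and f'': "\<And>p. (f' has_derivative blinfun_apply (f'' p)) (at p)"
      and cont: "continuous_on UNIV f''" and conv: "convex_on UNIV f"
      and on: "\<And>p. onorm (frechet_derivative f (at p)) < 1"
    unfolding convex_entire_spacelike_def C2_def by blast
  define grad where "grad p = (f' p (1, 0), f' p (0, 1))" for p
  define hess where "hess p v = (f'' p v (1, 0), f'' p v (0, 1))" for p v
  have lin: "L v = fst v * L (1, 0) + snd v * L (0, 1)" for L :: "plane \<Rightarrow>\<^sub>L real" and v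
  proof -
    have "v = fst v *\<^sub>R (1, 0) + snd v *\<^sub>R (0, 1)" by (cases v) simp
    then have "L v = L (fst v *\<^sub>R (1, 0) + snd v *\<^sub>R (0, 1))" by simp
    then show ?thesis by (simp only: blinfun.add_right blinfun.scaleR_right) simp
  qed
  have g: "grad p \<bullet> v = f' p v" for p v
    using lin[of "f' p" v] by (simp add: grad_def inner_prod_def mult.commute)
  have df: "(f has_derivative (\<lambda>v. grad p \<bullet> v)) (at p)" for p
    using f' by (simp add: g)
  have "spacelike_graph f grad hess"
  proof
    fix p q
    show "(f has_derivative (\<lambda>v. grad p \<bullet> v)) (at p)" by (fact df)
    show "(grad has_derivative hess p) (at p)"
      unfolding grad_def hess_def
      by (auto intro!: derivative_eq_intros f'')
    show "continuous_on UNIV (\<lambda>(p, v). hess p v)"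
    proof -
      have "continuous_on UNIV (\<lambda>x. f'' (fst x))"
        by (rule continuous_on_compose2[OF cont]) (auto intro: continuous_intros)
      then show ?thesis
      unfolding hess_def case_prod_beta
      by (intro continuous_intros)
    qed
    have fd: "frechet_derivative f (at p) = (\<lambda>v. grad p \<bullet> v)"
      using df by (metis frechet_derivative_at)
    have "norm (grad p \<bullet> grad p) \<le> onorm (\<lambda>v. grad p \<bullet> v) * norm (grad p)"
      by (rule onorm) (rule bounded_linear_inner_right)
    moreover have "onorm (\<lambda>v. grad p \<bullet> v) < 1" using on[of p] fd by simp
    ultimately have "norm (grad p) * norm (grad p) \<le> onorm (\<lambda>v. grad p \<bullet> v) * norm (grad p)"
      by (simp add: dot_square_norm power2_eq_square)
    then show "norm (grad p) < 1" using \<open>onorm (\<lambda>v. grad p \<bullet> v) < 1\<close>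
      by (cases "norm (grad p) > 0") auto
    show "f p + grad p \<bullet> (q - p) \<le> f q"
      by (rule convex_tangent_le[OF conv df])
  qed
  then show thesis by (rule that)
qed

context spacelike_graph begin

lemma hess_sym: "hess p u \<bullet> v = hess p v \<bullet> u"
  using second_derivative_symmetric[OF deriv_f deriv_grad] .

lemma hess_linear: "bounded_linear (hess p)"
  using deriv_grad has_derivative_bounded_linear by blast

lemma grad_inner_less: "norm v = 1 \<Longrightarrow> grad p \<bullet> v < 1"
  using spacelike[of p] norm_cauchy_schwarz[of "grad p" v] by simp

lemma continuous_f: "continuous_on S f"
  by (intro continuous_at_imp_continuous_on ballI has_derivative_continuous[OF deriv_f])

lemma continuous_grad: "continuous_on S grad"
  by (intro continuous_at_imp_continuous_on ballI has_derivative_continuous[OF deriv_grad])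

lemma deriv_f_line: "((\<lambda>s. f (p + s *\<^sub>R v)) has_real_derivative grad (p + s *\<^sub>R v) \<bullet> v) (at s within S)"
proof -
  have "((\<lambda>s. p + s *\<^sub>R v) has_derivative (\<lambda>s. s *\<^sub>R v)) (at s within S)"
    by (auto intro!: derivative_eq_intros)
  from has_derivative_compose[OF this deriv_f] show ?thesis
    unfolding has_field_derivative_def
    by (rule has_derivative_eq_rhs) (simp add: fun_eq_iff mult.commute)
qed

lemma deriv_grad_line:
  "((\<lambda>s. grad (p + s *\<^sub>R v) \<bullet> w) has_real_derivative hess (p + s *\<^sub>R v) v \<bullet> w) (at s within S)"
proof -
  have "((\<lambda>s. p + s *\<^sub>R v) has_derivative (\<lambda>s. s *\<^sub>R v)) (at s within S)"
    by (auto intro!: derivative_eq_intros)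
  from has_derivative_inner_left[OF has_derivative_compose[OF this deriv_grad], of w] show ?thesis
    unfolding has_field_derivative_def
    by (rule has_derivative_eq_rhs) (simp add: fun_eq_iff linear_simps[OF hess_linear] mult.commute)
qed

lemma lipschitz: "\<bar>f p - f q\<bar> \<le> norm (p - q)"
proof -
  have "f a - f b \<le> norm (a - b)" for a b
    using tangent_le[of a b] spacelike[of a] norm_cauchy_schwarz[of "grad a" "a - b"]
    by (smt (verit) inner_diff_right mult_left_le_one_le norm_ge_zero)
  from this[of p q] this[of q p] show ?thesis by (simp add: norm_minus_commute)
qed

lemma hess_nonneg: "hess p v \<bullet> v \<ge> 0"
proof -
  have "mono_on UNIV (\<lambda>s. grad (p + s *\<^sub>R v) \<bullet> v)"
  proof (rule mono_onI)
    fix r s :: real assume "r \<le> s"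
    have "f (p + r *\<^sub>R v) + grad (p + r *\<^sub>R v) \<bullet> ((s - r) *\<^sub>R v) \<le> f (p + s *\<^sub>R v)"
      using tangent_le[of "p + r *\<^sub>R v" "p + s *\<^sub>R v"] by (simp add: algebra_simps)
    moreover have "f (p + s *\<^sub>R v) + grad (p + s *\<^sub>R v) \<bullet> ((r - s) *\<^sub>R v) \<le> f (p + r *\<^sub>R v)"
      using tangent_le[of "p + s *\<^sub>R v" "p + r *\<^sub>R v"] by (simp add: algebra_simps)
    ultimately have "(s - r) * (grad (p + r *\<^sub>R v) \<bullet> v) \<le> (s - r) * (grad (p + s *\<^sub>R v) \<bullet> v)"
      by (simp add: algebra_simps)
    then show "grad (p + r *\<^sub>R v) \<bullet> v \<le> grad (p + s *\<^sub>R v) \<bullet> v"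
      using \<open>r \<le> s\<close> by (cases "r = s") auto
  qed
  moreover have "((\<lambda>s. grad (p + s *\<^sub>R v) \<bullet> v) has_real_derivative hess p v \<bullet> v) (at 0)"
    using deriv_grad_line[of p v v 0 UNIV] by simp
  ultimately show ?thesis
    using mono_on_imp_deriv_nonneg[of UNIV "\<lambda>s. grad (p + s *\<^sub>R v) \<bullet> v" _ 0] by simp
qed

abbreviation hess_determinant :: "plane \<Rightarrow> real" where
  "hess_determinant p \<equiv> (hess p (1, 0) \<bullet> (1, 0)) * (hess p (0, 1) \<bullet> (0, 1)) - (hess p (1, 0) \<bullet> (0, 1))\<^sup>2"

end

section \<open>Comparison with hyperboloids\<close>

context spacelike_graph begin

lemma ray_antimono:
  assumes "norm d = 1" "r \<le> s"
  shows "f (q + s *\<^sub>R d) - s \<le> f (q + r *\<^sub>R d) - r"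
proof -
  have "norm ((q + s *\<^sub>R d) - (q + r *\<^sub>R d)) = s - r"
    using assms by (simp flip: scaleR_left_diff_distrib)
  then show ?thesis
    using lipschitz[of "q + s *\<^sub>R d" "q + r *\<^sub>R d"] by linarith
qed

text \<open>Along a ray in a null direction the height above the null planes tends to its infimum over
  the whole surface, whatever the base point: the gradient tends to \<open>d\<close>, so tangent planes cannot
  separate different parallel rays.\<close>

lemma ray_support:
  assumes d: "norm d = 1" and p: "m < p \<bullet> d - f p"
  shows "\<exists>r\<ge>0. f (q + r *\<^sub>R d) - (q + r *\<^sub>R d) \<bullet> d < - m"
proof (rule ccontr)
  assume "\<not> ?thesis"
  moreover have dd: "d \<bullet> d = 1" using d by (simp add: norm_eq_1)
  ultimately have ge: "f (q + r *\<^sub>R d) \<ge> q \<bullet> d + r - m" if "r \<ge> 0" for r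
    using that by (auto simp: inner_add_left not_less)
  define \<eta> where "\<eta> = p \<bullet> d - f p - m"
  define B where "B = norm (p - q) + 1"
  \<comment> \<open>From \<open>norm g \<le> 1\<close> and
    \<open>g \<bullet> d > 1 - \<delta>\<close> the square of \<open>norm (g - d)\<close> is at most
    \<open>2 * \<delta>\<close>; this choice makes the deviation of the tangent plane between
    \<open>q\<close> and \<open>p\<close> less than \<eta>.\<close>
  define \<delta> where "\<delta> = (\<eta> / B)\<^sup>2 / 4"
  have "\<eta> > 0" "B > 0" using p by (auto simp: \<eta>_def B_def add_nonneg_pos)
  then have "\<delta> > 0" by (simp add: \<delta>_def)
  \<comment> \<open>By \<open>ge\<close> the function rises by \<open>r\<close> up to a constant,
    while the tangent at the far point allows a rise of at most \<open>r * (g \<bullet> d)\<close>;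
    for this \<open>r\<close> the slope must exceed \<open>1 - \<delta>\<close>.\<close>
  define r where "r = max 0 ((f q - q \<bullet> d + m) / \<delta> + 1)"
  have r: "r \<ge> 0" "r > (f q - q \<bullet> d + m) / \<delta>" by (auto simp: r_def)
  define g where "g = grad (q + r *\<^sub>R d)"
  have "f (q + r *\<^sub>R d) \<le> f q + r * (g \<bullet> d)"
    using tangent_le[of "q + r *\<^sub>R d" q] by (simp add: g_def)
  moreover have "r * \<delta> > f q - q \<bullet> d + m" using r(2) \<open>\<delta> > 0\<close> by (simp add: field_simps)
  ultimately have "r * (1 - \<delta>) < r * (g \<bullet> d)" using ge[OF r(1)] by (simp add: algebra_simps)
  then have gd: "g \<bullet> d > 1 - \<delta>" using r(1) by (simp add: mult_less_cancel_left)
  have "(norm g)\<^sup>2 \<le> 1" using spacelike[of "q + r *\<^sub>R d"] by (simp add: g_def abs_square_le_1)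
  then have "(norm (g - d))\<^sup>2 \<le> 2 * \<delta>"
    using gd dd by (simp add: power2_norm_eq_inner inner_diff_left inner_diff_right inner_commute)
  also have "\<dots> \<le> (\<eta> / B)\<^sup>2" by (simp add: \<delta>_def)
  finally have "norm (g - d) \<le> \<eta> / B"
    using \<open>\<eta> > 0\<close> \<open>B > 0\<close> by (simp add: power2_le_iff_abs_le)
  then have "norm (g - d) * norm (p - q) \<le> \<eta> / B * norm (p - q)" by (rule mult_right_mono) simp
  also have "\<dots> < \<eta>" using \<open>\<eta> > 0\<close> \<open>B > 0\<close> by (simp add: field_simps B_def)
  finally have "\<bar>(g - d) \<bullet> (p - q)\<bar> < \<eta>"
    using Cauchy_Schwarz_ineq2 order.strict_trans1 by blast
  \<comment> \<open>The tangent plane at the far point of the ray from \<open>q\<close> is evaluated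
    on the parallel ray from \<open>p\<close>, along which the height above the null line can only
    have dropped.\<close>
  moreover have "f (q + r *\<^sub>R d) + g \<bullet> (p - q) \<le> f p + r"
    using tangent_le[of "q + r *\<^sub>R d" "p + r *\<^sub>R d"] ray_antimono[OF d r(1), of p] by (simp add: g_def)
  ultimately show False using ge[OF r(1)]
    by (simp add: \<eta>_def inner_diff_left inner_diff_right inner_commute)
qed

text \<open>By \<open>supp\<close> the apex lies on the same side of every null support plane as the
  surface, that is, in the closed domain of dependence. Raising it to \<open>z'\<close> makes every
  null ray leave the cone's side of the surface. The directions in which this has not happened up to
  radius \<open>n\<close> form a decreasing sequence of compact sets without common point, so one of
  them is empty.\<close>

lemma above_cone_bounded:
  assumes supp: "\<And>d m. norm d = 1 \<Longrightarrow> m < q \<bullet> d - z \<Longrightarrow> \<exists>p. m < p \<bullet> d - f p" and "z < z'"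
  shows "\<exists>R. \<forall>p. norm (p - q) \<le> f p - z' \<longrightarrow> norm (p - q) \<le> R"
proof -
  define K where "K n = {d \<in> sphere 0 1. real n \<le> f (q + real n *\<^sub>R d) - z'}" for n :: nat
  have "\<exists>n. K n = {}"
  proof (rule ccontr)
    assume ne: "\<not> ?thesis"
    have "\<Inter> (range K) \<noteq> {}"
    proof (rule compact_nest)
      fix n
      have "closed {d. real n \<le> f (q + real n *\<^sub>R d) - z'}"
        by (intro closed_Collect_le continuous_intros continuous_on_compose2[OF continuous_f[of UNIV]]) auto
      moreover have "K n = sphere 0 1 \<inter> {d. real n \<le> f (q + real n *\<^sub>R d) - z'}" by (auto simp: K_def)
      ultimately show "compact (K n)" by (simp add: compact_Int_closed)
      show "K n \<noteq> {}" using ne by simp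
    next
      fix m n :: nat assume "m \<le> n"
      then show "K n \<subseteq> K m" using ray_antimono[of _ "real m" "real n" q] by (force simp: K_def)
    qed
    then obtain d where d: "\<And>n. d \<in> K n" by blast
    then have nd: "norm d = 1" by (auto simp: K_def)
    obtain p where "q \<bullet> d - z' < p \<bullet> d - f p" using supp[OF nd, of "q \<bullet> d - z'"] \<open>z < z'\<close> by auto
    from ray_support[OF nd this, of q] obtain r where "r \<ge> 0"
      and r: "f (q + r *\<^sub>R d) - (q + r *\<^sub>R d) \<bullet> d < - (q \<bullet> d - z')" by blast
    have "f (q + r *\<^sub>R d) - z' < r" using r nd by (simp add: inner_add_left norm_eq_1)
    moreover obtain n :: nat where "r \<le> real n" using real_arch_simple by blast
    moreover have "real n \<le> f (q + real n *\<^sub>R d) - z'" using d[of n] by (simp add: K_def)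
    ultimately show False using ray_antimono[OF nd \<open>r \<le> real n\<close>, of q] by linarith
  qed
  then obtain n where n: "K n = {}" by blast
  have "norm (p - q) \<le> real n" if p: "norm (p - q) \<le> f p - z'" for p
  proof (rule ccontr)
    assume gt: "\<not> norm (p - q) \<le> real n"
    define s where "s = norm (p - q)"
    define d where "d = (p - q) /\<^sub>R s"
    have s: "s > real n" "s > 0" using gt unfolding s_def by linarith+
    then have nd: "norm d = 1" by (simp add: d_def s_def)
    have "q + s *\<^sub>R d = p" using s by (simp add: d_def)
    then have "d \<in> K n" using ray_antimono[OF nd, of "real n" s q] s p nd by (simp add: K_def s_def)
    then show False using n by simp
  qed
  then show ?thesis by blast
qed

end

section \<open>Second-order conditions at a maximum, and determinants of quadratic forms\<close>

lemma open_line: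
  fixes a v :: "'a::real_normed_vector"
  assumes "open D" "a \<in> D"
  shows "\<exists>\<delta>>0. \<forall>s. \<bar>s\<bar> < \<delta> \<longrightarrow> a + s *\<^sub>R v \<in> D"
proof -
  have "open ((\<lambda>s. a + s *\<^sub>R v) -` D)"
    by (intro open_vimage continuous_intros assms)
  moreover have "(0::real) \<in> (\<lambda>s. a + s *\<^sub>R v) -` D" using assms by simp
  ultimately obtain \<delta> :: real where "\<delta> > 0" "ball 0 \<delta> \<subseteq> (\<lambda>s. a + s *\<^sub>R v) -` D"
    unfolding open_contains_ball by blast
  then show ?thesis by (intro exI[of _ \<delta>]) (auto simp: subset_iff)
qed

lemma second_order_local_max:
  fixes g g' :: "real \<Rightarrow> real"
  assumes der: "\<And>s. \<bar>s\<bar> < \<delta> \<Longrightarrow> (g has_real_derivative g' s) (at s)" and "\<delta> > 0"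
    and der2: "(g' has_real_derivative c) (at 0)"
    and max: "\<And>s. \<bar>s\<bar> < \<delta> \<Longrightarrow> g s \<le> g 0"
  shows "g' 0 = 0" and "c \<le> 0"
proof -
  show 0: "g' 0 = 0"
    by (rule DERIV_local_max[OF der[of 0] \<open>\<delta> > 0\<close>]) (use \<open>\<delta> > 0\<close> max in auto)
  show "c \<le> 0"
  proof (rule ccontr)
    assume "\<not> c \<le> 0"
    then obtain d where d: "d > 0" "\<And>h. h > 0 \<Longrightarrow> h < d \<Longrightarrow> g' 0 < g' (0 + h)"
      using DERIV_pos_inc_right[OF der2] by auto
    define s where "s = min d \<delta> / 2"
    have s: "0 < s" "s < d" "s < \<delta>" using d \<open>\<delta> > 0\<close> by (auto simp: s_def)
    obtain r where r: "0 < r" "r < s" "g s - g 0 = (s - 0) * g' r"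
      using MVT2[of 0 s g g'] der s by auto
    then have "g' r > 0" using d(2)[of r] s 0 by simp
    then show False using r s max[of s] by (smt (verit) mult_pos_pos)
  qed
qed

lemma psd_discriminant:
  fixes a b c :: real
  assumes "\<And>x y. 0 \<le> a * x\<^sup>2 + 2 * b * (x * y) + c * y\<^sup>2"
  shows "0 \<le> a" "0 \<le> c" "b\<^sup>2 \<le> a * c"
proof -
  show a: "0 \<le> a" using assms[of 1 0] by simp
  show c: "0 \<le> c" using assms[of 0 1] by simp
  show "b\<^sup>2 \<le> a * c"
  proof (cases "a = 0")
    case True
    have "b = 0"
    proof (rule ccontr)
      assume "b \<noteq> 0"
      \<comment> \<open>For \<open>a = 0\<close> the form has the value -1 at this point.\<close>
      then show False using assms[of "- (c + 1) / (2 * b)" 1] True by (simp add: field_simps)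
    qed
    then show ?thesis using True by simp
  next
    case False
    have "a * (a * c - b\<^sup>2) \<ge> 0" using assms[of b "- a"] by (simp add: algebra_simps power2_eq_square)
    then show ?thesis using a False by (simp add: zero_le_mult_iff)
  qed
qed

text \<open>The larger form is the sum of two positive semidefinite ones. Its determinant is the sum
  of their determinants plus the mixed term \<open>P + Q - 2 * (b * (b' - b))\<close>, which is
  nonnegative by the two discriminant inequalities and the inequality of arithmetic and geometric
  means.\<close>

lemma det_mono:
  fixes a b c a' b' c' :: real
  assumes nonneg: "\<And>x y. 0 \<le> a * x\<^sup>2 + 2 * b * (x * y) + c * y\<^sup>2"
    and le: "\<And>x y. a * x\<^sup>2 + 2 * b * (x * y) + c * y\<^sup>2 \<le> a' * x\<^sup>2 + 2 * b' * (x * y) + c' * y\<^sup>2"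
  shows "a * c - b\<^sup>2 \<le> a' * c' - b'\<^sup>2"
proof -
  have D: "0 \<le> (a' - a) * x\<^sup>2 + 2 * (b' - b) * (x * y) + (c' - c) * y\<^sup>2" for x y
    using le[of x y] by (simp add: algebra_simps)
  note A = psd_discriminant[OF nonneg] and D = psd_discriminant[OF D]
  define P Q where "P = a * (c' - c)" and "Q = c * (a' - a)"
  have PQ: "0 \<le> P" "0 \<le> Q" using A D by (auto simp: P_def Q_def)
  have "(b * (b' - b))\<^sup>2 \<le> (a * c) * ((a' - a) * (c' - c))"
    unfolding power_mult_distrib using A D by (intro mult_mono) auto
  also have "\<dots> = P * Q" by (simp add: P_def Q_def)
  finally have "(2 * (b * (b' - b)))\<^sup>2 \<le> 4 * (P * Q)" by (simp add: power_mult_distrib)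
  also have "\<dots> \<le> (P + Q)\<^sup>2" using zero_le_square[of "P - Q"] by (simp add: power2_eq_square algebra_simps)
  finally have "(2 * (b * (b' - b)))\<^sup>2 \<le> (P + Q)\<^sup>2" .
  then have "2 * (b * (b' - b)) \<le> P + Q"
    by (rule power2_le_imp_le) (use PQ in simp)
  moreover have "a' * c' - b'\<^sup>2 - (a * c - b\<^sup>2) = P + Q - 2 * (b * (b' - b)) + ((a' - a) * (c' - c) - (b' - b)\<^sup>2)"
    by (simp add: P_def Q_def power2_eq_square algebra_simps)
  ultimately show ?thesis using D(3) by linarith
qed

text \<open>The Gaussian curvature of a spacelike graph is minus the Hessian determinant divided by
  \<open>(1 - (norm (grad p))\<^sup>2)\<^sup>2\<close>, so \<open>curved\<close> says that it is at
  most \<open>- \<kappa>\<close>. Both comparison arguments use the curvature in this form;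
  \<open>gauss_curvature_graph\<close> links it with the holonomy definition.\<close>

locale curved_graph = spacelike_graph +
  fixes \<kappa> :: real
  assumes kappa_pos: "\<kappa> > 0"
    and curved: "\<kappa> * (1 - (norm (grad p))\<^sup>2)\<^sup>2 \<le> hess_determinant p"
begin

text \<open>The function \<open>(f - z)\<^sup>2 - \<bar>p - q\<bar>\<^sup>2\<close> is minus the squared Lorentzian distance to the apex; it is
  maximal where the surface is tangent to a hyperboloid with the same apex; there the curvature
  bound limits the radius of the hyperboloid.\<close>

lemma hyperboloid_comparison:
  assumes supp: "\<And>d m. norm d = 1 \<Longrightarrow> m < q \<bullet> d - z \<Longrightarrow> \<exists>p. m < p \<bullet> d - f p" and "z < f p"
  shows "(f p - z)\<^sup>2 \<le> 1 / \<kappa> + (norm (p - q))\<^sup>2"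
proof -
  \<comment> \<open>For an apex raised to \<open>z' > z\<close> the part of the surface above the
    cone is compact, so that the maximum is attained; in the end \<open>z'\<close> tends to
    \<open>z\<close>.\<close>
  have main: "(f p - z')\<^sup>2 \<le> 1 / \<kappa> + (norm (p - q))\<^sup>2" if z': "z < z'" "z' < f p" for z'
  proof -
    define G where "G x = (f x - z')\<^sup>2 - (x - q) \<bullet> (x - q)" for x
    define S where "S = {x. norm (x - q) \<le> f x - z'}"
    have "G p \<le> 1 / \<kappa>"
    proof (cases "p \<in> S")
      case False
      then have "f p - z' \<le> norm (p - q)" by (simp add: S_def)
      then have "(f p - z')\<^sup>2 \<le> (norm (p - q))\<^sup>2" using z' by (intro power_mono) auto
      then have "G p \<le> 0" by (simp add: G_def power2_norm_eq_inner)
      also have "0 \<le> 1 / \<kappa>" using kappa_pos by simp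
      finally show ?thesis .
    next
      case True
      have "\<exists>R. \<forall>p. norm (p - q) \<le> f p - z' \<longrightarrow> norm (p - q) \<le> R"
        by (rule above_cone_bounded[of q z z']) (use supp z' in blast)+
      then obtain R where R: "\<And>x. x \<in> S \<Longrightarrow> norm (x - q) \<le> R" unfolding S_def by blast
      have "S \<subseteq> cball q R" using R by (auto simp: dist_norm norm_minus_commute)
      then have "bounded S" using bounded_subset bounded_cball by blast
      moreover have "closed S" unfolding S_def
        by (intro closed_Collect_le continuous_intros continuous_f)
      ultimately have "compact S" by (simp add: compact_eq_bounded_closed)
      moreover have "continuous_on S G" unfolding G_def by (intro continuous_intros continuous_f)
      ultimately obtain a where a: "a \<in> S" "\<And>x. x \<in> S \<Longrightarrow> G x \<le> G a"
        using continuous_attains_sup[of S G] True by blast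
      show ?thesis
      proof (cases "G a \<le> 0")
        case True
        then show ?thesis using a(2)[OF \<open>p \<in> S\<close>] kappa_pos by (smt (verit) divide_nonneg_pos)
      next
        case False
        define t where "t = f a - z'"
        define g where "g = grad a"
        have "(norm (a - q))\<^sup>2 < t\<^sup>2" using False by (simp add: G_def t_def power2_norm_eq_inner)
        moreover have "t \<ge> 0" using a(1) norm_ge_zero[of "a - q"] by (simp add: S_def t_def del: norm_ge_zero)
        ultimately have at: "norm (a - q) < t" using power2_less_imp_less by blast
        then have t: "t > 0" using norm_ge_zero[of "a - q"] by linarith
        have "open {x. norm (x - q) < f x - z'}"
          by (intro open_Collect_less continuous_intros continuous_f)
        moreover have "a \<in> {x. norm (x - q) < f x - z'}" using at by (simp add: t_def)
        ultimately have line: "\<exists>\<delta>>0. \<forall>s. \<bar>s\<bar> < \<delta> \<longrightarrow> a + s *\<^sub>R v \<in> {x. norm (x - q) < f x - z'}" for v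
          by (rule open_line)
        \<comment> \<open>First and second derivative of \<open>G\<close> along a line through the
          maximum, divided by 2. The first one says that the surface and the hyperboloid have the
          same tangent plane.\<close>
        have crit: "g \<bullet> v * t = (a - q) \<bullet> v" "(g \<bullet> v)\<^sup>2 + t * (hess a v \<bullet> v) \<le> v \<bullet> v" for v
        proof -
          obtain \<delta> where \<delta>: "\<delta> > 0" and in_S: "\<And>s. \<bar>s\<bar> < \<delta> \<Longrightarrow> a + s *\<^sub>R v \<in> S"
            using line[of v] by (auto simp: S_def less_imp_le)
          let ?G = "\<lambda>s. G (a + s *\<^sub>R v)"
          let ?G' = "\<lambda>s. 2 * (f (a + s *\<^sub>R v) - z') * (grad (a + s *\<^sub>R v) \<bullet> v) - 2 * ((a - q) \<bullet> v + s * (v \<bullet> v))"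
          have Gq: "G (a + s *\<^sub>R v) = (f (a + s *\<^sub>R v) - z')\<^sup>2 - ((a - q) \<bullet> (a - q) + 2 * s * ((a - q) \<bullet> v) + s\<^sup>2 * (v \<bullet> v))" for s
            by (simp add: G_def algebra_simps power2_eq_square inner_commute)
          have d1: "(?G has_real_derivative ?G' s) (at s)" for s
            unfolding Gq by (rule derivative_eq_intros deriv_f_line refl | simp add: algebra_simps)+
          have d2: "(?G' has_real_derivative 2 * (g \<bullet> v)\<^sup>2 + 2 * t * (hess a v \<bullet> v) - 2 * (v \<bullet> v)) (at 0)"
            by (rule derivative_eq_intros deriv_f_line deriv_grad_line refl
               | simp add: algebra_simps g_def t_def power2_eq_square)+
          note so = second_order_local_max[of \<delta> ?G ?G', OF d1 \<delta> d2]
          have "?G' 0 = 0" by (rule so(1)) (use a(2)[OF in_S] in auto)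
          then show "g \<bullet> v * t = (a - q) \<bullet> v" by (simp add: g_def t_def algebra_simps)
          have "2 * (g \<bullet> v)\<^sup>2 + 2 * t * (hess a v \<bullet> v) - 2 * (v \<bullet> v) \<le> 0"
            by (rule so(2)) (use a(2)[OF in_S] in auto)
          then show "(g \<bullet> v)\<^sup>2 + t * (hess a v \<bullet> v) \<le> v \<bullet> v" by simp
        qed
        have aq: "a - q = t *\<^sub>R g"
          by (rule vector_eq_rdot[THEN iffD1]) (use crit(1) in \<open>simp add: mult.commute\<close>)
        have Ga: "G a = t\<^sup>2 * (1 - (norm g)\<^sup>2)"
          unfolding G_def t_def[symmetric] aq power2_norm_eq_inner
          by (simp add: right_diff_distrib power2_eq_square)
        define A B C where "A = hess a (1,0) \<bullet> (1,0)" and "B = hess a (1,0) \<bullet> (0,1)" and "C = hess a (0,1) \<bullet> (0,1)"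
        have hq: "hess a (x, y) \<bullet> (x, y) = A * x\<^sup>2 + 2 * B * (x * y) + C * y\<^sup>2" for x y
        proof -
          have e: "(x, y) = x *\<^sub>R (1, 0) + y *\<^sub>R (0, 1)" by simp
          have "hess a (x, y) = x *\<^sub>R hess a (1, 0) + y *\<^sub>R hess a (0, 1)"
            by (subst e) (simp only: linear_simps[OF hess_linear])
          then show ?thesis using hess_sym[of a "(1,0)" "(0,1)"]
            by (subst e) (simp only: inner_add_left inner_add_right inner_scaleR_left inner_scaleR_right A_def B_def C_def, simp add: power2_eq_square algebra_simps)
        qed
        obtain g1 g2 where g12: "g = (g1, g2)" by fastforce
        \<comment> \<open>By \<open>crit(2)\<close> the Hessian times \<open>t\<close> is at most
          the identity minus the square of the linear form \<open>g\<close>. This is the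
          corresponding form of the hyperboloid, and its determinant is
          \<open>1 - (norm g)\<^sup>2\<close>.\<close>
        have "(t * A) * (t * C) - (t * B)\<^sup>2 \<le> (1 - g1\<^sup>2) * (1 - g2\<^sup>2) - (- (g1 * g2))\<^sup>2"
        proof (rule det_mono)
          fix x y :: real
          have eq: "t * A * x\<^sup>2 + 2 * (t * B) * (x * y) + t * C * y\<^sup>2 = t * (hess a (x, y) \<bullet> (x, y))"
            unfolding hq by (simp add: algebra_simps)
          show "0 \<le> t * A * x\<^sup>2 + 2 * (t * B) * (x * y) + t * C * y\<^sup>2"
            unfolding eq using t hess_nonneg by simp
          show "t * A * x\<^sup>2 + 2 * (t * B) * (x * y) + t * C * y\<^sup>2 \<le>
            (1 - g1\<^sup>2) * x\<^sup>2 + 2 * - (g1 * g2) * (x * y) + (1 - g2\<^sup>2) * y\<^sup>2"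
            unfolding eq using crit(2)[of "(x, y)"] by (simp add: g12 power2_eq_square algebra_simps)
        qed
        then have "t\<^sup>2 * (A * C - B\<^sup>2) \<le> 1 - (norm g)\<^sup>2"
          by (simp add: g12 norm_Pair algebra_simps power2_eq_square)
        moreover have "t\<^sup>2 * (\<kappa> * (1 - (norm g)\<^sup>2)\<^sup>2) \<le> t\<^sup>2 * (A * C - B\<^sup>2)"
          using curved[of a] by (intro mult_left_mono) (auto simp: A_def B_def C_def g_def)
        ultimately have "(t\<^sup>2 * \<kappa> * (1 - (norm g)\<^sup>2)) * (1 - (norm g)\<^sup>2) \<le> 1 * (1 - (norm g)\<^sup>2)"
          by (simp add: power2_eq_square mult.assoc)
        moreover have "1 - (norm g)\<^sup>2 > 0" using spacelike[of a] by (simp add: g_def abs_square_less_1)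
        ultimately have "t\<^sup>2 * \<kappa> * (1 - (norm g)\<^sup>2) \<le> 1" using mult_right_le_imp_le by blast
        then have "G a \<le> 1 / \<kappa>" using kappa_pos by (simp add: Ga field_simps)
        then show ?thesis using a(2)[OF \<open>p \<in> S\<close>] by simp
      qed
    qed
    then show ?thesis by (simp add: G_def power2_norm_eq_inner)
  qed
  have "((\<lambda>z'. (f p - z')\<^sup>2) \<longlongrightarrow> (f p - z)\<^sup>2) (at_right z)" by (intro tendsto_intros)
  moreover have "eventually (\<lambda>z'. (f p - z')\<^sup>2 \<le> 1 / \<kappa> + (norm (p - q))\<^sup>2) (at_right z)"
    using main \<open>z < f p\<close> unfolding eventually_at_right_field by blast
  ultimately show ?thesis
    using tendsto_upperbound trivial_limit_at_right_real by blast
qed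

end

section \<open>Null coordinates and the barrier\<close>

text \<open>The barrier and its derivatives in \<open>u\<close> are odd powers of the inverse root.
  Integer powers keep the final inequality polynomial; the same rule later differentiates the
  inverse of the area density.\<close>

lemma DERIV_inverse_sqrt_power:
  assumes "x > 0"
  shows "((\<lambda>x. inverse (sqrt x) ^ k) has_real_derivative - (real k / 2) * inverse (sqrt x) ^ (k + 2)) (at x)"
proof -
  have "((\<lambda>x. inverse (sqrt x)) has_real_derivative - (inverse (sqrt x) * (inverse (sqrt x) / 2) * inverse (sqrt x))) (at x)"
    using assms by (auto intro!: derivative_eq_intros)
  from DERIV_power[OF this, of k] show ?thesis
    by (rule DERIV_cong) (cases k; simp add: algebra_simps)
qed

locale directed_graph = spacelike_graph +
  fixes e n :: plane and c :: real
  assumes norm_e: "norm e = 1" and n_def: "n = (- snd e, fst e)"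
begin

text \<open>\<open>u\<close> is minus the Lorentzian product with the null vector, normalised by \<open>c\<close> to have infimum 0.\<close>

definition u :: "plane \<Rightarrow> real" where "u p = f p - p \<bullet> e + c"
definition F :: "plane \<Rightarrow> real" where "F p = (f p + p \<bullet> e + c) / 2"

lemma e_sq: "(fst e)\<^sup>2 + (snd e)\<^sup>2 = 1"
  using norm_e by (cases e) (simp add: norm_Pair real_sqrt_eq_1_iff)

lemma e_e [simp]: "e \<bullet> e = 1" and n_n [simp]: "n \<bullet> n = 1" and e_n [simp]: "e \<bullet> n = 0" "n \<bullet> e = 0"
  using e_sq by (auto simp: n_def inner_prod_def power2_eq_square)

lemma norm_n: "norm n = 1"
  by (simp add: norm_eq_1)

lemma inner_decomp: "v \<bullet> w = (v \<bullet> e) * (w \<bullet> e) + (v \<bullet> n) * (w \<bullet> n)"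
proof -
  obtain a b x y x' y' where [simp]: "e = (a, b)" "v = (x, y)" "w = (x', y')" by fastforce
  have "(v \<bullet> e) * (w \<bullet> e) + (v \<bullet> n) * (w \<bullet> n) = (a\<^sup>2 + b\<^sup>2) * (x * x' + y * y')"
    by (simp add: n_def algebra_simps power2_eq_square)
  then show ?thesis using e_sq by simp
qed

lemma norm_decomp: "(norm v)\<^sup>2 = (v \<bullet> e)\<^sup>2 + (v \<bullet> n)\<^sup>2"
  unfolding power2_norm_eq_inner using inner_decomp[of v v] by (simp only: power2_eq_square)

lemma hess_quadratic:
  "hess p (x *\<^sub>R e + y *\<^sub>R n) \<bullet> (x *\<^sub>R e + y *\<^sub>R n) =
   (hess p e \<bullet> e) * x\<^sup>2 + 2 * (hess p e \<bullet> n) * (x * y) + (hess p n \<bullet> n) * y\<^sup>2"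
  using hess_sym[of p e n]
  by (simp add: linear_simps[OF hess_linear] inner_add_left inner_add_right algebra_simps power2_eq_square)

lemma hess_det:
  "(hess p e \<bullet> e) * (hess p n \<bullet> n) - (hess p e \<bullet> n)\<^sup>2 =
   hess_determinant p"
proof -
  obtain a b where e: "e = (a, b)" by fastforce
  have lin: "hess p (x, y) = x *\<^sub>R hess p (1, 0) + y *\<^sub>R hess p (0, 1)" for x y
  proof -
    have "hess p (x *\<^sub>R (1, 0) + y *\<^sub>R (0, 1)) = x *\<^sub>R hess p (1, 0) + y *\<^sub>R hess p (0, 1)"
      by (simp only: linear_simps[OF hess_linear])
    then show ?thesis by simp
  qed
  obtain h1 h2 k1 k2 where h: "hess p (1, 0) = (h1, h2)" "hess p (0, 1) = (k1, k2)" by fastforce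
  have "k1 = h2" using hess_sym[of p "(1,0)" "(0,1)"] by (simp add: h)
  then have "(hess p e \<bullet> e) * (hess p n \<bullet> n) - (hess p e \<bullet> n)\<^sup>2 = (a\<^sup>2 + b\<^sup>2)\<^sup>2 * (h1 * k2 - h2\<^sup>2)"
    unfolding n_def e by (simp add: lin[of a b] lin[of "- b" a] h algebra_simps power2_eq_square)
  then show ?thesis using e_sq \<open>k1 = h2\<close> by (simp add: e h)
qed

lemma u_line: "((\<lambda>s. u (p + s *\<^sub>R v)) has_real_derivative grad (p + s *\<^sub>R v) \<bullet> v - v \<bullet> e) (at s within S)"
  unfolding u_def inner_add_left inner_scaleR_left by (rule derivative_eq_intros deriv_f_line refl | simp)+

lemma F_line: "((\<lambda>s. F (p + s *\<^sub>R v)) has_real_derivative (grad (p + s *\<^sub>R v) \<bullet> v + v \<bullet> e) / 2) (at s within S)"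
  unfolding F_def inner_add_left inner_scaleR_left by (rule derivative_eq_intros deriv_f_line refl | simp)+

lemma continuous_u: "continuous_on S u" and continuous_F: "continuous_on S F"
  unfolding u_def F_def by (intro continuous_intros continuous_f; simp)+

lemma p_e: "p \<bullet> e = F p - u p / 2"
  by (simp add: F_def u_def field_simps)

end

text \<open>The barrier is \<open>F = C cosh (\<mu> y) s\<^sup>-\<^sup>1\<^sup>/\<^sup>2\<close> with \<open>s = u - u\<^sub>0\<close>, where the surface is written as a graph of
  \<open>F\<close> over the null plane with coordinates \<open>u\<close>, \<open>y\<close>. In these coordinates the curvature bound reads
  \<open>det D\<^sup>2 F \<ge> \<kappa> (2 F\<^sub>u + F\<^sub>y\<^sup>2)\<^sup>2\<close>.\<close>

locale curved_directed_graph = directed_graph + curved_graph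
begin

text \<open>At an interior maximum of \<open>F\<close> minus the product, the product as a function
  of \<open>(u, y)\<close> has the first derivatives of the surface and the larger second
  derivatives, so it inherits the curvature inequality. The surface is not rewritten as a graph over
  the null plane: the change of coordinates is made on tangent vectors at \<open>a\<close>
  only.\<close>

lemma null_graph_second_order:
  assumes D: "open D" "a \<in> D" and s_pos: "\<And>p. p \<in> D \<Longrightarrow> u p > u0"
    and ch: "\<And>y. (ch has_real_derivative sh y) (at y)" "\<And>y. (sh has_real_derivative cc y) (at y)"
    and p: "\<And>s. s > 0 \<Longrightarrow> (p has_real_derivative p1 s) (at s)" "\<And>s. s > 0 \<Longrightarrow> (p1 has_real_derivative p2 s) (at s)"
    and max: "\<And>x. x \<in> D \<Longrightarrow> F x - ch (x \<bullet> n) * p (u x - u0) \<le> F a - ch (a \<bullet> n) * p (u a - u0)"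
    and y: "y = a \<bullet> n" and s: "s = u a - u0"
  shows "\<kappa> * (2 * (ch y * p1 s) + (sh y * p s)\<^sup>2)\<^sup>2 \<le> (ch y * p2 s) * (cc y * p s) - (sh y * p1 s)\<^sup>2"
proof -
  define g where "g = grad a"
  \<comment> \<open>Along the line the rates of \<open>u\<close> and \<open>y\<close> are
    \<open>grad \<bullet> v - v \<bullet> e\<close> and \<open>v \<bullet> n\<close>. The second
    derivative of \<open>u\<close> brings in the Hessian of \<open>f\<close> once more, whence the
    factor \<open>1 / 2 - ch y * p1 s\<close>.\<close>
  have crit: "(g \<bullet> v + v \<bullet> e) / 2 = sh y * (v \<bullet> n) * p s + ch y * p1 s * (g \<bullet> v - v \<bullet> e)"
    "(hess a v \<bullet> v) * (1 / 2 - ch y * p1 s) \<le> ch y * p2 s * (g \<bullet> v - v \<bullet> e)\<^sup>2 +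
       2 * (sh y * p1 s) * ((g \<bullet> v - v \<bullet> e) * (v \<bullet> n)) + cc y * p s * (v \<bullet> n)\<^sup>2" for v
  proof -
    obtain \<delta> where \<delta>: "\<delta> > 0" and in_D: "\<And>t. \<bar>t\<bar> < \<delta> \<Longrightarrow> a + t *\<^sub>R v \<in> D"
      using open_line[OF D, of v] by blast
    let ?y = "\<lambda>t. y + t * (v \<bullet> n)" and ?s = "\<lambda>t. u (a + t *\<^sub>R v) - u0" and ?g = "\<lambda>t. grad (a + t *\<^sub>R v) \<bullet> v"
    let ?E = "\<lambda>t. F (a + t *\<^sub>R v) - ch (?y t) * p (?s t)"
    let ?E' = "\<lambda>t. (?g t + v \<bullet> e) / 2 - (sh (?y t) * (v \<bullet> n) * p (?s t) + ch (?y t) * (p1 (?s t) * (?g t - v \<bullet> e)))"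
    have s': "(?s has_real_derivative ?g t - v \<bullet> e) (at t)" for t
      by (rule derivative_eq_intros u_line refl | simp)+
    have y': "(?y has_real_derivative v \<bullet> n) (at t)" for t
      by (rule derivative_eq_intros refl | simp)+
    have pos: "?s t > 0" if "\<bar>t\<bar> < \<delta>" for t using s_pos[OF in_D[OF that]] by simp
    note der = DERIV_chain2[OF ch(1) y'] DERIV_chain2[OF ch(2) y'] DERIV_chain2[OF p(1) s'] DERIV_chain2[OF p(2) s']
    have d1: "(?E has_real_derivative ?E' t) (at t)" if "\<bar>t\<bar> < \<delta>" for t
      by (rule DERIV_cong, (rule derivative_intros der F_line pos[OF that])+) simp
    have d2: "(?E' has_real_derivative (hess a v \<bullet> v) / 2 - (cc y * (v \<bullet> n)\<^sup>2 * p s + 2 * (sh y * (v \<bullet> n) * p1 s * (g \<bullet> v - v \<bullet> e))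
       + ch y * (p2 s * (g \<bullet> v - v \<bullet> e)\<^sup>2 + p1 s * (hess a v \<bullet> v)))) (at 0)"
      using pos[of 0] \<delta>
      by - (rule DERIV_cong, (rule derivative_intros der deriv_grad_line | simp)+, simp add: g_def y s power2_eq_square algebra_simps)
    have mx: "?E t \<le> ?E 0" if "\<bar>t\<bar> < \<delta>" for t
      using max[OF in_D[OF that]] by (simp add: inner_add_left y s)
    note so = second_order_local_max[of \<delta> ?E ?E', OF d1 \<delta> d2 mx]
    show "(g \<bullet> v + v \<bullet> e) / 2 = sh y * (v \<bullet> n) * p s + ch y * p1 s * (g \<bullet> v - v \<bullet> e)"
      using so(1) by (simp add: g_def s)
    show "(hess a v \<bullet> v) * (1 / 2 - ch y * p1 s) \<le> ch y * p2 s * (g \<bullet> v - v \<bullet> e)\<^sup>2 +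
       2 * (sh y * p1 s) * ((g \<bullet> v - v \<bullet> e) * (v \<bullet> n)) + cc y * p s * (v \<bullet> n)\<^sup>2"
      using so(2) by (simp add: algebra_simps)
  qed
  define ge gn Fs Fy where "ge = g \<bullet> e" and "gn = g \<bullet> n" and "Fs = ch y * p1 s" and "Fy = sh y * p s"
  define w where "w = 1 - ge"
  have w: "w > 0" using grad_inner_less[OF norm_e, of a] by (simp add: w_def ge_def g_def)
  have c1: "(1 + ge) / 2 = - Fs * w" using crit(1)[of e] by (simp add: ge_def Fs_def w_def algebra_simps)
  have c2: "gn / 2 = Fy + Fs * gn" using crit(1)[of n] by (simp add: gn_def Fs_def Fy_def)
  have half: "1 / 2 - Fs = 1 / w" using c1 w by (simp add: field_simps w_def)
  have Fyw: "Fy * w = gn"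
  proof -
    have "Fy = gn * (1 / 2 - Fs)" using c2 by (simp add: algebra_simps)
    then show ?thesis unfolding half using w by simp
  qed
  have norm_g: "(norm g)\<^sup>2 = ge\<^sup>2 + gn\<^sup>2" by (simp add: norm_decomp ge_def gn_def)
  define A B C where "A = hess a e \<bullet> e" and "B = hess a e \<bullet> n" and "C = hess a n \<bullet> n"
  \<comment> \<open>The tangent vector with \<open>u\<close>-rate \<open>x\<close> and
    \<open>y\<close>-rate \<open>z\<close>; it exists because \<open>w > 0\<close>.\<close>
  let ?v = "\<lambda>x z. ((z * gn - x) / w) *\<^sub>R e + z *\<^sub>R n"
  have vn: "?v x z \<bullet> n = z" for x z by (simp add: inner_add_left)
  have vs: "g \<bullet> ?v x z - ?v x z \<bullet> e = x" for x z
  proof -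
    have "g \<bullet> (k *\<^sub>R e + z *\<^sub>R n) - (k *\<^sub>R e + z *\<^sub>R n) \<bullet> e = z * gn - k * w" for k
      by (simp add: inner_add_left inner_add_right ge_def gn_def w_def algebra_simps)
    then have "g \<bullet> ?v x z - ?v x z \<bullet> e = z * gn - (z * gn - x) / w * w" .
    then show ?thesis using w by simp
  qed
  \<comment> \<open>The Hessian of \<open>F\<close> as a function of \<open>(u, y)\<close>. Its
    determinant is that of \<open>f\<close> divided by \<open>w ^ 4\<close>.\<close>
  let ?a = "A / w ^ 3" and ?b = "- (A * gn / w ^ 3 + B / w\<^sup>2)" and ?c = "A * gn\<^sup>2 / w ^ 3 + 2 * B * gn / w\<^sup>2 + C / w"
  have q: "(hess a (?v x z) \<bullet> ?v x z) * (1 / w) =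
    ?a * x\<^sup>2 + 2 * ?b * (x * z) + ?c * z\<^sup>2" for x z
    unfolding hess_quadratic A_def[symmetric] B_def[symmetric] C_def[symmetric]
    using w by (simp add: field_simps power2_eq_square power3_eq_cube)
  have "?a * ?c - ?b\<^sup>2
    \<le> (ch y * p2 s) * (cc y * p s) - (sh y * p1 s)\<^sup>2"
  proof (rule det_mono)
    fix x z
    show "0 \<le> ?a * x\<^sup>2 + 2 * ?b * (x * z) + ?c * z\<^sup>2"
      unfolding q[symmetric] using hess_nonneg w by simp
    show "?a * x\<^sup>2 + 2 * ?b * (x * z) + ?c * z\<^sup>2
      \<le> ch y * p2 s * x\<^sup>2 + 2 * (sh y * p1 s) * (x * z) + cc y * p s * z\<^sup>2"
      unfolding q[symmetric] using crit(2)[of "?v x z"] by (simp only: vn vs Fs_def[symmetric] half)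
  qed
  also have "?a * ?c - ?b\<^sup>2 = (A * C - B\<^sup>2) / w ^ 4"
    using w by (simp add: field_simps power2_eq_square power3_eq_cube power4_eq_xxxx)
  finally have "(A * C - B\<^sup>2) / w ^ 4 \<le> (ch y * p2 s) * (cc y * p s) - (sh y * p1 s)\<^sup>2" .
  moreover have "\<kappa> * (1 - (norm g)\<^sup>2)\<^sup>2 / w ^ 4 \<le> (A * C - B\<^sup>2) / w ^ 4"
    using curved[of a] w unfolding hess_det[symmetric] A_def B_def C_def g_def by (intro divide_right_mono) auto
  \<comment> \<open>Up to sign this quantity replaces \<open>1 - (norm (grad p))\<^sup>2\<close>
    over the null plane. Its square carries the same factor \<open>w ^ 4\<close> as the determinant,
    so the curvature inequality keeps its form.\<close>
  moreover have "2 * Fs + Fy\<^sup>2 = - (1 - (norm g)\<^sup>2) / w\<^sup>2"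
  proof -
    have Fsw: "Fs * w = - (1 + ge) / 2" using c1 by simp
    have "(2 * Fs + Fy\<^sup>2) * w\<^sup>2 = 2 * (Fs * w) * w + (Fy * w)\<^sup>2" by (simp add: power2_eq_square algebra_simps)
    also have "\<dots> = - (1 - (norm g)\<^sup>2)"
      unfolding Fyw norm_g Fsw by (simp add: w_def power2_eq_square field_simps)
    finally show ?thesis using w by (simp add: field_simps)
  qed
  moreover have "(- x / w\<^sup>2)\<^sup>2 = x\<^sup>2 / w ^ 4" for x :: real
    by (simp add: power_divide flip: power_mult)
  ultimately have "\<kappa> * (2 * Fs + Fy\<^sup>2)\<^sup>2 \<le> (ch y * p2 s) * (cc y * p s) - (sh y * p1 s)\<^sup>2"
    by (simp add: power2_commute[of "(norm g)\<^sup>2" 1])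
  then show ?thesis by (simp add: Fs_def Fy_def)
qed

text \<open>Where \<open>cosh (\<mu> * y) * sqrt u = Q\<close>, the known bound is less than 3/2
  times \<open>(cosh (\<mu> * y))\<^sup>2 / (\<kappa> * Q\<^sup>2)\<close>, while the constant
  \<open>2 / (\<kappa> * Q)\<close> makes the barrier twice this. In the interior
  \<open>\<mu>\<^sup>2 = \<kappa> / 4\<close> is small enough for the barrier to violate
  \<open>null_graph_second_order\<close>, so \<open>F\<close> cannot exceed it.\<close>

lemma barrier_comparison:
  assumes u_pos: "\<And>p. u p > 0" and Q: "Q > 0" and \<mu>: "\<mu> = sqrt \<kappa> / 2"
    and bound: "\<And>p. F p \<le> X (p \<bullet> n) + 1 / (2 * \<kappa> * u p)"
    and X: "\<And>y. X y < (cosh (\<mu> * y))\<^sup>2 / (\<kappa> * Q\<^sup>2)"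
    and p: "cosh (\<mu> * (p \<bullet> n)) * sqrt (u p) < Q"
  shows "F p \<le> 2 / (\<kappa> * Q) * cosh (\<mu> * (p \<bullet> n)) / sqrt (u p)"
proof -
  define C where "C = 2 / (\<kappa> * Q)"
  have C: "C > 0" using Q kappa_pos by (simp add: C_def)
  have \<mu>_pos: "\<mu> > 0" and \<mu>2: "\<mu>\<^sup>2 = \<kappa> / 4" using kappa_pos by (auto simp: \<mu> power_divide)
  define ch sh cc where "ch y = cosh (\<mu> * y)" and "sh y = \<mu> * sinh (\<mu> * y)" and "cc y = \<mu>\<^sup>2 * cosh (\<mu> * y)" for y
  define r where "r s = inverse (sqrt s)" for s :: real
  have ch1: "ch y \<ge> 1" for y by (simp add: ch_def cosh_real_ge_1)
  have ch_abs: "\<mu> * \<bar>y\<bar> \<le> 2 * ch y" for y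
  proof -
    have "\<mu> * \<bar>y\<bar> \<le> exp (\<mu> * \<bar>y\<bar>)" using exp_ge_add_one_self[of "\<mu> * \<bar>y\<bar>"] by linarith
    also have "\<dots> \<le> 2 * cosh (\<mu> * \<bar>y\<bar>)" by (simp add: cosh_def)
    also have "cosh (\<mu> * \<bar>y\<bar>) = ch y" by (cases "y \<ge> 0") (auto simp: ch_def)
    finally show ?thesis .
  qed
  \<comment> \<open>The barrier shifted by \<open>u0\<close> is infinite at \<open>u = u0\<close>,
    which keeps the comparison away from the end \<open>u = 0\<close>, where compactness would fail.
    The shift tends to 0 afterwards.\<close>
  have main: "F p \<le> C * ch (p \<bullet> n) * r (u p - u0)" if u0: "0 < u0" "u0 < u p" for u0
  proof (rule ccontr)
    assume neg: "\<not> ?thesis"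
    define E where "E x = F x - ch (x \<bullet> n) * (C * r (u x - u0))" for x
    \<comment> \<open>Where \<open>E\<close> is nonnegative, the barrier is at most
      \<open>F \<le> 1 / (\<kappa> * u0)\<close>, and this forces
      \<open>sqrt (u x - u0) \<ge> 2 * u0 / Q\<close>. The radius \<open>R\<close> collects the
      bounds for \<open>x \<bullet> e\<close> and \<open>x \<bullet> n\<close>.\<close>
    define \<sigma> where "\<sigma> = (2 * u0 / Q)\<^sup>2"
    define R where "R = 1 / (\<kappa> * u0) + (u0 + Q\<^sup>2) + 2 * (Q / sqrt (2 * u0)) / \<mu>"
    have \<sigma>: "\<sigma> > 0" using u0 Q by (simp add: \<sigma>_def)
    have Ep: "E p > 0" using neg by (simp add: E_def algebra_simps)
    \<comment> \<open>A point with \<open>E x \<ge> 0\<close> is neither on the lateral boundary nor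
      near \<open>u = u0\<close> nor far away, so a positive maximum over the compact set
      \<open>K\<close> is interior.\<close>
    have loc: "ch (x \<bullet> n) * sqrt (u x - u0) < Q \<and> \<sigma> \<le> u x - u0 \<and> norm x \<le> R"
      if x: "u0 < u x" "ch (x \<bullet> n) * sqrt (u x - u0) \<le> Q" "E x \<ge> 0" for x
    proof -
      define s h \<rho> where "s = u x - u0" and "h = ch (x \<bullet> n)" and "\<rho> = sqrt s"
      have s: "s > 0" "\<rho> > 0" "s = \<rho>\<^sup>2" "s < u x" "h \<ge> 1" using x(1) u0 ch1 by (auto simp: s_def \<rho>_def h_def)
      have hQ: "h * \<rho> \<le> Q" using x(2) by (simp add: h_def \<rho>_def s_def)
      have F1: "h * C / \<rho> \<le> F x" using x(3) by (simp add: E_def r_def h_def \<rho>_def s_def divide_inverse)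
      have "h * C * h * \<rho> \<le> h * C * Q"
        using mult_left_mono[OF hQ, of "h * C"] s(5) C by (simp add: mult.assoc)
      then have "2 * h\<^sup>2 / (\<kappa> * Q\<^sup>2) \<le> h * C / \<rho>"
        using s(2) Q kappa_pos by (simp add: C_def field_simps power2_eq_square)
      moreover have F2: "F x < h\<^sup>2 / (\<kappa> * Q\<^sup>2) + 1 / (2 * \<kappa> * u x)"
        using bound[of x] X[of "x \<bullet> n"] by (simp add: h_def ch_def)
      ultimately have h2: "h\<^sup>2 / (\<kappa> * Q\<^sup>2) < 1 / (2 * \<kappa> * u x)" using F1 by (simp add: field_simps)
      then have h2': "h\<^sup>2 < Q\<^sup>2 / (2 * u x)"
        using kappa_pos Q u_pos[of x] by (simp add: field_simps)
      have "h\<^sup>2 * \<rho>\<^sup>2 < Q\<^sup>2"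
      proof -
        have "h\<^sup>2 * \<rho>\<^sup>2 \<le> h\<^sup>2 * u x" using s by (intro mult_left_mono) auto
        also have "\<dots> < Q\<^sup>2 / (2 * u x) * u x" by (rule mult_strict_right_mono[OF h2' u_pos])
        also have "\<dots> \<le> Q\<^sup>2" using u_pos[of x] by simp
        finally show ?thesis .
      qed
      then have 1: "h * \<rho> < Q"
        using Q by (metis power_less_imp_less_base power_mult_distrib less_imp_le)
      have "1 / (2 * \<kappa> * u x) \<le> 1 / (2 * \<kappa> * u0)"
        using x(1) u0 kappa_pos by (intro divide_left_mono) auto
      moreover have "1 / (\<kappa> * u0) = 1 / (2 * \<kappa> * u0) + 1 / (2 * \<kappa> * u0)" by (simp add: field_simps)
      ultimately have FM: "F x \<le> 1 / (\<kappa> * u0)" and h3: "h\<^sup>2 / (\<kappa> * Q\<^sup>2) \<le> 1 / (2 * \<kappa> * u0)"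
        using F2 h2 by linarith+
      have "C / \<rho> \<le> h * C / \<rho>" using s C by (intro divide_right_mono) auto
      then have "C / \<rho> \<le> 1 / (\<kappa> * u0)" using F1 FM by linarith
      then have "2 * u0 / Q \<le> \<rho>" using s Q u0 kappa_pos by (simp add: C_def field_simps)
      then have 2: "\<sigma> \<le> s" using s Q u0 by (simp add: \<sigma>_def power_mono)
      have "h\<^sup>2 \<le> (Q / sqrt (2 * u0))\<^sup>2"
        using h3 kappa_pos Q u0 by (simp add: power_divide field_simps)
      then have "h \<le> Q / sqrt (2 * u0)" using Q u0 by (intro power2_le_imp_le[of h]) auto
      then have "\<mu> * \<bar>x \<bullet> n\<bar> \<le> 2 * (Q / sqrt (2 * u0))" using ch_abs[of "x \<bullet> n"] by (simp add: h_def)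
      then have yn: "\<bar>x \<bullet> n\<bar> \<le> 2 * (Q / sqrt (2 * u0)) / \<mu>"
        using \<mu>_pos by (simp only: pos_le_divide_eq mult.commute)
      have "\<rho> \<le> h * \<rho>" using s by simp
      then have "\<rho> \<le> Q" using 1 by linarith
      then have "s \<le> Q\<^sup>2" using s by (simp add: power_mono)
      moreover have "F x \<ge> 0" using F1 s C by (smt (verit) divide_nonneg_pos mult_nonneg_nonneg)
      ultimately have xe: "\<bar>x \<bullet> e\<bar> \<le> 1 / (\<kappa> * u0) + (u0 + Q\<^sup>2)"
        using FM u_pos[of x] u0 unfolding p_e[of x] s_def by linarith
      have "(norm x)\<^sup>2 \<le> (\<bar>x \<bullet> e\<bar> + \<bar>x \<bullet> n\<bar>)\<^sup>2" by (simp add: norm_decomp power2_sum)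
      then have "norm x \<le> \<bar>x \<bullet> e\<bar> + \<bar>x \<bullet> n\<bar>" by (rule power2_le_imp_le) simp
      then have 3: "norm x \<le> R" using xe yn by (simp add: R_def)
      show ?thesis using 1 2 3 by (simp add: h_def \<rho>_def s_def)
    qed
    define K where "K = {x. norm x \<le> R \<and> u0 + \<sigma> \<le> u x \<and> ch (x \<bullet> n) * sqrt (u x - u0) \<le> Q}"
    have cont_ch: "continuous_on S (\<lambda>x. ch (x \<bullet> n))" for S unfolding ch_def by (intro continuous_intros)
    have "closed K" unfolding K_def
      by (intro closed_Collect_conj closed_Collect_le continuous_intros continuous_u cont_ch)
    moreover have "K \<subseteq> cball 0 R" by (auto simp: K_def)
    ultimately have "compact K" by (meson bounded_cball bounded_subset compact_eq_bounded_closed)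
    moreover have "continuous_on K E" unfolding E_def r_def
      by (intro continuous_intros continuous_u continuous_F cont_ch) (use \<sigma> in \<open>auto simp: K_def\<close>)
    moreover have "sqrt (u p - u0) \<le> sqrt (u p)" using u0 by simp
    then have pQ: "ch (p \<bullet> n) * sqrt (u p - u0) \<le> Q"
      using p ch1[of "p \<bullet> n"] by (smt (verit) ch_def mult_left_mono)
    then have "p \<in> K" using loc[of p] u0 Ep by (auto simp: K_def)
    ultimately obtain a where a: "a \<in> K" "\<And>x. x \<in> K \<Longrightarrow> E x \<le> E a"
      using continuous_attains_sup[of K E] by blast
    have Ea: "E a > 0" using a(2)[OF \<open>p \<in> K\<close>] Ep by linarith
    define D where "D = {x. u0 < u x \<and> ch (x \<bullet> n) * sqrt (u x - u0) < Q}"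
    have "open D" unfolding D_def
      by (intro open_Collect_conj open_Collect_less continuous_intros continuous_u cont_ch)
    have "a \<in> D" using a(1) loc[of a] Ea \<sigma> by (auto simp: D_def K_def)
    define y s where "y = a \<bullet> n" and "s = u a - u0"
    have s: "s > 0" and yQ: "ch y * sqrt s < Q" using \<open>a \<in> D\<close> by (auto simp: D_def s_def y_def)
    let ?p1 = "\<lambda>s. - (C / 2) * r s ^ 3" and ?p2 = "\<lambda>s. 3 / 4 * C * r s ^ 5"
    have "\<kappa> * (2 * (ch y * ?p1 s) + (sh y * (C * r s))\<^sup>2)\<^sup>2 \<le> (ch y * ?p2 s) * (cc y * (C * r s)) - (sh y * ?p1 s)\<^sup>2"
    proof (rule null_graph_second_order[OF \<open>open D\<close> \<open>a \<in> D\<close>, where p = "\<lambda>s. C * r s" and ch = ch])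
      show "\<And>x. x \<in> D \<Longrightarrow> u0 < u x" by (simp add: D_def)
      show "(ch has_real_derivative sh y) (at y)" for y
        unfolding ch_def sh_def by (auto intro!: derivative_eq_intros)
      show "(sh has_real_derivative cc y) (at y)" for y
        unfolding sh_def cc_def by (auto intro!: derivative_eq_intros simp: power2_eq_square)
      show "((\<lambda>s. C * r s) has_real_derivative ?p1 s) (at s)" if "s > 0" for s
        using DERIV_cmult[OF DERIV_inverse_sqrt_power[OF that, of 1], of C] by (simp add: r_def numeral_eq_Suc)
      show "(?p1 has_real_derivative ?p2 s) (at s)" if "s > 0" for s
        using DERIV_cmult[OF DERIV_inverse_sqrt_power[OF that, of 3], of "- (C / 2)"] by (simp add: r_def algebra_simps)
      \<comment> \<open>Points of \<open>D\<close> outside \<open>K\<close> are harmless: there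
        \<open>E\<close> is negative, hence below its positive maximum.\<close>
      show "F x - ch (x \<bullet> n) * (C * r (u x - u0)) \<le> F a - ch (a \<bullet> n) * (C * r (u a - u0))" if "x \<in> D" for x
      proof -
        have "E x \<le> E a"
        proof (cases "E x \<ge> 0")
          case True
          then show ?thesis using loc[of x] that by (intro a(2)) (auto simp: D_def K_def)
        qed (use Ea in simp)
        then show ?thesis by (simp add: E_def)
      qed
    qed (simp_all add: y_def s_def)
    moreover define t where "t = r s"
    moreover have t: "t > 0" and st: "sqrt s = 1 / t" using s by (auto simp: t_def r_def divide_inverse)
    ultimately have fin: "\<kappa> * (C * ch y * t ^ 3 - (sh y)\<^sup>2 * (C * t)\<^sup>2)\<^sup>2 \<le> 3 / 4 * C\<^sup>2 * \<mu>\<^sup>2 * (ch y)\<^sup>2 * t ^ 6 - (sh y * (C / 2 * t ^ 3))\<^sup>2"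
      by (simp add: cc_def ch_def[symmetric] power_mult_distrib power2_commute[of "C * ch y * t ^ 3"] algebra_simps power2_eq_square flip: power_add)
         (simp add: numeral_eq_Suc algebra_simps)
    have hy: "ch y < Q * t" using yQ st t by (simp add: field_simps)
    have shy: "(sh y)\<^sup>2 \<le> \<mu>\<^sup>2 * (ch y)\<^sup>2"
      using cosh_square_eq[of "\<mu> * y"] by (simp add: sh_def ch_def power_mult_distrib mult_left_mono)
    \<comment> \<open>Inside the region \<open>ch y < Q * t\<close>. This limits the square of the
      \<open>y\<close>-derivative of the barrier to half the size of twice its
      \<open>s\<close>-derivative, so the barrier is spacelike with a margin.\<close>
    have "(sh y)\<^sup>2 * (C * t)\<^sup>2 \<le> \<mu>\<^sup>2 * (ch y)\<^sup>2 * (C * t)\<^sup>2"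
      using shy by (rule mult_right_mono) simp
    also have "\<dots> = ch y * (\<mu>\<^sup>2 * ch y * (C * t)\<^sup>2)" by (simp add: power2_eq_square)
    also have "\<dots> \<le> Q * t * (\<mu>\<^sup>2 * ch y * (C * t)\<^sup>2)"
      using hy ch1[of y] by (intro mult_right_mono) auto
    also have "\<dots> = C * ch y * t ^ 3 / 2"
      unfolding \<mu>2 using Q kappa_pos by (simp add: C_def power2_eq_square power3_eq_cube)
    finally have "C * ch y * t ^ 3 / 2 \<le> C * ch y * t ^ 3 - (sh y)\<^sup>2 * (C * t)\<^sup>2" by simp
    moreover have pos: "C * ch y * t ^ 3 / 2 > 0" using C ch1[of y] t by simp
    ultimately have "(C * ch y * t ^ 3 / 2)\<^sup>2 \<le> (C * ch y * t ^ 3 - (sh y)\<^sup>2 * (C * t)\<^sup>2)\<^sup>2"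
      by (intro power_mono) auto
    then have "\<kappa> * (C * ch y * t ^ 3 / 2)\<^sup>2 \<le> 3 / 4 * C\<^sup>2 * \<mu>\<^sup>2 * (ch y)\<^sup>2 * t ^ 6"
      using fin kappa_pos by (smt (verit) mult_left_mono zero_le_power2)
    moreover have sq: "(C * ch y * t ^ 3 / 2)\<^sup>2 = C\<^sup>2 * (ch y)\<^sup>2 * t ^ 6 / 4"
      by (simp add: power_mult_distrib power_divide flip: power_mult)
    \<comment> \<open>A positive quantity would be at most 3/4 of itself. The 3/4 is the coefficient
      in the second derivative of the inverse root, and \<mu> was chosen so that the margin of one
      half is paid for.\<close>
    ultimately have "\<kappa> * (C * ch y * t ^ 3 / 2)\<^sup>2 \<le> 3 / 4 * (\<kappa> * (C * ch y * t ^ 3 / 2)\<^sup>2)"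
      unfolding sq \<mu>2 by (simp only: mult_ac times_divide_eq_left times_divide_eq_right)
    moreover have "\<kappa> * (C * ch y * t ^ 3 / 2)\<^sup>2 > 0" using pos kappa_pos by (intro mult_pos_pos zero_less_power)
    ultimately show False by linarith
  qed
  have "((\<lambda>u0. C * ch (p \<bullet> n) * r (u p - u0)) \<longlongrightarrow> C * ch (p \<bullet> n) * r (u p - 0)) (at_right 0)"
    unfolding r_def using u_pos[of p] by (intro tendsto_intros) auto
  moreover have "eventually (\<lambda>u0. F p \<le> C * ch (p \<bullet> n) * r (u p - u0)) (at_right 0)"
    using main u_pos[of p] unfolding eventually_at_right_field by blast
  ultimately have "F p \<le> C * ch (p \<bullet> n) * r (u p - 0)"
    using tendsto_lowerbound trivial_limit_at_right_real by blast
  then show ?thesis by (simp add: C_def ch_def r_def divide_inverse)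
qed

end

section \<open>Consequences of the growth condition\<close>

lemma one_minus_cos_ge:
  fixes x :: real
  assumes "\<bar>x\<bar> \<le> 1"
  shows "x\<^sup>2 / 4 \<le> 1 - cos x"
proof -
  have cos_half: "cos y \<ge> 1 / 2" if "0 \<le> y" "y \<le> 1" for y :: real
  proof -
    have "cos (pi / 3) \<le> cos y"
      using that pi_gt3 by (intro cos_monotone_0_pi_le) auto
    then show ?thesis by (simp add: cos_60)
  qed
  have sin_ge: "y / 2 \<le> sin y" if "0 \<le> y" "y \<le> 1" for y :: real
  proof -
    have "sin 0 - 0 / 2 \<le> sin y - y / 2"
    proof (rule DERIV_nonneg_imp_nondecreasing[OF that(1), where f = "\<lambda>z. sin z - z / 2"])
      fix z assume "0 \<le> z" "z \<le> y"
      then show "\<exists>D. ((\<lambda>z. sin z - z / 2) has_real_derivative D) (at z) \<and> 0 \<le> D"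
        using cos_half[of z] that by (intro exI[of _ "cos z - 1 / 2"]) (auto intro!: derivative_eq_intros)
    qed
    then show ?thesis by simp
  qed
  have "1 - cos 0 - 0\<^sup>2 / 4 \<le> 1 - cos \<bar>x\<bar> - \<bar>x\<bar>\<^sup>2 / 4"
  proof (rule DERIV_nonneg_imp_nondecreasing[where f = "\<lambda>z. 1 - cos z - z\<^sup>2 / 4"])
    fix z assume "0 \<le> z" "z \<le> \<bar>x\<bar>"
    then show "\<exists>D. ((\<lambda>z. 1 - cos z - z\<^sup>2 / 4) has_real_derivative D) (at z) \<and> 0 \<le> D"
      using sin_ge[of z] assms by (intro exI[of _ "sin z - z / 2"]) (auto intro!: derivative_eq_intros)
  qed simp
  then show ?thesis by simp
qed

lemma power_le_cosh_square:
  fixes \<mu> :: real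
  assumes "\<mu> > 0"
  shows "\<exists>M>0. \<forall>y. (1 + \<bar>y\<bar>) ^ Suc k \<le> M * (cosh (\<mu> * y))\<^sup>2"
proof -
  define N where "N = Suc k"
  define a where "a = min 1 (\<mu> / real N)"
  have a: "0 < a" "a \<le> 1" "a \<le> \<mu> / real N" using assms by (auto simp: a_def N_def)
  have "(1 + \<bar>y\<bar>) ^ N \<le> 2 / a ^ N * (cosh (\<mu> * y))\<^sup>2" for y
  proof -
    have "a * \<bar>y\<bar> \<le> \<mu> * \<bar>y\<bar> / real N" using mult_right_mono[OF a(3), of "\<bar>y\<bar>"] by simp
    then have "a * (1 + \<bar>y\<bar>) \<le> 1 + \<mu> * \<bar>y\<bar> / real N" using a(2) by (simp add: algebra_simps)
    then have "(a * (1 + \<bar>y\<bar>)) ^ N \<le> (1 + \<mu> * \<bar>y\<bar> / real N) ^ N" using a by (intro power_mono) auto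
    also have "\<dots> \<le> exp (\<mu> * \<bar>y\<bar>)"
      using assms by (intro exp_ge_one_plus_x_over_n_power_n) (auto simp: N_def intro: order_trans[of _ 0])
    also have "\<dots> \<le> 2 * cosh (\<mu> * \<bar>y\<bar>)" by (simp add: cosh_def)
    also have "cosh (\<mu> * \<bar>y\<bar>) = cosh (\<mu> * y)" by (cases "y \<ge> 0") auto
    also have "cosh (\<mu> * y) \<le> (cosh (\<mu> * y))\<^sup>2" using cosh_real_ge_1[of "\<mu> * y"] by (simp add: power2_eq_square)
    finally have "a ^ N * (1 + \<bar>y\<bar>) ^ N \<le> 2 * (cosh (\<mu> * y))\<^sup>2" by (simp add: power_mult_distrib)
    then show ?thesis using a by (simp add: field_simps)
  qed
  moreover have "2 / a ^ N > 0" using a by simp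
  ultimately show ?thesis unfolding N_def by blast
qed

context directed_graph begin

lemma u_e_less: "u (p + e) < u p"
  using tangent_le[of "p + e" p] grad_inner_less[OF norm_e, of "p + e"] by (simp add: u_def inner_add_left)

lemma unit_vector_polar:
  assumes "norm d = 1"
  obtains t where "\<bar>t\<bar> \<le> pi" "d = cos t *\<^sub>R e + sin t *\<^sub>R n"
proof -
  have "(d \<bullet> e)\<^sup>2 + (d \<bullet> n)\<^sup>2 = 1" using norm_decomp[of d] assms by simp
  then obtain t where t: "- pi < t" "t \<le> pi" "d \<bullet> e = cos t" "d \<bullet> n = sin t"
    using sincos_total_2pi_le[of "d \<bullet> e" "d \<bullet> n"] by (metis sincos_principal_value)
  have eq: "d \<bullet> x = ((d \<bullet> e) *\<^sub>R e + (d \<bullet> n) *\<^sub>R n) \<bullet> x" for x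
    using inner_decomp[of d x]
    by (simp only: inner_add_left inner_scaleR_left inner_commute[of e x] inner_commute[of n x])
  have "d = cos t *\<^sub>R e + sin t *\<^sub>R n"
    using vector_eq_rdot[THEN iffD1, OF allI, OF eq] by (simp only: t)
  then show thesis using t by (intro that[of t]) auto
qed

end

text \<open>The first two assumptions say that \<open>c\<close> is the supremum defining the null
  support in direction \<open>e\<close>; \<open>growth\<close> bounds the supremum at angle
  \<open>t\<close> from below. Witnesses \<open>p\<close> instead of suprema keep extended reals out
  and cover directions of infinite support.\<close>

locale growing_graph = curved_directed_graph +
  fixes \<epsilon> \<alpha> \<rho> :: real
  assumes supp_le: "p \<bullet> e - f p \<le> c"
    and supp_approx: "m < c \<Longrightarrow> \<exists>p. m < p \<bullet> e - f p"
    and params: "\<epsilon> > 0" "0 < \<alpha>" "\<alpha> < 1" "0 < \<rho>" "\<rho> \<le> 1"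
    and growth: "0 < \<bar>t\<bar> \<Longrightarrow> \<bar>t\<bar> < \<rho> \<Longrightarrow> m < c + \<epsilon> * \<bar>t\<bar> powr \<alpha> \<Longrightarrow> \<exists>p. m < p \<bullet> (cos t *\<^sub>R e + sin t *\<^sub>R n) - f p"
begin

text \<open>The supremum is not attained, because \<open>u\<close> strictly decreases in direction
  \<open>e\<close> and is still nonnegative at \<open>p + e\<close>.\<close>

lemma u_pos: "u p > 0"
  using supp_le[of "p + e"] u_e_less[of p] by (simp add: u_def)

text \<open>Near the distinguished direction the growth condition beats \<open>y sin t\<close> for small \<open>t\<close>, and the
  quadratic term does for the others.\<close>

lemma cone_below:
  obtains B k where "B > 0" "\<And>y d m. norm d = 1 \<Longrightarrow>
    m < (B * (1 + \<bar>y\<bar>) ^ Suc k) * (d \<bullet> e - 1) + y * (d \<bullet> n) + c \<Longrightarrow> \<exists>p. m < p \<bullet> d - f p"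
proof -
  \<comment> \<open>If the growth term does not absorb \<open>\<bar>y\<bar> * \<bar>t\<bar>\<close>,
    then \<open>\<bar>t\<bar> powr (1 - \<alpha>)\<close> exceeds
    \<open>\<epsilon> / \<bar>y\<bar>\<close>. The power \<open>k\<close> turns this into
    \<open>\<epsilon> ^ k \<le> \<bar>t\<bar> * \<bar>y\<bar> ^ k\<close>, which makes a height of
    order \<open>\<bar>y\<bar> ^ Suc k\<close> sufficient.\<close>
  obtain k :: nat where k: "1 / (1 - \<alpha>) \<le> real k" using real_arch_simple by blast
  then have k1: "1 \<le> real k * (1 - \<alpha>)" using params by (simp add: field_simps)
  \<comment> \<open>The first summand serves angles below \<rho>. The second serves the others,
    where the only information about the support function is that it is at least
    \<open>- f 0\<close>.\<close>
  define B where "B = 4 / \<epsilon> ^ k + (\<bar>f 0\<bar> + \<bar>c\<bar> + 1) / (1 - cos \<rho>)"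
  have "cos \<rho> < cos 0" using params pi_gt3 by (intro cos_monotone_0_pi) auto
  then have cr: "1 - cos \<rho> > 0" by simp
  have B1: "B \<ge> 4 / \<epsilon> ^ k" and Bpos: "B > 0"
    using params cr by (auto simp: B_def add_pos_nonneg)
  have "B * (1 - cos \<rho>) = 4 / \<epsilon> ^ k * (1 - cos \<rho>) + (\<bar>f 0\<bar> + \<bar>c\<bar> + 1)"
    unfolding B_def distrib_right[of "4 / \<epsilon> ^ k"] using cr by simp
  moreover have "4 / \<epsilon> ^ k * (1 - cos \<rho>) \<ge> 0" using params cr by simp
  ultimately have B2: "\<bar>f 0\<bar> + \<bar>c\<bar> + 1 \<le> B * (1 - cos \<rho>)" by linarith
  show thesis
  proof (rule that[OF Bpos])
    fix y m :: real and d :: plane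
    define X where "X = B * (1 + \<bar>y\<bar>) ^ Suc k"
    have X: "X \<ge> 0" using Bpos by (simp add: X_def)
    assume d: "norm d = 1" and m: "m < (B * (1 + \<bar>y\<bar>) ^ Suc k) * (d \<bullet> e - 1) + y * (d \<bullet> n) + c"
    obtain t where t: "\<bar>t\<bar> \<le> pi" and dt: "d = cos t *\<^sub>R e + sin t *\<^sub>R n" by (rule unit_vector_polar[OF d])
    have m': "m < c - X * (1 - cos t) + y * sin t"
      using m by (simp add: X_def dt inner_add_left algebra_simps)
    have sin_le: "y * sin t \<le> \<bar>y\<bar> * \<bar>t\<bar>"
      using mult_mono[OF order_refl[of "\<bar>y\<bar>"] abs_sin_x_le_abs_x[of t]] abs_ge_self[of "y * sin t"] by (simp add: abs_mult)
    consider "t = 0" | "0 < \<bar>t\<bar>" "\<bar>t\<bar> < \<rho>" | "\<rho> \<le> \<bar>t\<bar>" by linarith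
    then show "\<exists>p. m < p \<bullet> d - f p"
    proof cases
      case 1
      then show ?thesis using supp_approx[of m] m' by (simp add: dt)
    next
      case 2
      have "y * sin t - X * (1 - cos t) \<le> \<epsilon> * \<bar>t\<bar> powr \<alpha>"
      proof (cases "\<bar>y\<bar> * \<bar>t\<bar> powr (1 - \<alpha>) \<le> \<epsilon>")
        case True
        have "\<bar>t\<bar> = \<bar>t\<bar> powr (1 - \<alpha>) * \<bar>t\<bar> powr \<alpha>" using 2 by (simp flip: powr_add)
        then have "\<bar>y\<bar> * \<bar>t\<bar> = (\<bar>y\<bar> * \<bar>t\<bar> powr (1 - \<alpha>)) * \<bar>t\<bar> powr \<alpha>" by simp
        also have "\<dots> \<le> \<epsilon> * \<bar>t\<bar> powr \<alpha>" using True by (intro mult_right_mono) auto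
        finally show ?thesis using sin_le X by (smt (verit) cos_le_one mult_nonneg_nonneg)
      next
        case False
        then have y0: "\<bar>y\<bar> > 0" using params by auto
        then have gt: "\<epsilon> / \<bar>y\<bar> < \<bar>t\<bar> powr (1 - \<alpha>)" using False by (simp add: pos_divide_less_eq mult.commute)
        have "(\<epsilon> / \<bar>y\<bar>) ^ k \<le> (\<bar>t\<bar> powr (1 - \<alpha>)) ^ k" using gt params by (intro power_mono) auto
        also have "\<dots> = \<bar>t\<bar> powr (real k * (1 - \<alpha>))" using 2 by (simp add: powr_power mult.commute)
        also have "\<dots> \<le> \<bar>t\<bar> powr 1" using 2 params k1 by (intro powr_mono') auto
        finally have tk: "\<epsilon> ^ k \<le> \<bar>t\<bar> * \<bar>y\<bar> ^ k" using y0 2 by (simp add: power_divide field_simps)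
        have "4 / \<epsilon> ^ k * \<bar>y\<bar> ^ Suc k \<le> X"
          unfolding X_def using B1 Bpos params by (intro mult_mono power_mono) auto
        then have "\<bar>t\<bar> * (4 / \<epsilon> ^ k * \<bar>y\<bar> ^ Suc k) \<le> \<bar>t\<bar> * X" by (rule mult_left_mono) simp
        moreover have "4 * \<bar>y\<bar> \<le> \<bar>t\<bar> * (4 / \<epsilon> ^ k * \<bar>y\<bar> ^ Suc k)"
          using mult_left_mono[OF tk, of "4 * \<bar>y\<bar>"] params by (simp add: field_simps)
        ultimately have "\<bar>y\<bar> * \<bar>t\<bar> \<le> (\<bar>t\<bar> * X / 4) * \<bar>t\<bar>" by (intro mult_right_mono) auto
        also have "\<dots> = X * (t\<^sup>2 / 4)" by (simp add: power2_eq_square flip: abs_mult)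
        also have "\<dots> \<le> X * (1 - cos t)" using 2 params X by (intro mult_left_mono one_minus_cos_ge) auto
        finally have "y * sin t - X * (1 - cos t) \<le> 0" using sin_le by linarith
        moreover have "0 \<le> \<epsilon> * \<bar>t\<bar> powr \<alpha>" using params by simp
        ultimately show ?thesis by linarith
      qed
      then have "m < c + \<epsilon> * \<bar>t\<bar> powr \<alpha>" using m' by linarith
      then show ?thesis unfolding dt by (rule growth[OF 2])
    next
      case 3
      have "cos \<bar>t\<bar> \<le> cos \<rho>" using 3 t params by (intro cos_monotone_0_pi_le) auto
      then have ct: "1 - cos \<rho> \<le> 1 - cos t" by simp
      have "\<bar>f 0\<bar> + \<bar>c\<bar> + \<bar>y\<bar> \<le> (\<bar>f 0\<bar> + \<bar>c\<bar> + 1) * (1 + \<bar>y\<bar>)" by (simp add: algebra_simps)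
      also have "\<dots> \<le> (B * (1 - cos \<rho>)) * (1 + \<bar>y\<bar>) ^ Suc k"
      proof (intro mult_mono B2)
        show "1 + \<bar>y\<bar> \<le> (1 + \<bar>y\<bar>) ^ Suc k" by (rule self_le_power) auto
      qed (use Bpos cr in auto)
      also have "\<dots> = X * (1 - cos \<rho>)" by (simp add: X_def)
      also have "\<dots> \<le> X * (1 - cos t)" using ct X by (rule mult_left_mono)
      finally have "\<bar>f 0\<bar> + \<bar>c\<bar> + \<bar>y\<bar> \<le> X * (1 - cos t)" .
      moreover have "y * sin t \<le> \<bar>y\<bar>"
        using mult_mono[OF order_refl[of "\<bar>y\<bar>"] abs_sin_le_one[of t]] abs_ge_self[of "y * sin t"] by (simp add: abs_mult)
      ultimately have "m < - f 0" using m' by linarith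
      then show ?thesis by (intro exI[of _ 0]) simp
    qed
  qed
qed

text \<open>The apex has \<open>u = 0\<close>, the same \<open>y\<close> as \<open>p\<close>, and
  \<open>F = x\<close>. The terms in \<open>y\<close> then cancel in the hyperboloid comparison, and
  \<open>2 * u * (F - x) \<le> 1 / \<kappa>\<close> remains.\<close>

lemma F_upper:
  obtains B k where "B > 0" "\<And>p. F p \<le> B * (1 + \<bar>p \<bullet> n\<bar>) ^ Suc k + 1 / (2 * \<kappa> * u p)"
proof -
  obtain B k where B: "B > 0" and cone: "\<And>y d m. norm d = 1 \<Longrightarrow>
    m < (B * (1 + \<bar>y\<bar>) ^ Suc k) * (d \<bullet> e - 1) + y * (d \<bullet> n) + c \<Longrightarrow> \<exists>p. m < p \<bullet> d - f p"
    using cone_below by blast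
  define X where "X y = B * (1 + \<bar>y\<bar>) ^ Suc k" for y
  have bound: "F p \<le> X (p \<bullet> n) + 1 / (2 * \<kappa> * u p)" for p
  proof -
    define x where "x = X (p \<bullet> n)"
    define q where "q = x *\<^sub>R e + (p \<bullet> n) *\<^sub>R n"
    have qn: "(norm (p - q))\<^sup>2 = (p \<bullet> e - x)\<^sup>2"
      by (simp add: norm_decomp q_def inner_diff_left inner_add_left)
    have "u p + p \<bullet> e - x \<le> 0 \<or> (u p + p \<bullet> e - x)\<^sup>2 \<le> 1 / \<kappa> + (p \<bullet> e - x)\<^sup>2"
    proof (cases "x - c < f p")
      case True
      have "(f p - (x - c))\<^sup>2 \<le> 1 / \<kappa> + (norm (p - q))\<^sup>2"
      proof (rule hyperboloid_comparison[OF _ True])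
        fix d :: plane and m assume "norm d = 1" "m < q \<bullet> d - (x - c)"
        then have "m < x * (d \<bullet> e - 1) + (p \<bullet> n) * (d \<bullet> n) + c"
          by (simp add: q_def inner_add_left inner_commute[of e d] inner_commute[of n d] algebra_simps)
        then show "\<exists>p. m < p \<bullet> d - f p"
          unfolding x_def X_def by (rule cone[OF \<open>norm d = 1\<close>])
      qed
      then show ?thesis unfolding qn by (simp add: u_def algebra_simps)
    qed (simp add: u_def)
    moreover have "(u p + p \<bullet> e - x)\<^sup>2 = (u p)\<^sup>2 + 2 * u p * (p \<bullet> e - x) + (p \<bullet> e - x)\<^sup>2"
      by (simp add: power2_eq_square algebra_simps)
    ultimately have "u p + p \<bullet> e - x \<le> 0 \<or> u p * (u p + 2 * (p \<bullet> e - x)) \<le> 1 / \<kappa>"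
      by (auto simp: power2_eq_square algebra_simps)
    then have "u p / 2 + p \<bullet> e - x \<le> 1 / (2 * \<kappa> * u p)"
    proof
      assume "u p + p \<bullet> e - x \<le> 0"
      moreover have "0 < 1 / (2 * \<kappa> * u p)" using kappa_pos u_pos by simp
      ultimately show ?thesis using u_pos[of p] by linarith
    next
      assume "u p * (u p + 2 * (p \<bullet> e - x)) \<le> 1 / \<kappa>"
      then have "u p + 2 * (p \<bullet> e - x) \<le> 1 / \<kappa> / u p"
        using u_pos[of p] by (simp only: pos_le_divide_eq mult.commute[of _ "u p"])
      also define z where "z = 1 / (2 * \<kappa> * u p)"
      have "1 / \<kappa> / u p = 2 * z" using kappa_pos u_pos[of p] by (simp add: z_def field_simps)
      finally have le: "u p + 2 * (p \<bullet> e - x) \<le> 2 * z" .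
      have "u p / 2 + p \<bullet> e - x = (u p + 2 * (p \<bullet> e - x)) / 2" by (simp add: field_simps)
      also have "\<dots> \<le> z" using le by simp
      finally show ?thesis by (simp only: z_def)
    qed
    then show ?thesis using p_e[of p] by (simp add: x_def)
  qed
  show thesis by (rule that[OF B]) (use bound in \<open>simp add: X_def\<close>)
qed

lemma F_bound:
  obtains C u1 where "C > 0" "u1 > 0" "\<And>p. p \<bullet> n = 0 \<Longrightarrow> u p < u1 \<Longrightarrow> F p \<le> C / sqrt (u p)"
proof -
  obtain B k where B: "B > 0" and "\<And>p. F p \<le> B * (1 + \<bar>p \<bullet> n\<bar>) ^ Suc k + 1 / (2 * \<kappa> * u p)"
    using F_upper by blast
  define X where "X y = B * (1 + \<bar>y\<bar>) ^ Suc k" for y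
  have bound: "F p \<le> X (p \<bullet> n) + 1 / (2 * \<kappa> * u p)" for p
    unfolding X_def by fact
  define \<mu> where "\<mu> = sqrt \<kappa> / 2"
  have "\<mu> > 0" using kappa_pos by (simp add: \<mu>_def)
  then obtain M where M: "M > 0" "\<And>y. (1 + \<bar>y\<bar>) ^ Suc k \<le> M * (cosh (\<mu> * y))\<^sup>2"
    using power_le_cosh_square by blast
  \<comment> \<open>With this value \<open>1 / (\<kappa> * Q\<^sup>2)\<close> is twice
    \<open>B * M\<close>, the amount that the polynomial needs; the factor 2 gives the strict
    inequality \<open>X\<close>.\<close>
  define Q where "Q = sqrt (1 / (2 * \<kappa> * B * M))"
  have Q: "Q > 0" and Q2: "\<kappa> * Q\<^sup>2 = 1 / (2 * B * M)" using kappa_pos B M by (auto simp: Q_def)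
  have X: "X y < (cosh (\<mu> * y))\<^sup>2 / (\<kappa> * Q\<^sup>2)" for y
  proof -
    have "X y \<le> B * (M * (cosh (\<mu> * y))\<^sup>2)" unfolding X_def using M(2) B by (intro mult_left_mono) auto
    also have "\<dots> < 2 * (B * (M * (cosh (\<mu> * y))\<^sup>2))"
      using B M cosh_real_pos[of "\<mu> * y"] by simp
    also have "\<dots> = (cosh (\<mu> * y))\<^sup>2 / (\<kappa> * Q\<^sup>2)" unfolding Q2 by simp
    finally show ?thesis .
  qed
  show thesis
  proof (rule that)
    show "2 / (\<kappa> * Q) > 0" using kappa_pos Q by simp
    show "Q\<^sup>2 > 0" using Q by simp
    fix p assume p: "p \<bullet> n = 0" "u p < Q\<^sup>2"
    then have "sqrt (u p) < Q" using Q by (simp add: real_less_lsqrt u_pos less_imp_le)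
    then show "F p \<le> 2 / (\<kappa> * Q) / sqrt (u p)"
      using barrier_comparison[OF u_pos Q \<mu>_def bound X, of p] p by simp
  qed
qed

text \<open>Along the line spanned by \<open>e\<close>, \<open>u\<close> becomes small forwards by
  \<open>ray_support\<close> and large backwards by the tangent plane at 0.\<close>

lemma u_attained:
  assumes "t > 0"
  obtains x where "u (x *\<^sub>R e) = t"
proof -
  define g where "g x = u (x *\<^sub>R e)" for x
  have cont: "continuous_on S g" for S
    unfolding g_def by (intro continuous_on_compose2[OF continuous_u[of UNIV]] continuous_intros) auto
  obtain p where "c - t < p \<bullet> e - f p" using supp_approx[of "c - t"] assms by auto
  from ray_support[OF norm_e this, of 0] obtain r where "f (r *\<^sub>R e) - r < t - c" by auto
  then have r: "g r < t" by (simp add: g_def u_def)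
  define b where "b = 1 - grad 0 \<bullet> e"
  have b: "b > 0" using grad_inner_less[OF norm_e, of 0] by (simp add: b_def)
  define s where "s = max (\<bar>t - f 0 - c\<bar> / b) \<bar>r\<bar>"
  have s: "- s \<le> r" by (simp add: s_def)
  have "\<bar>t - f 0 - c\<bar> \<le> s * b" using b by (simp add: s_def pos_divide_le_eq[symmetric])
  then have "t \<le> g (- s)"
    using tangent_le[of 0 "- s *\<^sub>R e"] by (simp add: g_def u_def b_def algebra_simps)
  then obtain x where "g x = t" using IVT2'[of g r t "- s"] r s cont by auto
  then show thesis using that by (simp add: g_def)
qed

end

section \<open>Discrete geodesics\<close>

lemma compact_Pi_UNIV:
  fixes K :: "'i \<Rightarrow> 'a::topological_space set"
  assumes "\<And>i. compact (K i)"
  shows "compact (Pi UNIV K)"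
proof -
  have "compactin (product_topology (\<lambda>i::'i. euclidean :: 'a topology) UNIV) (PiE UNIV K)"
    using assms by (auto simp: compactin_PiE)
  then show ?thesis
    by (simp add: euclidean_product_topology PiE_def)
qed

lemma power_diff_le:
  fixes a b :: real
  assumes "0 \<le> b" "b \<le> a"
  shows "a ^ Suc n - b ^ Suc n \<le> real (Suc n) * a ^ n * (a - b)"
proof (induction n)
  case (Suc n)
  have "a ^ Suc (Suc n) - b ^ Suc (Suc n) = a * (a ^ Suc n - b ^ Suc n) + b ^ Suc n * (a - b)"
    by (simp add: algebra_simps)
  also have "\<dots> \<le> a * (real (Suc n) * a ^ n * (a - b)) + a ^ Suc n * (a - b)"
    using assms Suc.IH by (intro add_mono mult_left_mono mult_right_mono power_mono) auto
  finally show ?case by (simp add: algebra_simps)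
qed simp

abbreviation second_diff :: "(nat \<Rightarrow> 'a::real_vector) \<Rightarrow> nat \<Rightarrow> 'a" where
  "second_diff X i \<equiv> X (Suc (Suc i)) - 2 *\<^sub>R X (Suc i) + X i"

context spacelike_graph begin

abbreviation second_diff_f :: "(nat \<Rightarrow> plane) \<Rightarrow> nat \<Rightarrow> real" where
  "second_diff_f X i \<equiv> f (X (Suc (Suc i))) - 2 * f (X (Suc i)) + f (X i)"

text \<open>The Lorentzian square of the segment in Minkowski space between two points of the
  graph.\<close>

definition chord :: "plane \<Rightarrow> plane \<Rightarrow> real" where
  "chord p q = (norm (p - q))\<^sup>2 - (f p - f q)\<^sup>2"

definition energy :: "nat \<Rightarrow> (nat \<Rightarrow> plane) \<Rightarrow> real" where
  "energy N X = (\<Sum>i<N. chord (X i) (X (Suc i)))"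

lemma chord_commute: "chord p q = chord q p"
  by (simp add: chord_def norm_minus_commute power2_commute)

lemma chord_nonneg: "chord p q \<ge> 0"
  using power_mono[OF lipschitz[of p q], of 2] by (simp add: chord_def)

lemma grad_bound: "\<exists>l. 0 \<le> l \<and> l < 1 \<and> (\<forall>p \<in> cball a R. norm (grad p) \<le> l)"
proof (cases "cball a R = {}")
  case True
  then show ?thesis by (intro exI[of _ 0]) auto
next
  case False
  have "continuous_on (cball a R) (\<lambda>p. norm (grad p))" by (intro continuous_intros continuous_grad)
  then obtain x where "x \<in> cball a R" "\<And>p. p \<in> cball a R \<Longrightarrow> norm (grad p) \<le> norm (grad x)"
    using continuous_attains_sup[OF compact_cball False] by blast
  then show ?thesis using spacelike[of x] by (intro exI[of _ "norm (grad x)"]) auto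
qed

text \<open>Only \<open>p\<close> is confined to a ball. Far away the surface may become as steep as
  the light cone, so just a linear bound survives there: on the first unit of the segment from
  \<open>p\<close> the increment of \<open>f\<close> falls short of the Lipschitz bound by
  \<open>1 - l\<close>, and the chord factors as a difference of squares.\<close>

lemma chord_lower:
  obtains b where "0 < b" "b \<le> 1" "\<And>p q. p \<in> cball a R \<Longrightarrow> norm (p - q) \<le> 1 \<Longrightarrow> b * (norm (p - q))\<^sup>2 \<le> chord p q"
    "\<And>p q. p \<in> cball a R \<Longrightarrow> 1 \<le> norm (p - q) \<Longrightarrow> b * norm (p - q) \<le> chord p q"
proof -
  obtain l where l: "0 \<le> l" "l < 1" and gl: "\<And>p. p \<in> cball a (R + 1) \<Longrightarrow> norm (grad p) \<le> l"
    using grad_bound by blast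
  have near: "\<bar>f p - f q\<bar> \<le> l * norm (p - q)" if "p \<in> cball a R" "norm (p - q) \<le> 1" for p q
  proof -
    have "p \<in> cball a (R + 1)" "q \<in> cball a (R + 1)"
      using that dist_triangle[of a q p] by (auto simp: dist_norm)
    then have "norm (grad p) \<le> l" "norm (grad q) \<le> l" using gl by auto
    then have "norm (grad p) * norm (q - p) \<le> l * norm (q - p)" "norm (grad q) * norm (p - q) \<le> l * norm (p - q)"
      by (auto intro: mult_right_mono)
    then show ?thesis
      using tangent_le[of p q] tangent_le[of q p] Cauchy_Schwarz_ineq2[of "grad p" "q - p"] Cauchy_Schwarz_ineq2[of "grad q" "p - q"]
      by (simp add: norm_minus_commute abs_le_iff)
  qed
  show thesis
  proof (rule that[of "1 - l"])
    show "0 < 1 - l" "1 - l \<le> 1" using l by auto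
    fix p q assume p: "p \<in> cball a R"
    show "(1 - l) * (norm (p - q))\<^sup>2 \<le> chord p q" if "norm (p - q) \<le> 1"
    proof -
      have "(f p - f q)\<^sup>2 \<le> (l * norm (p - q))\<^sup>2"
        using power_mono[OF near[OF p that], of 2] by simp
      also have "\<dots> \<le> l * (norm (p - q))\<^sup>2"
        using l by (simp add: power_mult_distrib mult_right_mono power2_eq_square[of l] mult_left_le)
      finally show ?thesis by (simp add: chord_def algebra_simps)
    qed
    show "(1 - l) * norm (p - q) \<le> chord p q" if r: "1 \<le> norm (p - q)"
    proof -
      define r where "r = norm (p - q)"
      define x where "x = p + (1 / r) *\<^sub>R (q - p)"
      have r1: "r \<ge> 1" using r by (simp add: r_def)
      have "p - x = (1 / r) *\<^sub>R (p - q)" by (simp add: x_def algebra_simps)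
      then have "norm (p - x) = 1" using r1 by (simp add: r_def[symmetric])
      then have "\<bar>f p - f x\<bar> \<le> l" using near[OF p, of x] by simp
      moreover have "norm (x - q) = r - 1"
      proof -
        have "x - q = (1 - 1 / r) *\<^sub>R (p - q)" by (simp add: x_def algebra_simps)
        then have "norm (x - q) = \<bar>1 - 1 / r\<bar> * r" by (simp only: norm_scaleR r_def real_norm_def)
        also have "\<dots> = r - 1" using r1 by (simp add: left_diff_distrib)
        finally show ?thesis .
      qed
      ultimately have d: "\<bar>f p - f q\<bar> \<le> r - (1 - l)" using lipschitz[of x q] by linarith
      have "(1 - l) * r \<le> (r - \<bar>f p - f q\<bar>) * (r + \<bar>f p - f q\<bar>)"
        using d r1 l by (intro mult_mono) auto
      also have "\<dots> = chord p q" by (simp add: chord_def r_def algebra_simps power2_eq_square)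
      finally show ?thesis by (simp add: r_def)
    qed
  qed
qed

lemma chord_bounded: "\<exists>R'. \<forall>p q. norm p \<le> R \<longrightarrow> chord p q \<le> E \<longrightarrow> norm q \<le> R'"
proof -
  obtain b where b: "0 < b" "\<And>p q. p \<in> cball 0 R \<Longrightarrow> 1 \<le> norm (p - q) \<Longrightarrow> b * norm (p - q) \<le> chord p q"
    by (rule chord_lower[of 0 R]) blast
  have "norm q \<le> R + max 1 (E / b)" if "norm p \<le> R" "chord p q \<le> E" for p q
  proof -
    have "norm (p - q) \<le> max 1 (E / b)"
    proof (cases "1 \<le> norm (p - q)")
      case True
      then have "b * norm (p - q) \<le> E" using b(2)[of p q] that by simp
      then show ?thesis using b(1) by (simp add: pos_le_divide_eq mult.commute le_max_iff_disj)
    qed simp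
    then show ?thesis using that norm_triangle_sub[of q p] by (simp add: norm_minus_commute)
  qed
  then show ?thesis by blast
qed

text \<open>By \<open>chord_bounded\<close> a bound for one vertex and for the energy bounds the
  next vertex. Starting from the fixed vertex \<open>a\<close>, this confines all competitors to a
  product of balls.\<close>

lemma energy_minimizer:
  assumes "N > 0"
  obtains X where "X 0 = a" "X N = b" "\<And>Y. Y 0 = a \<Longrightarrow> Y N = b \<Longrightarrow> energy N X \<le> energy N Y"
proof -
  define Y0 where "Y0 i = (if i = 0 then a else if i \<le> N then b else 0)" for i :: nat
  have chord_le: "chord (Y i) (Y (Suc i)) \<le> energy N Y" if "i < N" for Y i
    unfolding energy_def using that by (intro member_le_sum) (auto simp: chord_nonneg)
  have "\<exists>R. \<forall>Y. Y 0 = a \<and> energy N Y \<le> energy N Y0 \<longrightarrow> norm (Y i) \<le> R" if "i \<le> N" for i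
    using that
  proof (induction i)
    case 0
    show ?case by (intro exI[of _ "norm a"]) auto
  next
    case (Suc i)
    then obtain R where R: "\<And>Y. Y 0 = a \<and> energy N Y \<le> energy N Y0 \<Longrightarrow> norm (Y i) \<le> R" by auto
    obtain R' where "\<And>p q. norm p \<le> R \<Longrightarrow> chord p q \<le> energy N Y0 \<Longrightarrow> norm q \<le> R'"
      using chord_bounded by blast
    then show ?case using R chord_le[of i] Suc.prems by (meson Suc_le_lessD order_trans)
  qed
  then obtain R where R: "\<And>i Y. i \<le> N \<Longrightarrow> Y 0 = a \<Longrightarrow> energy N Y \<le> energy N Y0 \<Longrightarrow> norm (Y i) \<le> R i"
    by metis
  \<comment> \<open>Radius 0 beyond \<open>N\<close> pins the vertices that do not enter the energy,
    so that this set of infinite sequences is compact.\<close>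
  define S where "S = Pi UNIV (\<lambda>i. cball 0 (if i \<le> N then R i else 0)) \<inter> {Y. Y 0 = a} \<inter> {Y. Y N = b}"
  have coord: "continuous_on UNIV (\<lambda>Y :: nat \<Rightarrow> plane. Y i)" for i by (rule continuous_on_product_coordinates)
  have "compact S" unfolding S_def
    by (intro compact_Int_closed compact_Pi_UNIV closed_Collect_eq continuous_intros coord) auto
  moreover have "Y0 \<in> S" using R[of _ Y0] assms by (auto simp: S_def Y0_def)
  moreover have "continuous_on S (energy N)"
    unfolding energy_def chord_def
    by (intro continuous_intros continuous_on_compose2[OF continuous_f[of UNIV]] continuous_on_subset[OF coord]) auto
  ultimately obtain X where X: "X \<in> S" "\<And>Y. Y \<in> S \<Longrightarrow> energy N X \<le> energy N Y"
    using continuous_attains_inf[of S "energy N"] by blast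
  show thesis
  proof (rule that[of X])
    show "X 0 = a" "X N = b" using X(1) by (auto simp: S_def)
    fix Y :: "nat \<Rightarrow> plane" assume Y: "Y 0 = a" "Y N = b"
    show "energy N X \<le> energy N Y"
    proof (cases "energy N Y \<le> energy N Y0")
      case True
      define Y' where "Y' i = (if i \<le> N then Y i else 0)" for i
      have "energy N Y' = energy N Y" by (simp add: energy_def Y'_def)
      moreover have "Y' \<in> S" using R[OF _ Y(1) True] Y by (auto simp: S_def Y'_def)
      ultimately show ?thesis using X(2) by metis
    next
      case False
      then show ?thesis using X(2)[OF \<open>Y0 \<in> S\<close>] by linarith
    qed
  qed
qed

text \<open>The second difference in Minkowski space is normal to the surface, that is, a multiple of
  \<open>(grad, 1)\<close>.\<close>

definition discrete_geodesic :: "nat \<Rightarrow> (nat \<Rightarrow> plane) \<Rightarrow> bool" where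
  "discrete_geodesic N X \<longleftrightarrow> (\<forall>i. Suc i < N \<longrightarrow>
     second_diff X i =
     (second_diff_f X i) *\<^sub>R grad (X (Suc i)))"

lemma chord_line_deriv:
  "((\<lambda>s. chord p (q + s *\<^sub>R v)) has_real_derivative 2 * ((q - p) \<bullet> v - (f q - f p) * (grad q \<bullet> v))) (at 0)"
proof -
  have eq: "chord p (q + s *\<^sub>R v) = (q - p) \<bullet> (q - p) + 2 * s * ((q - p) \<bullet> v) + s\<^sup>2 * (v \<bullet> v) - (f (q + s *\<^sub>R v) - f p)\<^sup>2" for s
    unfolding chord_def power2_norm_eq_inner
    by (simp add: inner_diff_left inner_diff_right inner_add_left inner_add_right inner_commute power2_eq_square algebra_simps)
  show ?thesis unfolding eq
    by (rule derivative_eq_intros deriv_f_line refl | simp add: algebra_simps)+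
qed

lemma minimizer_discrete_geodesic:
  assumes min: "\<And>Y. Y 0 = X 0 \<Longrightarrow> Y N = X N \<Longrightarrow> energy N X \<le> energy N Y"
  shows "discrete_geodesic N X"
  unfolding discrete_geodesic_def
proof (intro allI impI)
  fix i assume i: "Suc i < N"
  define p q r where "p = X i" and "q = X (Suc i)" and "r = X (Suc (Suc i))"
  have "(r - 2 *\<^sub>R q + p) \<bullet> v = ((f r - 2 * f q + f p) *\<^sub>R grad q) \<bullet> v" for v
  proof -
    let ?h = "\<lambda>s. chord p (q + s *\<^sub>R v) + chord r (q + s *\<^sub>R v)"
    have "?h 0 \<le> ?h s" for s
    proof -
      define Y where "Y = X(Suc i := q + s *\<^sub>R v)"
      have split: "energy N Z = chord (Z i) (Z (Suc i)) + chord (Z (Suc i)) (Z (Suc (Suc i))) + (\<Sum>j\<in>{..<N} - {i, Suc i}. chord (Z j) (Z (Suc j)))" for Z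
      proof -
        have "{..<N} = insert i (insert (Suc i) ({..<N} - {i, Suc i}))" using i by auto
        then have "energy N Z = (\<Sum>j\<in>insert i (insert (Suc i) ({..<N} - {i, Suc i})). chord (Z j) (Z (Suc j)))"
          by (simp add: energy_def)
        then show ?thesis by (simp add: add.assoc)
      qed
      have "(\<Sum>j\<in>{..<N} - {i, Suc i}. chord (Y j) (Y (Suc j))) = (\<Sum>j\<in>{..<N} - {i, Suc i}. chord (X j) (X (Suc j)))"
        by (rule sum.cong) (auto simp: Y_def)
      moreover have "energy N X \<le> energy N Y" by (rule min) (use i in \<open>auto simp: Y_def\<close>)
      ultimately have "chord p q + chord q r \<le> chord p (q + s *\<^sub>R v) + chord (q + s *\<^sub>R v) r"
        unfolding split by (simp add: Y_def p_def q_def r_def)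
      then show ?thesis by (simp add: chord_commute[of r])
    qed
    then have "2 * ((q - p) \<bullet> v - (f q - f p) * (grad q \<bullet> v)) + 2 * ((q - r) \<bullet> v - (f q - f r) * (grad q \<bullet> v)) = 0"
      by (intro DERIV_local_min[OF DERIV_add[OF chord_line_deriv chord_line_deriv], of 1]) auto
    then show ?thesis by (simp add: inner_diff_left inner_add_left algebra_simps)
  qed
  then have "r - 2 *\<^sub>R q + p = (f r - 2 * f q + f p) *\<^sub>R grad q"
    using vector_eq_rdot by blast
  then show "second_diff X i =
     (second_diff_f X i) *\<^sub>R grad (X (Suc i))"
    by (simp add: p_def q_def r_def)
qed

end

context directed_graph begin

text \<open>On Minkowski space the null coordinates are affine functions, so the formula
  \<open>dy\<^sup>2 - 2 dF du\<close> is exact for finite chords.\<close>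

lemma chord_null: "chord p q = ((p - q) \<bullet> n)\<^sup>2 - 2 * (F p - F q) * (u p - u q)"
proof -
  have "(norm (p - q))\<^sup>2 = (p \<bullet> e - q \<bullet> e)\<^sup>2 + ((p - q) \<bullet> n)\<^sup>2"
    by (simp add: norm_decomp inner_diff_left)
  then show ?thesis
    by (simp add: chord_def F_def u_def power2_eq_square field_simps)
qed

end

context growing_graph begin

text \<open>The competitor runs in \<open>y = 0\<close> with \<open>u\<close> the fourth power of a
  linear parameter \<open>v\<close>. Its energy is then controlled by sums of \<open>v ^ 3\<close>
  against increments of \<open>G\<close>, where \<open>G \<le> C' / v\<^sup>2\<close>. As only an
  upper bound of \<open>G\<close> is known and none of its increments, summation by parts is used;
  it leaves terms \<open>v ^ 3 * G\<close> and \<open>v\<^sup>2 * G\<close>, which are bounded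
  above.\<close>

lemma discrete_geodesics_bounded_energy:
  obtains E a X where "E > 0"
    "\<And>N. N > 0 \<Longrightarrow> discrete_geodesic N (X N)" "\<And>N. N > 0 \<Longrightarrow> X N 0 = a"
    "\<And>N. N > 0 \<Longrightarrow> energy N (X N) \<le> E / real N"
    "(\<lambda>N. u (X N N)) \<longlonglongrightarrow> 0"
proof -
  obtain C u1 where C: "C > 0" and u1: "u1 > 0" and FC: "\<And>p. p \<bullet> n = 0 \<Longrightarrow> u p < u1 \<Longrightarrow> F p \<le> C / sqrt (u p)"
    using F_bound by blast
  have "\<exists>x. t > 0 \<longrightarrow> u (x *\<^sub>R e) = t" for t using u_attained by metis
  then obtain x where x: "\<And>t. t > 0 \<Longrightarrow> u (x t *\<^sub>R e) = t" by metis
  define P where "P t = x t *\<^sub>R e" for t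
  have P: "u (P t) = t" "P t \<bullet> n = 0" if "t > 0" for t using x that by (auto simp: P_def)
  define us where "us = u1 / 2"
  define C' where "C' = C / sqrt us"
  define G where "G t = F (P (us * t ^ 4))" for t
  have us: "us > 0" "us < u1" using u1 by (auto simp: us_def)
  have C': "C' > 0" using C us by (simp add: C'_def)
  have G: "G t \<le> C' / t\<^sup>2" if "0 < t" "t \<le> 1" for t
  proof -
    have "us * t ^ 4 \<le> us" using that us by (simp add: mult_left_le power_le_one)
    then have "us * t ^ 4 < u1" using us by linarith
    then have "G t \<le> C / sqrt (us * t ^ 4)"
      using FC[of "P (us * t ^ 4)"] P[of "us * t ^ 4"] that us by (simp add: G_def)
    also have "sqrt (us * t ^ 4) = sqrt us * t\<^sup>2"
    proof -
      have "us * t ^ 4 = us * (t\<^sup>2)\<^sup>2" by (simp flip: power_mult)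
      then show ?thesis by (simp only: real_sqrt_mult real_sqrt_abs abs_power2)
    qed
    finally show ?thesis by (simp add: C'_def)
  qed
  \<comment> \<open>In the summation by parts \<open>12 * C'\<close> comes from the differences of
    the weights, another \<open>C'\<close> from the last boundary term and
    \<open>\<bar>G 1\<bar>\<close> from the first. The factor \<open>8 * us\<close> is that of
    \<open>chord_le\<close>.\<close>
  define E where "E = 8 * us * (13 * C' + \<bar>G 1\<bar>)"
  have "E > 0" using us C' by (simp add: E_def add_pos_nonneg)
  \<comment> \<open>Division by \<open>Suc N\<close> keeps the last vertex on the surface, at
    \<open>u = us / Suc N ^ 4\<close>.\<close>
  define q where "q N i = P (us * ((real (Suc N) - real i) / real (Suc N)) ^ 4)" for N i :: nat
  have q_energy: "energy N (q N) \<le> E / real N" if N: "N > 0" for N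
  proof -
    define M where "M = real (Suc N)"
    define v where "v i = (M - real i) / M" for i :: nat
    define g where "g i = G (v i)" for i
    have M: "M > 0" "M > real N" by (auto simp: M_def)
    have v0: "v 0 = 1" using M by (simp add: v_def)
    have vS: "v i = v (Suc i) + 1 / M" for i using M by (simp add: v_def field_simps)
    have vpos: "0 < v i" "v i \<le> 1" if "i \<le> N" for i using that by (auto simp: v_def M_def)
    have vS2: "1 / M \<le> v (Suc i)" if "i < N" for i using that by (auto simp: v_def M_def field_simps)
    have qP: "q N i = P (us * v i ^ 4)" for i by (simp add: q_def v_def M_def)
    have g_le: "g i \<le> C' / (v i)\<^sup>2" if "i \<le> N" for i
      unfolding g_def by (rule G) (use vpos[OF that] in auto)
    have chord_le: "chord (q N i) (q N (Suc i)) \<le> (8 * us / M) * (v i ^ 3 * (g (Suc i) - g i))" if "i < N" for i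
    proof -
      have pos: "us * v i ^ 4 > 0" "us * v (Suc i) ^ 4 > 0" using us vpos[of i] vpos[of "Suc i"] that by auto
      have "v i ^ Suc 3 - v (Suc i) ^ Suc 3 \<le> real (Suc 3) * v i ^ 3 * (v i - v (Suc i))"
        by (rule power_diff_le) (use vpos[of "Suc i"] vS[of i] that M in auto)
      then have d: "us * (v i ^ 4 - v (Suc i) ^ 4) \<le> us * (4 * v i ^ 3 / M)"
        using us vS[of i] by (intro mult_left_mono) (auto simp: numeral_eq_Suc)
      have "v (Suc i) ^ 4 < v i ^ 4" using vpos[of "Suc i"] vS[of i] that M by (intro power_strict_mono) auto
      then have du: "us * (v i ^ 4 - v (Suc i) ^ 4) > 0" using us by simp
      have eq: "chord (q N i) (q N (Suc i)) = 2 * (g (Suc i) - g i) * (us * (v i ^ 4 - v (Suc i) ^ 4))"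
        unfolding chord_null qP using P[OF pos(1)] P[OF pos(2)]
        by (simp add: inner_diff_left g_def G_def algebra_simps)
      moreover have "chord (q N i) (q N (Suc i)) \<ge> 0" by (rule chord_nonneg)
      ultimately have "g (Suc i) - g i \<ge> 0" using du by (simp add: zero_le_mult_iff)
      have "2 * (g (Suc i) - g i) * (us * (v i ^ 4 - v (Suc i) ^ 4)) \<le> 2 * (g (Suc i) - g i) * (us * (4 * v i ^ 3 / M))"
        using \<open>g (Suc i) - g i \<ge> 0\<close> by (intro mult_left_mono d) auto
      also have "\<dots> = (8 * us / M) * (v i ^ 3 * (g (Suc i) - g i))" by simp
      finally show ?thesis unfolding eq .
    qed
    \<comment> \<open>Since \<open>v (Suc m)\<close> is at least one step \<open>1 / M\<close>,
      \<open>v m\<close> is at most twice as large; the difference of the cubes is therefore at most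
      3 times 4 times \<open>(v (Suc m))\<^sup>2 / M\<close>.\<close>
    have abel: "(\<Sum>i<m. v i ^ 3 * (g (Suc i) - g i)) \<le> v m ^ 3 * g m - g 0 + 12 * C' * (real m / M)" if "m \<le> N" for m
      using that
    proof (induction m)
      case 0
      show ?case by (simp add: v0)
    next
      case (Suc m)
      then have m: "m < N" by simp
      have v2: "v m \<le> 2 * v (Suc m)" using vS[of m] vS2[OF m] by linarith
      have vp: "0 < v (Suc m)" "v (Suc m) \<le> v m" using vpos[of "Suc m"] m vS[of m] M by auto
      have "v m ^ Suc 2 - v (Suc m) ^ Suc 2 \<le> real (Suc 2) * v m ^ 2 * (v m - v (Suc m))"
        by (rule power_diff_le) (use vp in auto)
      then have "v m ^ 3 - v (Suc m) ^ 3 \<le> 3 * (v m)\<^sup>2 * (1 / M)" using vS[of m] by (simp add: numeral_eq_Suc)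
      also have "\<dots> \<le> 3 * (2 * v (Suc m))\<^sup>2 * (1 / M)"
        using v2 vp M by (intro mult_right_mono mult_left_mono power_mono) auto
      finally have d: "v m ^ 3 - v (Suc m) ^ 3 \<le> 12 * (v (Suc m))\<^sup>2 / M" by (simp add: power_mult_distrib)
      have d0: "0 \<le> v m ^ 3 - v (Suc m) ^ 3" using vp by (simp add: power_mono)
      have "(v m ^ 3 - v (Suc m) ^ 3) * g (Suc m) \<le> (v m ^ 3 - v (Suc m) ^ 3) * (C' / (v (Suc m))\<^sup>2)"
        using d0 g_le[of "Suc m"] m by (intro mult_left_mono) auto
      also have "\<dots> \<le> 12 * (v (Suc m))\<^sup>2 / M * (C' / (v (Suc m))\<^sup>2)"
        using d C' by (intro mult_right_mono) auto
      also have "\<dots> = 12 * C' / M" using vp by simp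
      finally have "v m ^ 3 * g (Suc m) \<le> v (Suc m) ^ 3 * g (Suc m) + 12 * C' / M" by (simp add: algebra_simps)
      moreover have "12 * C' * (real (Suc m) / M) = 12 * C' * (real m / M) + 12 * C' / M"
        by (simp add: distrib_left add_divide_distrib)
      ultimately show ?case using Suc.IH m by (simp add: algebra_simps)
    qed
    have "energy N (q N) \<le> (\<Sum>i<N. (8 * us / M) * (v i ^ 3 * (g (Suc i) - g i)))"
      unfolding energy_def by (rule sum_mono) (use chord_le in auto)
    also have "\<dots> = (8 * us / M) * (\<Sum>i<N. v i ^ 3 * (g (Suc i) - g i))"
      by (simp add: sum_distrib_left)
    also have "\<dots> \<le> (8 * us / M) * (13 * C' + \<bar>G 1\<bar>)"
    proof (rule mult_left_mono)
      have "v N ^ 3 * g N \<le> v N ^ 3 * (C' / (v N)\<^sup>2)" using g_le[of N] vpos[of N] by (intro mult_left_mono) auto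
      also have "\<dots> = C' * v N" using vpos[of N] by (simp add: power2_eq_square power3_eq_cube)
      also have "\<dots> \<le> C'" using vpos[of N] C' by (simp add: mult_left_le)
      finally have "v N ^ 3 * g N \<le> C'" .
      moreover have "12 * C' * (real N / M) \<le> 12 * C' * 1"
        using C' M by (intro mult_left_mono) auto
      moreover have "- g 0 \<le> \<bar>G 1\<bar>" by (simp add: g_def v0)
      ultimately show "(\<Sum>i<N. v i ^ 3 * (g (Suc i) - g i)) \<le> 13 * C' + \<bar>G 1\<bar>"
        using abel[of N] by linarith
    qed (use us M in auto)
    also have "\<dots> = E / M" by (simp add: E_def)
    also have "\<dots> \<le> E / real N" using \<open>E > 0\<close> M N by (intro divide_left_mono) auto
    finally show ?thesis .
  qed
  have "\<exists>X. discrete_geodesic N X \<and> X 0 = q N 0 \<and> X N = q N N \<and> energy N X \<le> E / real N" if N: "N > 0" for N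
  proof -
    obtain X where X: "X 0 = q N 0" "X N = q N N" "\<And>Y. Y 0 = q N 0 \<Longrightarrow> Y N = q N N \<Longrightarrow> energy N X \<le> energy N Y"
      using energy_minimizer[OF N] by blast
    have "discrete_geodesic N X" by (rule minimizer_discrete_geodesic) (simp add: X)
    moreover have "energy N X \<le> E / real N" using X(3)[of "q N"] q_energy[OF N] by simp
    ultimately show ?thesis using X by blast
  qed
  then obtain X where X: "\<And>N. N > 0 \<Longrightarrow> discrete_geodesic N (X N) \<and> X N 0 = q N 0 \<and> X N N = q N N \<and> energy N (X N) \<le> E / real N"
    by metis
  show thesis
  proof (rule that[OF \<open>E > 0\<close>, of X "P us"])
    fix N :: nat assume "N > 0"
    then show "discrete_geodesic N (X N)" "X N 0 = P us" "energy N (X N) \<le> E / real N"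
      using X by (auto simp: q_def)
  next
    have "u (X N N) = us * inverse (real (Suc N)) ^ 4" if "N > 0" for N
      using X[OF that] P[of "us * (1 / real (Suc N)) ^ 4"] us by (simp add: q_def divide_inverse)
    moreover have "(\<lambda>N. us * inverse (real (Suc N)) ^ 4) \<longlonglongrightarrow> us * 0 ^ 4"
      by (intro tendsto_intros LIMSEQ_inverse_real_of_nat)
    ultimately show "(\<lambda>N. u (X N N)) \<longlonglongrightarrow> 0"
      by (subst tendsto_cong[of _ "\<lambda>N. us * inverse (real (Suc N)) ^ 4"]) (auto intro: eventually_sequentiallyI[of 1])
  qed
qed

end

section \<open>Compactness of discrete geodesics\<close>

lemma convex_seq_mono:
  fixes s :: "nat \<Rightarrow> real"
  assumes "\<And>i. Suc i < M \<Longrightarrow> s (Suc i) - s i \<le> s (Suc (Suc i)) - s (Suc i)" and "i \<le> j" "j < M"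
  shows "s (Suc i) - s i \<le> s (Suc j) - s j"
  using assms(2,3)
proof (induction j rule: dec_induct)
  case (step j)
  then show ?case using assms(1)[of j] by simp
qed simp

lemma norm_diff_le_sum_steps:
  fixes X :: "nat \<Rightarrow> 'a::real_normed_vector"
  shows "norm (X j - X 0) \<le> (\<Sum>i<j. norm (X (Suc i) - X i))"
proof -
  have "X j - X 0 = (\<Sum>i<j. X (Suc i) - X i)" by (simp add: sum_lessThan_telescope)
  then show ?thesis by (simp add: sum_norm_le)
qed

section \<open>Taylor remainders and convexity along discrete geodesics\<close>

context spacelike_graph begin

lemma taylor:
  "\<exists>s. 0 \<le> s \<and> s \<le> 1 \<and> f q - f p - grad p \<bullet> (q - p) = (hess (p + s *\<^sub>R (q - p)) (q - p) \<bullet> (q - p)) / 2"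
proof -
  define v where "v = q - p"
  define D where "D m s = (if m = 0 then f (p + s *\<^sub>R v) else if m = 1 then grad (p + s *\<^sub>R v) \<bullet> v else hess (p + s *\<^sub>R v) v \<bullet> v)" for m :: nat and s :: real
  have "\<exists>t>0. t < 1 \<and> D 0 1 = (\<Sum>m<2. D m 0 / fact m * 1 ^ m) + D 2 t / fact 2 * 1 ^ 2"
  proof (rule Maclaurin)
    show "\<forall>m t. m < 2 \<and> 0 \<le> t \<and> t \<le> 1 \<longrightarrow> (D m has_real_derivative D (Suc m) t) (at t)"
      using deriv_f_line[of p v _ UNIV] deriv_grad_line[of p v v _ UNIV] by (auto simp: D_def[abs_def] less_2_cases_iff)
  qed auto
  then obtain t where t: "0 < t" "t < 1" "f q = f p + grad p \<bullet> v + (hess (p + t *\<^sub>R v) v \<bullet> v) / 2"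
    by (auto simp: D_def numeral_2_eq_2 v_def)
  then show ?thesis by (intro exI[of _ t]) (simp add: v_def)
qed

text \<open>Pairing the discrete equation with the gradient expresses \<open>k\<close> by the two
  remainders of the tangent plane at the middle vertex. They are nonnegative by convexity, which
  gives the sign, and quadratic in the steps, which later bounds the acceleration.\<close>

lemma geodesic_second_difference:
  assumes "discrete_geodesic M Y" "Suc i < M"
  defines "k \<equiv> second_diff_f Y i" and "g \<equiv> grad (Y (Suc i))"
  shows "k * (1 - (norm g)\<^sup>2) = (f (Y (Suc (Suc i))) - f (Y (Suc i)) - g \<bullet> (Y (Suc (Suc i)) - Y (Suc i)))
      + (f (Y i) - f (Y (Suc i)) - g \<bullet> (Y i - Y (Suc i)))"
    and "0 \<le> k"
    and "second_diff Y i = k *\<^sub>R g"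
proof -
  show eq: "second_diff Y i = k *\<^sub>R g"
    using assms by (simp add: discrete_geodesic_def)
  have "g \<bullet> (Y (Suc (Suc i)) - Y (Suc i)) + g \<bullet> (Y i - Y (Suc i)) = g \<bullet> (k *\<^sub>R g)"
    unfolding eq[symmetric] by (simp add: inner_add_right inner_diff_right algebra_simps)
  then show main: "k * (1 - (norm g)\<^sup>2) = (f (Y (Suc (Suc i))) - f (Y (Suc i)) - g \<bullet> (Y (Suc (Suc i)) - Y (Suc i)))
      + (f (Y i) - f (Y (Suc i)) - g \<bullet> (Y i - Y (Suc i)))"
    by (simp add: k_def power2_norm_eq_inner algebra_simps)
  have "0 \<le> k * (1 - (norm g)\<^sup>2)"
    unfolding main using tangent_le[of "Y (Suc i)" "Y (Suc (Suc i))"] tangent_le[of "Y (Suc i)" "Y i"] by (simp add: g_def)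
  moreover have "1 - (norm g)\<^sup>2 > 0" using spacelike[of "Y (Suc i)"] by (simp add: g_def abs_square_less_1)
  ultimately show "0 \<le> k" by (simp add: zero_le_mult_iff)
qed

lemma hess_bound: "\<exists>H\<ge>0. \<forall>p v. norm p \<le> R \<longrightarrow> hess p v \<bullet> v \<le> H * (norm v)\<^sup>2"
proof -
  have "compact (cball (0::plane) R \<times> sphere (0::plane) 1)" by (simp add: compact_Times)
  moreover have "continuous_on (cball 0 R \<times> sphere 0 1) (\<lambda>x. hess (fst x) (snd x) \<bullet> snd x)"
    using continuous_on_subset[OF cont_hess] by (intro continuous_intros) (auto simp: case_prod_beta')
  ultimately have "bounded ((\<lambda>x. hess (fst x) (snd x) \<bullet> snd x) ` (cball 0 R \<times> sphere 0 1))"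
    using compact_continuous_image compact_imp_bounded by blast
  then obtain H where H: "\<And>p v. norm p \<le> R \<Longrightarrow> norm v = 1 \<Longrightarrow> \<bar>hess p v \<bullet> v\<bar> \<le> H"
    unfolding bounded_iff by fastforce
  have "hess p v \<bullet> v \<le> max H 0 * (norm v)\<^sup>2" if p: "norm p \<le> R" for p v
  proof (cases "v = 0")
    case True
    then show ?thesis by simp
  next
    case False
    define w where "w = v /\<^sub>R norm v"
    have v: "v = norm v *\<^sub>R w" "norm w = 1" using False by (auto simp: w_def)
    have "hess p v \<bullet> v = (norm v)\<^sup>2 * (hess p w \<bullet> w)"
      by (subst (1 2) v(1)) (simp add: linear_simps[OF hess_linear] power2_eq_square)
    also have "\<dots> \<le> (norm v)\<^sup>2 * max H 0"
      using H[OF p v(2)] by (intro mult_left_mono) auto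
    finally show ?thesis by (simp add: mult.commute)
  qed
  then show ?thesis by (intro exI[of _ "max H 0"]) auto
qed

end

context directed_graph begin

lemma u_lipschitz: "\<bar>u p - u q\<bar> \<le> 2 * norm (p - q)" and F_lipschitz: "\<bar>F p - F q\<bar> \<le> norm (p - q)"
proof -
  have "\<bar>p \<bullet> e - q \<bullet> e\<bar> \<le> norm (p - q)"
    using Cauchy_Schwarz_ineq2[of "p - q" e] norm_e by (simp add: inner_diff_left)
  then show "\<bar>u p - u q\<bar> \<le> 2 * norm (p - q)" "\<bar>F p - F q\<bar> \<le> norm (p - q)"
    using lipschitz[of p q] unfolding u_def F_def abs_le_iff by (auto simp: field_simps)
qed

lemma geodesic_u_convex:
  assumes "discrete_geodesic M Y" "Suc i < M"
  shows "u (Y (Suc (Suc i))) - 2 * u (Y (Suc i)) + u (Y i) =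
     (second_diff_f Y i) * (1 - grad (Y (Suc i)) \<bullet> e)"
    and "F (Y (Suc (Suc i))) - 2 * F (Y (Suc i)) + F (Y i) =
     (second_diff_f Y i) * (1 + grad (Y (Suc i)) \<bullet> e) / 2"
proof -
  define k where "k = second_diff_f Y i"
  have "(second_diff Y i) \<bullet> e = k * (grad (Y (Suc i)) \<bullet> e)"
    using geodesic_second_difference(3)[OF assms] by (simp add: k_def)
  then have s: "Y (Suc (Suc i)) \<bullet> e - 2 * (Y (Suc i) \<bullet> e) + Y i \<bullet> e = k * (grad (Y (Suc i)) \<bullet> e)"
    by (simp add: inner_add_left inner_diff_left)
  have "u (Y (Suc (Suc i))) - 2 * u (Y (Suc i)) + u (Y i) = k - k * (grad (Y (Suc i)) \<bullet> e)"
    unfolding s[symmetric] by (simp add: u_def k_def)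
  then show "u (Y (Suc (Suc i))) - 2 * u (Y (Suc i)) + u (Y i) =
     (second_diff_f Y i) * (1 - grad (Y (Suc i)) \<bullet> e)"
    by (simp add: k_def algebra_simps)
  have "2 * (F (Y (Suc (Suc i))) - 2 * F (Y (Suc i)) + F (Y i)) = k + k * (grad (Y (Suc i)) \<bullet> e)"
    unfolding s[symmetric] by (simp add: F_def k_def field_simps)
  then show "F (Y (Suc (Suc i))) - 2 * F (Y (Suc i)) + F (Y i) =
     (second_diff_f Y i) * (1 + grad (Y (Suc i)) \<bullet> e) / 2"
    by (simp add: k_def algebra_simps)
qed

lemma abs_grad_e: "\<bar>grad p \<bullet> e\<bar> < 1"
  using Cauchy_Schwarz_ineq2[of "grad p" e] spacelike[of p] norm_e by simp

lemma geodesic_steps_mono: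
  assumes "discrete_geodesic M Y" "i \<le> j" "j < M"
  shows "u (Y (Suc i)) - u (Y i) \<le> u (Y (Suc j)) - u (Y j)"
    and "F (Y (Suc i)) - F (Y i) \<le> F (Y (Suc j)) - F (Y j)"
proof -
  have "0 \<le> u (Y (Suc (Suc i))) - 2 * u (Y (Suc i)) + u (Y i)"
    "0 \<le> F (Y (Suc (Suc i))) - 2 * F (Y (Suc i)) + F (Y i)" if "Suc i < M" for i
    unfolding geodesic_u_convex[OF assms(1) that]
    using geodesic_second_difference(2)[OF assms(1) that] abs_grad_e[of "Y (Suc i)"] by (auto simp: abs_less_iff)
  then have "u (Y (Suc i)) - u (Y i) \<le> u (Y (Suc (Suc i))) - u (Y (Suc i))"
    "F (Y (Suc i)) - F (Y i) \<le> F (Y (Suc (Suc i))) - F (Y (Suc i))" if "Suc i < M" for i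
    using that by (smt (verit))+
  then show "u (Y (Suc i)) - u (Y i) \<le> u (Y (Suc j)) - u (Y j)"
    "F (Y (Suc i)) - F (Y i) \<le> F (Y (Suc j)) - F (Y j)"
    using convex_seq_mono[of M "\<lambda>i. u (Y i)" i j] convex_seq_mono[of M "\<lambda>i. F (Y i)" i j] assms(2,3) by blast+
qed

text \<open>By convexity the first increment of \<open>u\<close> is the smallest one, and the first
  step bounds it from below.\<close>

lemma geodesic_u_lower:
  assumes "discrete_geodesic M Y" "norm (Y 1 - Y 0) \<le> d" "j \<le> j'" "j' \<le> M"
  shows "u (Y j) - 2 * d * real (j' - j) \<le> u (Y j')"
  using assms(3,4)
proof (induction j' rule: dec_induct)
  case (step i)
  have "- (2 * d) \<le> u (Y 1) - u (Y 0)" using u_lipschitz[of "Y 1" "Y 0"] assms(2) by (simp add: abs_le_iff)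
  also have "\<dots> \<le> u (Y (Suc i)) - u (Y i)"
    using geodesic_steps_mono(1)[OF assms(1), of 0 i] step by simp
  finally show ?case using step by (simp add: Suc_diff_le algebra_simps)
qed simp

end

context growing_graph begin

text \<open>\<open>F_upper\<close> bounds \<open>p \<bullet> e\<close> from above because
  \<open>u\<close> stays away from 0; the tangent plane at 0 bounds it from below because
  \<open>u\<close> grows at least linearly in direction \<open>- e\<close>.\<close>

lemma sublevel_bounded:
  assumes "\<delta> > 0"
  shows "\<exists>R. \<forall>p. \<delta> \<le> u p \<longrightarrow> u p \<le> b \<longrightarrow> \<bar>p \<bullet> n\<bar> \<le> y \<longrightarrow> norm p \<le> R"
proof -
  obtain B k where B: "B > 0" and F: "\<And>p. F p \<le> B * (1 + \<bar>p \<bullet> n\<bar>) ^ Suc k + 1 / (2 * \<kappa> * u p)"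
    using F_upper by blast
  define w where "w = 1 - grad 0 \<bullet> e"
  have w: "w > 0" using grad_inner_less[OF norm_e, of 0] by (simp add: w_def)
  define R1 where "R1 = B * (1 + y) ^ Suc k + 1 / (2 * \<kappa> * \<delta>)"
  define R2 where "R2 = (b - u 0 + y) / w"
  have "norm p \<le> \<bar>R1\<bar> + \<bar>R2\<bar> + y" if p: "\<delta> \<le> u p" "u p \<le> b" "\<bar>p \<bullet> n\<bar> \<le> y" for p
  proof -
    have "F p \<le> B * (1 + \<bar>p \<bullet> n\<bar>) ^ Suc k + 1 / (2 * \<kappa> * u p)" by (rule F)
    also have "\<dots> \<le> R1" unfolding R1_def
      using p B kappa_pos assms by (intro add_mono mult_left_mono power_mono divide_left_mono) auto
    finally have 1: "p \<bullet> e \<le> R1" using p_e[of p] p assms by linarith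
    have "\<bar>grad 0 \<bullet> n\<bar> \<le> 1" using Cauchy_Schwarz_ineq2[of "grad 0" n] spacelike[of 0] norm_n by simp
    then have "\<bar>(grad 0 \<bullet> n) * (p \<bullet> n)\<bar> \<le> 1 * y" unfolding abs_mult using p by (intro mult_mono) auto
    moreover have "u 0 - w * (p \<bullet> e) + (grad 0 \<bullet> n) * (p \<bullet> n) \<le> u p"
      using tangent_le[of 0 p] inner_decomp[of "grad 0" p] by (simp add: u_def w_def algebra_simps)
    ultimately have "- (p \<bullet> e) * w \<le> b - u 0 + y" using p(2) by (simp add: abs_le_iff mult.commute)
    then have "- (p \<bullet> e) \<le> R2" using w by (simp add: R2_def pos_le_divide_eq)
    then have "\<bar>p \<bullet> e\<bar> \<le> \<bar>R1\<bar> + \<bar>R2\<bar>" using 1 by linarith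
    moreover have "norm p \<le> \<bar>p \<bullet> e\<bar> + \<bar>p \<bullet> n\<bar>"
      by (rule power2_le_imp_le) (auto simp: norm_decomp power2_sum)
    ultimately show ?thesis using p(3) by linarith
  qed
  then show ?thesis by blast
qed

text \<open>While \<open>u\<close> stays above \<open>\<delta>\<close>, it decreases. As \<open>u\<close> and \<open>F\<close> are convex along a discrete geodesic,
  \<open>\<Delta>u \<Delta>F\<close> is bounded, so that the energy controls the coordinate \<open>y\<close>; hence the geodesic remains in
  a compact part of the surface.\<close>

lemma discrete_geodesic_bounds:
  assumes "\<delta> > 0" "D \<ge> 0" "E \<ge> 0"
  obtains R C where "C \<ge> 0" "\<And>N M Y J. N > 0 \<Longrightarrow> discrete_geodesic M Y \<Longrightarrow> M \<le> N \<Longrightarrow> Y 0 \<in> cball a 1 \<Longrightarrow>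
     norm (Y 1 - Y 0) \<le> D / real N \<Longrightarrow> energy M Y \<le> E / real N \<Longrightarrow> J \<le> M \<Longrightarrow> u (Y M) < \<delta> \<Longrightarrow> \<delta> \<le> u (Y J) \<Longrightarrow>
     (\<forall>j\<le>J. norm (Y j) \<le> R) \<and> (\<forall>j<J. norm (Y (Suc j) - Y j) \<le> C / real N) \<and>
     (\<forall>j. Suc j < J \<longrightarrow> norm (second_diff Y j) \<le> C / (real N)\<^sup>2)"
proof -
  define y1 where "y1 = norm a + 1 + (sqrt E + 2 * D)"
  obtain R where R: "\<And>p. \<delta> \<le> u p \<Longrightarrow> u p \<le> u a + 2 \<Longrightarrow> \<bar>p \<bullet> n\<bar> \<le> y1 \<Longrightarrow> norm p \<le> R"
    using sublevel_bounded[OF assms(1)] by blast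
  obtain l where l: "0 \<le> l" "l < 1" "\<And>p. norm p \<le> R \<Longrightarrow> norm (grad p) \<le> l"
    using grad_bound[of 0 R] by auto
  obtain H where H: "H \<ge> 0" "\<And>p v. norm p \<le> R \<Longrightarrow> hess p v \<bullet> v \<le> H * (norm v)\<^sup>2"
    using hess_bound by blast
  define C1 where "C1 = D + 2 * D / (1 - l)"
  define C2 where "C2 = H * C1\<^sup>2 / (1 - l)"
  have C12: "C1 \<ge> 0" "C2 \<ge> 0" using assms l H by (auto simp: C1_def C2_def)
  show thesis
  proof (rule that[of "max C1 C2" R])
    show "0 \<le> max C1 C2" using C12 by simp
    fix N M Y J assume N: "N > 0" and geo: "discrete_geodesic M Y" and MN: "M \<le> N" and Y0: "Y 0 \<in> cball a 1"
      and D: "norm (Y 1 - Y 0) \<le> D / real N" and E: "energy M Y \<le> E / real N"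
      and J: "J \<le> M" "u (Y M) < \<delta>" "\<delta> \<le> u (Y J)"
    define d where "d = D / real N"
    have d: "d \<ge> 0" "norm (Y 1 - Y 0) \<le> d" using assms D by (auto simp: d_def)
    have dN: "real J * d \<le> D"
    proof -
      have "real J * d \<le> real N * d" using d J MN by (intro mult_right_mono) auto
      then show ?thesis using N by (simp add: d_def)
    qed
    define du dF dy where "du i = u (Y (Suc i)) - u (Y i)" and "dF i = F (Y (Suc i)) - F (Y i)"
      and "dy i = (Y (Suc i) - Y i) \<bullet> n" for i
    \<comment> \<open>A nonnegative increment before \<open>J\<close> would make \<open>u\<close>
      nondecreasing from there on, against \<open>u (Y M) < \<delta> \<le> u (Y J)\<close>.\<close>
    have du_neg: "du j < 0" if "j < J" for j
    proof (rule ccontr)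
      assume "\<not> du j < 0"
      then have ge: "du i \<ge> 0" if "j \<le> i" "i < M" for i
        using geodesic_steps_mono(1)[OF geo that] by (simp add: du_def)
      have "u (Y J) \<le> u (Y i)" if "J \<le> i" "i \<le> M" for i using that
      proof (induction i rule: dec_induct)
        case (step i)
        then show ?case using ge[of i] \<open>j < J\<close> by (simp add: du_def)
      qed simp
      then show False using J by force
    qed
    have du_ge: "- (2 * d) \<le> du j" and dF_ge: "- d \<le> dF j" if "j < J" for j
      using geodesic_steps_mono[OF geo, of 0 j] that J u_lipschitz[of "Y 1" "Y 0"] F_lipschitz[of "Y 1" "Y 0"] d
      by (auto simp: du_def dF_def abs_le_iff)
    have u_dec: "u (Y j) \<le> u (Y i)" if "i \<le> j" "j \<le> J" for i j using that
    proof (induction j rule: dec_induct)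
      case (step j)
      then show ?case using du_neg[of j] by (simp add: du_def)
    qed simp
    \<comment> \<open>The product of the increments of \<open>F\<close> and \<open>u\<close> is
      positive only if both decrease, and then neither decreases faster than in the first
      step.\<close>
    have dy: "\<bar>dy j\<bar> \<le> sqrt (chord (Y j) (Y (Suc j))) + 2 * d" if "j < J" for j
    proof -
      have "dF j * du j \<le> 2 * d\<^sup>2"
      proof (cases "dF j \<ge> 0")
        case True
        then have "dF j * du j \<le> 0" using du_neg[OF that] by (simp add: mult_nonneg_nonpos)
        then show ?thesis using zero_le_power2[of d] by linarith
      next
        case False
        then have "(- dF j) * (- du j) \<le> d * (2 * d)"
          using du_ge[OF that] dF_ge[OF that] du_neg[OF that] d by (intro mult_mono) auto
        then show ?thesis by (simp add: power2_eq_square)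
      qed
      moreover have "chord (Y j) (Y (Suc j)) = (dy j)\<^sup>2 - 2 * (dF j * du j)"
        by (subst chord_commute) (simp add: chord_null dy_def dF_def du_def)
      ultimately have "(dy j)\<^sup>2 \<le> chord (Y j) (Y (Suc j)) + (2 * d)\<^sup>2" by (simp add: power2_eq_square)
      also have "\<dots> \<le> (sqrt (chord (Y j) (Y (Suc j))) + 2 * d)\<^sup>2"
        using chord_nonneg d by (simp add: power2_sum)
      finally have "\<bar>dy j\<bar> \<le> \<bar>sqrt (chord (Y j) (Y (Suc j))) + 2 * d\<bar>" by (simp only: abs_le_square_iff)
      then show ?thesis using chord_nonneg[of "Y j" "Y (Suc j)"] d by simp
    qed
    have sum_dy: "(\<Sum>j<J. \<bar>dy j\<bar>) \<le> sqrt E + 2 * D"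
    proof -
      have "(\<Sum>j<J. sqrt (chord (Y j) (Y (Suc j))))\<^sup>2 \<le> (\<Sum>j<J. (sqrt (chord (Y j) (Y (Suc j))))\<^sup>2) * card {..<J}"
        by (rule sum_squared_le_sum_of_squares)
      also have "\<dots> = (\<Sum>j<J. chord (Y j) (Y (Suc j))) * real J" by (simp add: chord_nonneg)
      also have "\<dots> \<le> E / real N * real N"
      proof (intro mult_mono)
        have "(\<Sum>j<J. chord (Y j) (Y (Suc j))) \<le> energy M Y"
          unfolding energy_def using J by (intro sum_mono2) (auto simp: chord_nonneg)
        then show "(\<Sum>j<J. chord (Y j) (Y (Suc j))) \<le> E / real N" using E by linarith
      qed (use J MN assms in auto)
      also have "\<dots> = E" using N by simp
      finally have "(\<Sum>j<J. sqrt (chord (Y j) (Y (Suc j)))) \<le> sqrt E"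
        by (rule real_le_rsqrt)
      moreover have "(\<Sum>j<J. \<bar>dy j\<bar>) \<le> (\<Sum>j<J. sqrt (chord (Y j) (Y (Suc j))) + 2 * d)"
        by (rule sum_mono) (use dy in auto)
      ultimately show ?thesis using dN by (simp add: sum.distrib)
    qed
    have bound: "norm (Y j) \<le> R" if "j \<le> J" for j
    proof (rule R)
      show "\<delta> \<le> u (Y j)" using u_dec[OF that] J by simp
      have "u (Y j) \<le> u (Y 0)" using u_dec[of 0 j] that by simp
      then show "u (Y j) \<le> u a + 2" using u_lipschitz[of a "Y 0"] Y0 by (simp add: dist_norm abs_le_iff)
      have "\<bar>Y j \<bullet> n - Y 0 \<bullet> n\<bar> \<le> (\<Sum>i<j. \<bar>Y (Suc i) \<bullet> n - Y i \<bullet> n\<bar>)"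
        using norm_diff_le_sum_steps[of "\<lambda>i. Y i \<bullet> n" j] by simp
      also have "\<dots> \<le> (\<Sum>i<J. \<bar>Y (Suc i) \<bullet> n - Y i \<bullet> n\<bar>)" using that by (intro sum_mono2) auto
      also have "\<dots> \<le> sqrt E + 2 * D" using sum_dy by (simp add: dy_def inner_diff_left)
      finally have "\<bar>Y j \<bullet> n\<bar> \<le> \<bar>Y 0 \<bullet> n\<bar> + (sqrt E + 2 * D)" by linarith
      moreover have "\<bar>Y 0 \<bullet> n\<bar> \<le> norm (Y 0)" using Cauchy_Schwarz_ineq2[of "Y 0" n] norm_n by simp
      moreover have "norm (Y 0) \<le> norm a + 1" using Y0 norm_triangle_sub[of "Y 0" a] by (simp add: dist_norm norm_minus_commute)
      ultimately show "\<bar>Y j \<bullet> n\<bar> \<le> y1" by (simp add: y1_def)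
    qed
    define k where "k i = second_diff_f Y i" for i
    have k0: "0 \<le> k i" if "Suc i < J" for i
      using geodesic_second_difference(2)[OF geo, of i] that J by (simp add: k_def)
    have sd: "second_diff Y i = k i *\<^sub>R grad (Y (Suc i))" if "Suc i < J" for i
      using geodesic_second_difference(3)[OF geo, of i] that J by (simp add: k_def)
    have gl: "norm (grad (Y i)) \<le> l" if "i \<le> J" for i using l(3) bound[OF that] by simp
    have nsd: "norm (second_diff Y i) \<le> k i" if "Suc i < J" for i
      unfolding sd[OF that] using k0[OF that] gl[of "Suc i"] that l by (simp add: mult_left_le)
    \<comment> \<open>The increments of \<open>u\<close> grow from at least \<open>- 2 * d\<close>
      to at most 0, and each gain is at least \<open>k i * (1 - l)\<close>. So the velocity changes
      in total by no more than the order of one step.\<close>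
    have sum_k: "(\<Sum>i<m. k i) * (1 - l) \<le> 2 * d" if "m < J" for m
    proof -
      have "k i * (1 - l) \<le> du (Suc i) - du i" if i: "Suc i < J" for i
      proof -
        have "grad (Y (Suc i)) \<bullet> e \<le> l"
          using Cauchy_Schwarz_ineq2[of "grad (Y (Suc i))" e] norm_e gl[of "Suc i"] i by simp
        then have "k i * (1 - l) \<le> k i * (1 - grad (Y (Suc i)) \<bullet> e)" using k0[OF i] by (intro mult_left_mono) auto
        also have "\<dots> = du (Suc i) - du i"
          using geodesic_u_convex(1)[OF geo, of i] i J by (simp add: k_def du_def)
        finally show ?thesis .
      qed
      then have "(\<Sum>i<m. k i * (1 - l)) \<le> (\<Sum>i<m. du (Suc i) - du i)"
        using that by (intro sum_mono) auto
      also have "\<dots> = du m - du 0" by (rule sum_lessThan_telescope)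
      also have "\<dots> \<le> 2 * d" using du_neg[OF that] du_ge[of 0] that by simp
      finally show ?thesis by (simp add: sum_distrib_right)
    qed
    have step: "norm (Y (Suc j) - Y j) \<le> C1 / real N" if "j < J" for j
    proof -
      have "norm ((Y (Suc j) - Y j) - (Y (Suc 0) - Y 0)) \<le> (\<Sum>i<j. norm ((Y (Suc (Suc i)) - Y (Suc i)) - (Y (Suc i) - Y i)))"
        by (rule norm_diff_le_sum_steps[of "\<lambda>i. Y (Suc i) - Y i"])
      also have "\<dots> \<le> (\<Sum>i<j. k i)"
        using nsd that by (intro sum_mono) (simp add: algebra_simps scaleR_2)
      also have "\<dots> \<le> 2 * d / (1 - l)" using sum_k[OF that] l by (simp add: pos_le_divide_eq)
      finally have "norm (Y (Suc j) - Y j) \<le> d + 2 * d / (1 - l)"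
        using d norm_triangle_sub[of "Y (Suc j) - Y j" "Y (Suc 0) - Y 0"] by simp
      also have "\<dots> = C1 / real N" by (simp add: d_def C1_def add_divide_distrib)
      finally show ?thesis .
    qed
    have rem: "f q - f p - grad p \<bullet> (q - p) \<le> H * (C1 / real N)\<^sup>2 / 2"
      if "norm p \<le> R" "norm q \<le> R" "norm (q - p) \<le> C1 / real N" for p q
    proof -
      obtain s where s: "0 \<le> s" "s \<le> 1" "f q - f p - grad p \<bullet> (q - p) = (hess (p + s *\<^sub>R (q - p)) (q - p) \<bullet> (q - p)) / 2"
        using taylor by blast
      have "(1 - s) *\<^sub>R p + s *\<^sub>R q \<in> cball 0 R"
        by (rule convexD_alt[OF convex_cball]) (use s that in auto)
      then have "norm (p + s *\<^sub>R (q - p)) \<le> R" by (simp add: algebra_simps)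
      then have "hess (p + s *\<^sub>R (q - p)) (q - p) \<bullet> (q - p) \<le> H * (norm (q - p))\<^sup>2" by (rule H(2))
      also have "\<dots> \<le> H * (C1 / real N)\<^sup>2" using that H(1) by (intro mult_left_mono power_mono) auto
      finally show ?thesis using s(3) by simp
    qed
    have acc: "norm (second_diff Y j) \<le> C2 / (real N)\<^sup>2" if "Suc j < J" for j
    proof -
      have "(norm (grad (Y (Suc j))))\<^sup>2 \<le> l"
      proof -
        have "(norm (grad (Y (Suc j))))\<^sup>2 \<le> l\<^sup>2" using gl[of "Suc j"] that by (intro power_mono) auto
        also have "\<dots> \<le> l" using l by (simp add: power2_eq_square mult_left_le)
        finally show ?thesis .
      qed
      then have "k j * (1 - l) \<le> k j * (1 - (norm (grad (Y (Suc j))))\<^sup>2)" using k0[OF that] by (intro mult_left_mono) auto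
      also have "\<dots> \<le> H * (C1 / real N)\<^sup>2 / 2 + H * (C1 / real N)\<^sup>2 / 2"
        unfolding k_def using that J geodesic_second_difference(1)[OF geo, of j]
          rem[of "Y (Suc j)" "Y (Suc (Suc j))"] rem[of "Y (Suc j)" "Y j"] bound[of j] bound[of "Suc j"] bound[of "Suc (Suc j)"]
          step[of j] step[of "Suc j"] by (simp add: norm_minus_commute)
      finally have "k j \<le> H * (C1 / real N)\<^sup>2 / (1 - l)" using l by (simp add: pos_le_divide_eq)
      also have "\<dots> = C2 / (real N)\<^sup>2" by (simp add: C2_def power_divide)
      finally show ?thesis using nsd[OF that] by linarith
    qed
    have "C1 / real N \<le> max C1 C2 / real N" "C2 / (real N)\<^sup>2 \<le> max C1 C2 / (real N)\<^sup>2"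
      by (auto intro: divide_right_mono)
    then show "(\<forall>j\<le>J. norm (Y j) \<le> R) \<and> (\<forall>j<J. norm (Y (Suc j) - Y j) \<le> max C1 C2 / real N) \<and>
     (\<forall>j. Suc j < J \<longrightarrow> norm (second_diff Y j) \<le> max C1 C2 / (real N)\<^sup>2)"
      using bound step acc by (meson order_trans)
  qed
qed

text \<open>By the pigeonhole principle one of the first steps has at most average energy.\<close>

lemma slow_start:
  fixes a :: plane
  assumes E: "E > 0"
  obtains D where "D > 0" "\<forall>\<^sub>F N in sequentially. \<forall>X. X 0 = a \<longrightarrow> energy N X \<le> E / real N \<longrightarrow>
    (\<exists>i<N. X i \<in> cball a 1 \<and> norm (X (Suc i) - X i) \<le> D / real N)"
proof -
  obtain b where b: "0 < b" "\<And>p q. p \<in> cball a 1 \<Longrightarrow> norm (p - q) \<le> 1 \<Longrightarrow> b * (norm (p - q))\<^sup>2 \<le> chord p q"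
    "\<And>p q. p \<in> cball a 1 \<Longrightarrow> 1 \<le> norm (p - q) \<Longrightarrow> b * norm (p - q) \<le> chord p q"
    by (rule chord_lower[of a 1]) (rule that; blast)
  \<comment> \<open>During the first \<open>\<eta> * N\<close> steps the path cannot leave the unit
    ball: by Cauchy-Schwarz the square of the distance covered is at most
    \<open>\<eta> * E / b \<le> 1\<close>.\<close>
  define \<eta> where "\<eta> = min 1 (b / E)"
  have \<eta>: "\<eta> > 0" "\<eta> \<le> 1" "\<eta> * E \<le> b" using b E by (auto simp: \<eta>_def min_def field_simps)
  define D where "D = sqrt (2 * E / (\<eta> * b))"
  have D: "D > 0" using E \<eta> b by (simp add: D_def)
  have main: "\<exists>i<N. X i \<in> cball a 1 \<and> norm (X (Suc i) - X i) \<le> D / real N"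
    if N: "real N > E / b" "real N \<ge> 2 / \<eta>" "N > 0" and X: "X 0 = a" "energy N X \<le> E / real N" for N X
  proof -
    define m where "m = nat \<lfloor>\<eta> * real N\<rfloor>"
    have \<eta>N: "\<eta> * real N \<ge> 2" using N(2) \<eta> by (simp add: field_simps)
    have m: "real m \<le> \<eta> * real N" "real m \<ge> \<eta> * real N / 2" "m > 0" using \<eta>N unfolding m_def by linarith+
    have "real m \<le> real N" using m(1) \<eta> by (smt (verit) mult_left_le_one_le of_nat_0_le_iff)
    then have mN: "m \<le> N" by simp
    have EN: "E / real N < b" using N b by (simp add: field_simps)
    have chord_le: "chord (X i) (X (Suc i)) \<le> E / real N" if "i < N" for i
    proof -
      have "chord (X i) (X (Suc i)) \<le> energy N X"
        unfolding energy_def using that by (intro member_le_sum) (auto simp: chord_nonneg)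
      then show ?thesis using X by linarith
    qed
    have step: "b * (norm (X (Suc i) - X i))\<^sup>2 \<le> chord (X i) (X (Suc i))" if "i < N" "X i \<in> cball a 1" for i
    proof -
      have "norm (X i - X (Suc i)) < 1"
      proof (rule ccontr)
        assume "\<not> ?thesis"
        then have ge: "1 \<le> norm (X i - X (Suc i))" by simp
        then have "b * 1 \<le> b * norm (X i - X (Suc i))" using b(1) by (intro mult_left_mono) auto
        also have "\<dots> \<le> chord (X i) (X (Suc i))" by (rule b(3)[OF that(2) ge])
        finally show False using chord_le[OF that(1)] EN by linarith
      qed
      then show ?thesis using b(2)[OF that(2), of "X (Suc i)"] by (simp add: norm_minus_commute)
    qed
    have near: "X i \<in> cball a 1" if "i \<le> m" for i using that
    proof (induction i rule: less_induct)
      case (less i)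
      have "norm (X i - X 0) \<le> (\<Sum>j<i. norm (X (Suc j) - X j))" by (rule norm_diff_le_sum_steps)
      moreover have "(\<Sum>j<i. norm (X (Suc j) - X j))\<^sup>2 \<le> 1"
      proof -
        have "b * (\<Sum>j<i. (norm (X (Suc j) - X j))\<^sup>2) \<le> (\<Sum>j<i. chord (X j) (X (Suc j)))"
          unfolding sum_distrib_left using less mN by (intro sum_mono step) auto
        also have "\<dots> \<le> energy N X" unfolding energy_def using less.prems mN by (intro sum_mono2) (auto simp: chord_nonneg)
        also have "\<dots> \<le> E / real N" by (rule X)
        finally have s: "(\<Sum>j<i. (norm (X (Suc j) - X j))\<^sup>2) \<le> E / real N / b"
          using b(1) by (simp only: pos_le_divide_eq mult.commute[of _ b])
        have "(\<Sum>j<i. norm (X (Suc j) - X j))\<^sup>2 \<le> (\<Sum>j<i. (norm (X (Suc j) - X j))\<^sup>2) * card {..<i}"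
          by (rule sum_squared_le_sum_of_squares)
        also have "\<dots> \<le> E / real N / b * (\<eta> * real N)"
          using s m(1) less.prems E b by (intro mult_mono) (auto intro: sum_nonneg)
        also have "\<dots> = \<eta> * E / b" using N(3) by simp
        also have "\<dots> \<le> 1" using \<eta>(3) b(1) by simp
        finally show ?thesis .
      qed
      then have "(\<Sum>j<i. norm (X (Suc j) - X j)) \<le> 1" by (simp add: abs_square_le_1 sum_nonneg)
      ultimately show ?case using X(1) by (simp add: dist_norm norm_minus_commute)
    qed
    have "\<exists>i<m. chord (X i) (X (Suc i)) \<le> E / real N / real m"
    proof (rule ccontr)
      assume "\<not> ?thesis"
      then have "(\<Sum>i<m. E / real N / real m) < (\<Sum>i<m. chord (X i) (X (Suc i)))"
        using m(3) by (intro sum_strict_mono) auto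
      also have "\<dots> \<le> energy N X" unfolding energy_def using mN by (intro sum_mono2) (auto simp: chord_nonneg)
      finally show False using X(2) m(3) by simp
    qed
    then obtain i where i: "i < m" "chord (X i) (X (Suc i)) \<le> E / real N / real m" by blast
    have "b * (norm (X (Suc i) - X i))\<^sup>2 \<le> E / real N / real m" using step[of i] near[of i] i mN by simp
    also have "\<dots> \<le> E / real N / (\<eta> * real N / 2)"
      using m E N \<eta> by (intro divide_left_mono) auto
    finally have "(norm (X (Suc i) - X i))\<^sup>2 \<le> E / real N / (\<eta> * real N / 2) / b"
      using b(1) by (simp only: pos_le_divide_eq mult.commute[of _ b])
    also have "\<dots> = (D / real N)\<^sup>2"
      using E \<eta> b(1) by (simp add: D_def power_divide power2_eq_square mult_ac)
    finally have "norm (X (Suc i) - X i) \<le> D / real N"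
      by (rule power2_le_imp_le) (use D in simp)
    then show ?thesis using i mN near[of i] by (intro exI[of _ i]) auto
  qed
  have "\<forall>\<^sub>F N in sequentially. real N > E / b \<and> real N \<ge> 2 / \<eta> \<and> N > 0"
    by (intro eventually_conj eventually_gt_at_top
        eventually_compose_filterlim[OF eventually_gt_at_top filterlim_real_sequentially]
        eventually_compose_filterlim[OF eventually_ge_at_top filterlim_real_sequentially])
  then have "\<forall>\<^sub>F N in sequentially. \<forall>X. X 0 = a \<longrightarrow> energy N X \<le> E / real N \<longrightarrow>
    (\<exists>i<N. X i \<in> cball a 1 \<and> norm (X (Suc i) - X i) \<le> D / real N)"
    by eventually_elim (use main in blast)
  then show thesis using that D by blast
qed

text \<open>The bound \<open>E / N\<close> for a single chord only gives steps of order
  \<open>1 / sqrt N\<close>, whereas \<open>discrete_geodesic_bounds\<close> asks for a first step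
  of order \<open>1 / N\<close>. The geodesics are therefore restarted at the slow step found by
  \<open>slow_start\<close>.\<close>

lemma discrete_geodesics_bounded_speed:
  obtains E D a M Y where "E > 0" "D > 0"
    "\<forall>\<^sub>F N in sequentially. discrete_geodesic (M N) (Y N) \<and> 0 < N \<and> M N \<le> N \<and> Y N 0 \<in> cball a 1 \<and>
       norm (Y N 1 - Y N 0) \<le> D / real N \<and> energy (M N) (Y N) \<le> E / real N"
    "(\<lambda>N. u (Y N (M N))) \<longlonglongrightarrow> 0"
proof (rule discrete_geodesics_bounded_energy)
  fix E :: real and a and X :: "nat \<Rightarrow> nat \<Rightarrow> plane"
  assume E: "E > 0" and X: "\<And>N. N > 0 \<Longrightarrow> discrete_geodesic N (X N)" "\<And>N. N > 0 \<Longrightarrow> X N 0 = a"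
    "\<And>N. N > 0 \<Longrightarrow> energy N (X N) \<le> E / real N" "(\<lambda>N. u (X N N)) \<longlonglongrightarrow> 0"
  obtain D where D: "D > 0" and ev: "\<forall>\<^sub>F N in sequentially. \<forall>X. X 0 = a \<longrightarrow> energy N X \<le> E / real N \<longrightarrow>
    (\<exists>i<N. X i \<in> cball a 1 \<and> norm (X (Suc i) - X i) \<le> D / real N)"
    using slow_start[OF E] by blast
  define P where "P N i \<longleftrightarrow> i < N \<and> X N i \<in> cball a 1 \<and> norm (X N (Suc i) - X N i) \<le> D / real N" for N i
  \<comment> \<open>The default value concerns finitely many \<open>N\<close> only and keeps
    \<open>s N \<le> N\<close> for all of them.\<close>
  define s where "s N = (if \<exists>i. P N i then SOME i. P N i else 0)" for N
  define M Y where "M N = N - s N" and "Y N j = X N (s N + j)" for N j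
  have P: "P N (s N)" if "\<exists>i. P N i" for N using someI_ex[OF that] that by (simp add: s_def)
  have s_le: "s N \<le> N" for N using P[of N] by (cases "\<exists>i. P N i") (auto simp: P_def s_def)
  show thesis
  proof (rule that[OF E D, of M Y a])
    have "Y N (M N) = X N N" for N using s_le[of N] by (simp add: Y_def M_def)
    then show "(\<lambda>N. u (Y N (M N))) \<longlonglongrightarrow> 0" using X(4) by simp
    show "\<forall>\<^sub>F N in sequentially. discrete_geodesic (M N) (Y N) \<and> 0 < N \<and> M N \<le> N \<and> Y N 0 \<in> cball a 1 \<and>
       norm (Y N 1 - Y N 0) \<le> D / real N \<and> energy (M N) (Y N) \<le> E / real N"
      using ev eventually_gt_at_top[of 0]
    proof eventually_elim
      case (elim N)
      then have "P N (s N)" using X(2,3)[of N] by (intro P) (auto simp: P_def)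
      moreover have "discrete_geodesic (M N) (Y N)"
        unfolding discrete_geodesic_def
      proof (intro allI impI)
        fix i assume "Suc i < M N"
        then show "second_diff (Y N) i =
          (second_diff_f (Y N) i) *\<^sub>R grad (Y N (Suc i))"
          using X(1)[of N, unfolded discrete_geodesic_def, rule_format, of "s N + i"] elim(2)
          by (simp add: Y_def M_def)
      qed
      moreover have "energy (M N) (Y N) \<le> energy N (X N)"
      proof -
        have "energy (M N) (Y N) = (\<Sum>i\<in>(+) (s N) ` {..<M N}. chord (X N i) (X N (Suc i)))"
          by (simp add: energy_def Y_def sum.reindex)
        also have "\<dots> \<le> energy N (X N)"
          unfolding energy_def by (intro sum_mono2) (auto simp: chord_nonneg M_def)
        finally show ?thesis .
      qed
      ultimately show ?case using X(3)[of N] elim(2) by (auto simp: P_def M_def Y_def)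
    qed
  qed
qed

end

section \<open>Passage to the limit\<close>

text \<open>Along a filter from Tychonoff's theorem for extended reals all sequences converge at once, also
  those that are unbounded; this avoids diagonal subsequences.\<close>

lemma cluster_filter:
  fixes a :: "nat \<Rightarrow> 'i \<Rightarrow> real"
  obtains G where "G \<noteq> bot" "G \<le> sequentially" "\<And>i. \<exists>l::ereal. ((\<lambda>N. ereal (a N i)) \<longlongrightarrow> l) G"
proof -
  define h where "h N i = ereal (a N i)" for N i
  have "compact (Pi UNIV (\<lambda>_::'i. UNIV :: ereal set))" by (intro compact_Pi_UNIV compact_UNIV)
  moreover have "Pi UNIV (\<lambda>_::'i. UNIV :: ereal set) = UNIV" by auto
  ultimately have "compact (UNIV :: ('i \<Rightarrow> ereal) set)" by simp
  moreover have "filtermap h sequentially \<noteq> bot" by (simp add: filtermap_bot_iff)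
  ultimately obtain x where x: "inf (nhds x) (filtermap h sequentially) \<noteq> bot"
    unfolding compact_filter by (meson UNIV_I always_eventually)
  \<comment> \<open>The coarsest filter finer than \<open>sequentially\<close> along which
    \<open>h\<close> tends to the cluster point \<open>x\<close>; it is nontrivial because
    \<open>x\<close> is a cluster point.\<close>
  define G where "G = inf sequentially (filtercomap h (nhds x))"
  show thesis
  proof (rule that[of G])
    show "G \<noteq> bot"
    proof
      assume "G = bot"
      then have "eventually (\<lambda>_. False) G" by simp
      then obtain P Q where PQ: "eventually P sequentially" "eventually Q (nhds x)" "\<And>N. P N \<Longrightarrow> Q (h N) \<Longrightarrow> False"
        unfolding G_def eventually_inf eventually_filtercomap by blast
      have "eventually (\<lambda>y. \<not> Q y) (filtermap h sequentially)"
        unfolding eventually_filtermap using PQ(1) by eventually_elim (use PQ(3) in blast)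
      then have "eventually (\<lambda>_. False) (inf (nhds x) (filtermap h sequentially))"
        using PQ(2) unfolding eventually_inf by blast
      then show False using x by (simp add: trivial_limit_def)
    qed
    show "G \<le> sequentially" by (simp add: G_def)
    fix i
    have lim: "filterlim h (nhds x) G"
      unfolding G_def by (rule filterlim_mono[OF filterlim_filtercomap]) auto
    have "((\<lambda>N. h N i) \<longlongrightarrow> x i) G"
    proof (rule topological_tendstoI)
      fix S :: "ereal set" assume S: "open S" "x i \<in> S"
      have "open ((\<lambda>y :: 'i \<Rightarrow> ereal. y i) -` S)"
        by (rule open_vimage[OF S(1) continuous_on_product_coordinates])
      then have "eventually (\<lambda>y. y i \<in> S) (nhds x)"
        using eventually_nhds_in_open[of "(\<lambda>y :: 'i \<Rightarrow> ereal. y i) -` S" x] S(2) by simp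
      then show "\<forall>\<^sub>F N in G. h N i \<in> S"
        using lim unfolding filterlim_iff by blast
    qed
    then show "\<exists>l::ereal. ((\<lambda>N. ereal (a N i)) \<longlongrightarrow> l) G" by (auto simp: h_def)
  qed
qed

lemma bounded_ereal_limit:
  fixes x :: "'a \<Rightarrow> real"
  assumes lim: "((\<lambda>N. ereal (x N)) \<longlongrightarrow> l) G" and "G \<noteq> bot" and bd: "\<forall>\<^sub>F N in G. \<bar>x N\<bar> \<le> B"
  shows "\<exists>r. (x \<longlongrightarrow> r) G"
proof -
  have "l \<le> ereal B"
    by (rule tendsto_upperbound[OF lim _ \<open>G \<noteq> bot\<close>]) (use bd in \<open>auto elim: eventually_mono\<close>)
  moreover have "ereal (- B) \<le> l"
    by (rule tendsto_lowerbound[OF lim _ \<open>G \<noteq> bot\<close>]) (use bd in \<open>auto elim: eventually_mono\<close>)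
  ultimately obtain r where "l = ereal r" by (cases l) auto
  then show ?thesis using lim by auto
qed

definition idx :: "nat \<Rightarrow> real \<Rightarrow> nat" where
  "idx N t = nat \<lfloor>t * real N\<rfloor>"

lemma idx_bounds: "t \<ge> 0 \<Longrightarrow> real (idx N t) \<le> t * real N" "t * real N - 1 < real (idx N t)"
  unfolding idx_def by (simp_all, linarith)

lemma idx_mono: "s \<le> t \<Longrightarrow> idx N s \<le> idx N t"
  unfolding idx_def by (intro nat_mono floor_mono mult_right_mono) auto

lemma idx_0 [simp]: "idx N 0 = 0" and idx_1 [simp]: "idx N 1 = N"
  by (simp_all add: idx_def)

lemma idx_tendsto:
  assumes "t \<ge> 0"
  shows "(\<lambda>N. real (idx N t) / real N) \<longlonglongrightarrow> t"
proof (rule tendsto_sandwich)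
  show "\<forall>\<^sub>F N in sequentially. t - 1 / real N \<le> real (idx N t) / real N"
    using eventually_gt_at_top[of 0]
    by eventually_elim (use idx_bounds(2)[of t] in \<open>simp add: pos_le_divide_eq left_diff_distrib less_imp_le\<close>)
  show "\<forall>\<^sub>F N in sequentially. real (idx N t) / real N \<le> t"
    using eventually_gt_at_top[of 0]
    by eventually_elim (use idx_bounds(1)[OF assms] in \<open>simp add: field_simps\<close>)
  show "(\<lambda>N. t - 1 / real N) \<longlonglongrightarrow> t"
    using tendsto_diff[OF tendsto_const lim_1_over_n, of t] by simp
qed simp

lemma eventually_real_gt: "\<forall>\<^sub>F N in sequentially. x < real N"
  by (rule eventually_compose_filterlim[OF eventually_gt_at_top filterlim_real_sequentially])

lemma eventually_idx_less:
  assumes "0 \<le> s" "s < t"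
  shows "\<forall>\<^sub>F N in sequentially. idx N s + k < idx N t"
  using eventually_real_gt[of "(real k + 1) / (t - s)"]
proof eventually_elim
  case (elim N)
  then have "real k + 1 < real N * (t - s)" using assms by (simp add: field_simps)
  then have "real (idx N s + k) < real (idx N t)"
    using idx_bounds(1)[OF assms(1), of N] idx_bounds(2)[of t N] by (simp add: algebra_simps)
  then show ?case by simp
qed

lemma lipschitz_steps:
  fixes Z :: "nat \<Rightarrow> 'a::real_normed_vector"
  assumes "\<And>j. j < J \<Longrightarrow> norm (Z (Suc j) - Z j) \<le> c" "i \<le> j" "j \<le> J"
  shows "norm (Z j - Z i) \<le> c * (real j - real i)"
  using assms(2,3)
proof (induction j rule: dec_induct)
  case (step j)
  have "norm (Z (Suc j) - Z i) \<le> norm (Z (Suc j) - Z j) + norm (Z j - Z i)"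
    using norm_triangle_ineq[of "Z (Suc j) - Z j" "Z j - Z i"] by simp
  also have "\<dots> \<le> c + c * (real j - real i)" using step assms(1)[of j] by simp
  finally show ?case by (simp add: algebra_simps)
qed simp

text \<open>The Lipschitz bound spreads convergence at the time \<open>s\<close> over nearby
  indices. One third of \<gamma> is spent on the convergence, two thirds on an index distance of
  \<open>2 * \<delta> * N\<close>, half of which allows for the rounding in
  \<open>idx\<close>.\<close>

lemma near_limit:
  fixes Z :: "nat \<Rightarrow> nat \<Rightarrow> 'a::real_normed_vector"
  assumes G: "G \<le> sequentially" and s: "0 \<le> s" "s < t1" and C: "C \<ge> 0"
    and lim: "((\<lambda>N. Z N (idx N s)) \<longlongrightarrow> z) G"
    and lip: "\<forall>\<^sub>F N in G. \<forall>j < idx N t1. norm (Z N (Suc j) - Z N j) \<le> C / real N"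
    and \<gamma>: "\<gamma> > 0"
  shows "\<exists>\<delta>>0. \<forall>\<^sub>F N in G. \<forall>j \<le> idx N t1. \<bar>real j / real N - s\<bar> < \<delta> \<longrightarrow> norm (Z N j - z) < \<gamma>"
proof -
  define \<delta> where "\<delta> = \<gamma> / (3 * (C + 1))"
  have \<delta>: "\<delta> > 0" "C * \<delta> \<le> \<gamma> / 3"
    using C \<gamma> by (auto simp: \<delta>_def field_simps)
  have "\<forall>\<^sub>F N in G. dist (Z N (idx N s)) z < \<gamma> / 3" using tendstoD[OF lim, of "\<gamma> / 3"] \<gamma> by simp
  moreover have "\<forall>\<^sub>F N in G. 1 / \<delta> < real N" using filter_leD[OF G eventually_real_gt] .
  moreover note lip
  ultimately have "\<forall>\<^sub>F N in G. \<forall>j \<le> idx N t1. \<bar>real j / real N - s\<bar> < \<delta> \<longrightarrow> norm (Z N j - z) < \<gamma>"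
  proof eventually_elim
    case (elim N)
    show ?case
    proof (intro allI impI)
      fix j assume j: "j \<le> idx N t1" "\<bar>real j / real N - s\<bar> < \<delta>"
      have N: "real N > 0" using elim(2) \<delta> by (smt (verit) divide_pos_pos)
      have "norm (Z N j - Z N (idx N s)) \<le> C / real N * \<bar>real j - real (idx N s)\<bar>"
      proof (cases "idx N s \<le> j")
        case True
        then show ?thesis using lipschitz_steps[of "idx N t1" "Z N" "C / real N" "idx N s" j] elim(3) j by simp
      next
        case False
        then show ?thesis
          using lipschitz_steps[of "idx N t1" "Z N" "C / real N" j "idx N s"] elim(3) idx_mono[of s t1 N] s
          by (simp add: norm_minus_commute)
      qed
      also have "\<dots> \<le> C / real N * (2 * \<delta> * real N)"
      proof (rule mult_left_mono)
        have "\<bar>real j - s * real N\<bar> < \<delta> * real N"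
        proof -
          have "\<bar>real j / real N - s\<bar> * real N < \<delta> * real N" using j(2) N by simp
          moreover have "\<bar>real j / real N - s\<bar> * real N = \<bar>(real j / real N - s) * real N\<bar>" by (simp add: abs_mult)
          ultimately show ?thesis using N by (simp add: left_diff_distrib)
        qed
        moreover have "1 < \<delta> * real N" using elim(2) \<delta> by (simp add: field_simps)
        ultimately show "\<bar>real j - real (idx N s)\<bar> \<le> 2 * \<delta> * real N"
          using idx_bounds(1)[OF s(1), of N] idx_bounds(2)[of s N] by linarith
      qed (use C in simp)
      also have "\<dots> = 2 * (C * \<delta>)" using N by simp
      finally have "norm (Z N j - Z N (idx N s)) \<le> 2 * (\<gamma> / 3)" using \<delta> by linarith
      then show "norm (Z N j - z) < \<gamma>"
        using elim(1) norm_triangle_ineq[of "Z N j - Z N (idx N s)" "Z N (idx N s) - z"] by (simp add: dist_norm)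
    qed
  qed
  then show ?thesis using \<delta> by blast
qed

text \<open>If the scaled increments near \<open>s\<close> are close to \<open>A\<close>, their sum
  over the indices between two times is close to a multiple of \<open>A\<close>, and this survives
  in the limit. Applied to positions and to velocities.\<close>

lemma limit_has_vector_derivative:
  fixes Z :: "nat \<Rightarrow> nat \<Rightarrow> 'a::real_normed_vector"
  assumes G: "G \<noteq> bot" "G \<le> sequentially" and s: "0 \<le> s" "s < t1"
    and lim: "\<And>t. 0 \<le> t \<Longrightarrow> t < t1 \<Longrightarrow> ((\<lambda>N. Z N (idx N t)) \<longlongrightarrow> z t) G"
    and inc: "\<And>\<epsilon>. \<epsilon> > 0 \<Longrightarrow> \<exists>\<delta>>0. \<forall>\<^sub>F N in G. \<forall>j < idx N t1. \<bar>real j / real N - s\<bar> < \<delta> \<longrightarrow>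
      norm (real N *\<^sub>R (Z N (Suc j) - Z N j) - A) \<le> \<epsilon>"
  shows "(z has_vector_derivative A) (at s within {0..<t1})"
  unfolding has_vector_derivative_def has_derivative_within_alt
proof (intro conjI allI impI)
  show "bounded_linear (\<lambda>x. x *\<^sub>R A)" by (rule bounded_linear_scaleR_left)
  fix \<epsilon> :: real assume \<epsilon>: "\<epsilon> > 0"
  obtain \<delta> where \<delta>: "\<delta> > 0" and ev: "\<forall>\<^sub>F N in G. \<forall>j < idx N t1. \<bar>real j / real N - s\<bar> < \<delta> \<longrightarrow>
      norm (real N *\<^sub>R (Z N (Suc j) - Z N j) - A) \<le> \<epsilon>"
    using inc[OF \<epsilon>] by blast
  have key: "norm (z b - z a - (b - a) *\<^sub>R A) \<le> \<epsilon> * (b - a)"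
    if ab: "0 \<le> a" "a \<le> b" "b < t1" "\<bar>a - s\<bar> < \<delta> / 2" "\<bar>b - s\<bar> < \<delta> / 2" for a b
  proof (rule tendsto_le[OF G(1)])
    let ?r = "\<lambda>N. real (idx N b) / real N - real (idx N a) / real N"
    have r: "(?r \<longlongrightarrow> b - a) G"
      using ab by (intro tendsto_diff tendsto_mono[OF G(2) idx_tendsto[of a]] tendsto_mono[OF G(2) idx_tendsto[of b]]) auto
    show "((\<lambda>N. \<epsilon> * ?r N) \<longlongrightarrow> \<epsilon> * (b - a)) G" by (rule tendsto_mult_left[OF r])
    show "((\<lambda>N. norm (Z N (idx N b) - Z N (idx N a) - ?r N *\<^sub>R A)) \<longlongrightarrow> norm (z b - z a - (b - a) *\<^sub>R A)) G"
      by (rule tendsto_norm[OF tendsto_diff[OF tendsto_diff[OF lim lim] tendsto_scaleR[OF r tendsto_const]]])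
         (use ab in auto)
    show "\<forall>\<^sub>F N in G. norm (Z N (idx N b) - Z N (idx N a) - ?r N *\<^sub>R A) \<le> \<epsilon> * ?r N"
      using ev filter_leD[OF G(2) eventually_real_gt[of "2 / \<delta>"]]
    proof eventually_elim
      case (elim N)
      have N: "real N > 0" using elim(2) \<delta> by (smt (verit) divide_pos_pos)
      have "\<bar>real j / real N - s\<bar> < \<delta>" "j < idx N t1" if "idx N a \<le> j" "j < idx N b" for j
      proof -
        have "1 < \<delta> / 2 * real N" using elim(2) \<delta> by (simp add: field_simps)
        moreover have "real (idx N a) \<le> real j" "real j < real (idx N b)" using that by auto
        moreover have "s - \<delta> / 2 < a" "b < s + \<delta> / 2" using ab by linarith+
        then have "a * real N > (s - \<delta> / 2) * real N" "b * real N < (s + \<delta> / 2) * real N"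
          using N by (simp_all add: mult_strict_right_mono)
        ultimately have "(s - \<delta>) * real N < real j" "real j < (s + \<delta>) * real N"
          using idx_bounds(2)[of a N] idx_bounds(1)[of b N] ab by (auto simp: algebra_simps)
        then have "s - \<delta> < real j / real N" "real j / real N < s + \<delta>" using N by (simp_all add: field_simps)
        then show "\<bar>real j / real N - s\<bar> < \<delta>" by linarith
        show "j < idx N t1" using that idx_mono[of b t1 N] ab by linarith
      qed
      then have st: "norm (real N *\<^sub>R (Z N (Suc j) - Z N j) - A) \<le> \<epsilon>" if "idx N a \<le> j" "j < idx N b" for j
        using elim(1) that by blast
      have le: "idx N a \<le> idx N b" using ab by (intro idx_mono) auto
      have "(\<Sum>j = idx N a..<idx N b. real N *\<^sub>R (Z N (Suc j) - Z N j) - A)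
          = real N *\<^sub>R (Z N (idx N b) - Z N (idx N a)) - (real (idx N b) - real (idx N a)) *\<^sub>R A"
        using le by (simp add: sum_subtractf sum_constant_scaleR flip: scaleR_sum_right) (simp add: sum_Suc_diff' flip: sum_subtractf)
      moreover have "norm (\<Sum>j = idx N a..<idx N b. real N *\<^sub>R (Z N (Suc j) - Z N j) - A) \<le> (\<Sum>j = idx N a..<idx N b. \<epsilon>)"
        by (rule sum_norm_le) (use st in auto)
      ultimately have "norm (real N *\<^sub>R (Z N (idx N b) - Z N (idx N a)) - (real (idx N b) - real (idx N a)) *\<^sub>R A)
          \<le> \<epsilon> * (real (idx N b) - real (idx N a))" using le by (simp add: mult.commute)
      moreover have "real N *\<^sub>R (Z N (idx N b) - Z N (idx N a) - ?r N *\<^sub>R A)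
          = real N *\<^sub>R (Z N (idx N b) - Z N (idx N a)) - (real (idx N b) - real (idx N a)) *\<^sub>R A"
        using N by (simp add: scaleR_diff_right right_diff_distrib)
      ultimately have "real N * norm (Z N (idx N b) - Z N (idx N a) - ?r N *\<^sub>R A) \<le> \<epsilon> * (real (idx N b) - real (idx N a))"
        by (metis abs_of_nat norm_scaleR)
      also have "\<dots> = real N * (\<epsilon> * ?r N)" using N by (simp add: right_diff_distrib)
      finally show ?case using N by simp
    qed
  qed
  show "\<exists>d>0. \<forall>y\<in>{0..<t1}. norm (y - s) < d \<longrightarrow> norm (z y - z s - (y - s) *\<^sub>R A) \<le> \<epsilon> * norm (y - s)"
  proof (intro exI[of _ "\<delta> / 2"] conjI ballI impI)
    show "0 < \<delta> / 2" using \<delta> by simp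
    fix y assume y: "y \<in> {0..<t1}" "norm (y - s) < \<delta> / 2"
    show "norm (z y - z s - (y - s) *\<^sub>R A) \<le> \<epsilon> * norm (y - s)"
    proof (cases "s \<le> y")
      case True
      then show ?thesis using key[of s y] y s \<delta> by simp
    next
      case False
      have "z y - z s - (y - s) *\<^sub>R A = - (z s - z y - (s - y) *\<^sub>R A)" by (simp add: algebra_simps)
      then have "norm (z y - z s - (y - s) *\<^sub>R A) = norm (z s - z y - (s - y) *\<^sub>R A)" by (metis norm_minus_cancel)
      then show ?thesis using key[of y s] y s \<delta> False by simp
    qed
  qed
qed

context spacelike_graph begin

text \<open>Horizontal part of the normal acceleration \<open>k * (grad, 1)\<close> that keeps a
  curve on the surface; by \<open>christoffel_graph\<close> this is the right-hand side of the
  geodesic equation.\<close>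

definition geodesic_acc :: "plane \<Rightarrow> plane \<Rightarrow> plane" where
  "geodesic_acc p v = ((hess p v \<bullet> v) / (1 - (norm (grad p))\<^sup>2)) *\<^sub>R grad p"

lemma norm_grad_sq: "(norm (grad p))\<^sup>2 < 1"
  using spacelike[of p] by (simp add: abs_square_less_1)

text \<open>The scaled second difference is exactly \<open>\<Phi>\<close> at the middle vertex, the
  two intermediate points of the Taylor formula and the two velocities. \<open>\<Phi>\<close> is
  continuous and reduces to \<open>geodesic_acc\<close> when the points and the velocities coincide;
  its five arguments account for \<open>\<gamma>' / 5\<close>.\<close>

lemma discrete_acc_near:
  assumes "\<epsilon> > 0"
  shows "\<exists>\<gamma>>0. \<forall>M Y j N. discrete_geodesic M Y \<longrightarrow> Suc j < M \<longrightarrow> N > 0 \<longrightarrow>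
    norm (Y j - c) < \<gamma> \<longrightarrow> norm (Y (Suc j) - c) < \<gamma> \<longrightarrow> norm (Y (Suc (Suc j)) - c) < \<gamma> \<longrightarrow>
    norm (real N *\<^sub>R (Y (Suc j) - Y j) - v) < \<gamma> \<longrightarrow> norm (real N *\<^sub>R (Y (Suc (Suc j)) - Y (Suc j)) - v) < \<gamma> \<longrightarrow>
    norm ((real N)\<^sup>2 *\<^sub>R (second_diff Y j) - geodesic_acc c v) < \<epsilon>"
proof -
  define \<Phi> where "\<Phi> x = (let (p, (q, w), (q', w')) = x in
     (((hess q w \<bullet> w) / 2 + (hess q' w' \<bullet> w') / 2) / (1 - (norm (grad p))\<^sup>2)) *\<^sub>R grad p)" for x
  have "continuous_on UNIV (\<lambda>x :: plane \<times> (plane \<times> plane) \<times> (plane \<times> plane).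
     (((hess (fst (fst (snd x))) (snd (fst (snd x))) \<bullet> snd (fst (snd x))) / 2 +
       (hess (fst (snd (snd x))) (snd (snd (snd x))) \<bullet> snd (snd (snd x))) / 2) / (1 - (norm (grad (fst x)))\<^sup>2)) *\<^sub>R grad (fst x))"
  proof -
    have h: "continuous_on UNIV (\<lambda>x. hess (a x) (b x))" if "continuous_on UNIV a" "continuous_on UNIV b"
      for a b :: "plane \<times> (plane \<times> plane) \<times> (plane \<times> plane) \<Rightarrow> plane"
      using continuous_on_compose2[OF cont_hess, of UNIV "\<lambda>x. (a x, b x)"] that
      by (simp add: continuous_on_Pair)
    have g: "continuous_on UNIV (\<lambda>x :: plane \<times> (plane \<times> plane) \<times> (plane \<times> plane). grad (fst x))"
      by (intro continuous_on_compose2[OF continuous_grad[of UNIV]] continuous_intros) auto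
    have "1 - (norm (grad p))\<^sup>2 \<noteq> 0" for p using norm_grad_sq[of p] by simp
    then show ?thesis by (intro continuous_intros h g) auto
  qed
  then have "continuous_on UNIV \<Phi>" by (simp add: \<Phi>_def case_prod_beta' Let_def)
  then have "isCont \<Phi> (c, (c, v), (c, v))"
    using continuous_on_eq_continuous_at[of UNIV \<Phi>] open_UNIV by blast
  then obtain \<gamma>' where \<gamma>': "\<gamma>' > 0" "\<And>x. dist x (c, (c, v), (c, v)) < \<gamma>' \<Longrightarrow> dist (\<Phi> x) (\<Phi> (c, (c, v), (c, v))) < \<epsilon>"
    using assms unfolding continuous_at_eps_delta by blast
  show ?thesis
  proof (intro exI[of _ "\<gamma>' / 5"] conjI allI impI)
    show "\<gamma>' / 5 > 0" using \<gamma>' by simp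
    fix M :: nat and Y :: "nat \<Rightarrow> plane" and j N :: nat
    define p q r where "p = Y (Suc j)" and "q = Y j" and "r = Y (Suc (Suc j))"
    define w w' where "w = real N *\<^sub>R (r - p)" and "w' = real N *\<^sub>R (p - q)"
    assume geo: "discrete_geodesic M Y" "Suc j < M" and N: "N > 0"
      and "norm (Y j - c) < \<gamma>' / 5" "norm (Y (Suc j) - c) < \<gamma>' / 5" "norm (Y (Suc (Suc j)) - c) < \<gamma>' / 5"
      and "norm (real N *\<^sub>R (Y (Suc j) - Y j) - v) < \<gamma>' / 5" "norm (real N *\<^sub>R (Y (Suc (Suc j)) - Y (Suc j)) - v) < \<gamma>' / 5"
    then have close: "norm (q - c) < \<gamma>' / 5" "norm (p - c) < \<gamma>' / 5" "norm (r - c) < \<gamma>' / 5"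
      "norm (w' - v) < \<gamma>' / 5" "norm (w - v) < \<gamma>' / 5"
      by (auto simp: p_def q_def r_def w_def w'_def)
    obtain s where s: "0 \<le> s" "s \<le> 1" "f r - f p - grad p \<bullet> (r - p) = (hess (p + s *\<^sub>R (r - p)) (r - p) \<bullet> (r - p)) / 2"
      using taylor by blast
    obtain s' where s': "0 \<le> s'" "s' \<le> 1" "f q - f p - grad p \<bullet> (q - p) = (hess (p + s' *\<^sub>R (q - p)) (q - p) \<bullet> (q - p)) / 2"
      using taylor by blast
    define \<xi> \<xi>' where "\<xi> = p + s *\<^sub>R (r - p)" and "\<xi>' = p + s' *\<^sub>R (q - p)"
    have "(1 - s) *\<^sub>R p + s *\<^sub>R r \<in> ball c (\<gamma>' / 5)"
      by (rule convexD_alt[OF convex_ball]) (use s close in \<open>auto simp: dist_norm norm_minus_commute\<close>)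
    then have \<xi>: "norm (\<xi> - c) < \<gamma>' / 5" by (simp add: \<xi>_def algebra_simps dist_norm norm_minus_commute)
    have "(1 - s') *\<^sub>R p + s' *\<^sub>R q \<in> ball c (\<gamma>' / 5)"
      by (rule convexD_alt[OF convex_ball]) (use s' close in \<open>auto simp: dist_norm norm_minus_commute\<close>)
    then have \<xi>': "norm (\<xi>' - c) < \<gamma>' / 5" by (simp add: \<xi>'_def algebra_simps dist_norm norm_minus_commute)
    have "norm ((p, (\<xi>, w), (\<xi>', w')) - (c, (c, v), (c, v))) \<le> norm (p - c) + ((norm (\<xi> - c) + norm (w - v)) + (norm (\<xi>' - c) + norm (w' - v)))"
      unfolding diff_Pair
      by (intro norm_Pair_le[THEN order_trans] add_mono order_refl)
    also have "\<dots> < \<gamma>'" using close \<xi> \<xi>' by linarith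
    finally have "dist (\<Phi> (p, (\<xi>, w), (\<xi>', w'))) (\<Phi> (c, (c, v), (c, v))) < \<epsilon>"
      by (intro \<gamma>'(2)) (simp add: dist_norm)
    moreover have "\<Phi> (c, (c, v), (c, v)) = geodesic_acc c v"
      by (simp add: \<Phi>_def geodesic_acc_def)
    moreover have "\<Phi> (p, (\<xi>, w), (\<xi>', w')) = (real N)\<^sup>2 *\<^sub>R (r - 2 *\<^sub>R p + q)"
    proof -
      define k where "k = f r - 2 * f p + f q"
      have hw: "hess \<xi> w \<bullet> w = (real N)\<^sup>2 * (hess \<xi> (r - p) \<bullet> (r - p))"
        by (simp add: w_def linear_simps[OF hess_linear] power2_eq_square)
      have "w' = - real N *\<^sub>R (q - p)" by (simp add: w'_def algebra_simps)
      then have hw': "hess \<xi>' w' \<bullet> w' = (real N)\<^sup>2 * (hess \<xi>' (q - p) \<bullet> (q - p))"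
        by (simp only:) (simp add: linear_simps[OF hess_linear] power2_eq_square)
      have "k * (1 - (norm (grad p))\<^sup>2) = (hess \<xi> (r - p) \<bullet> (r - p)) / 2 + (hess \<xi>' (q - p) \<bullet> (q - p)) / 2"
        using geodesic_second_difference(1)[OF geo] s(3) s'(3)
        by (simp add: k_def p_def[symmetric] q_def[symmetric] r_def[symmetric] \<xi>_def \<xi>'_def)
      then have "(real N)\<^sup>2 * (k * (1 - (norm (grad p))\<^sup>2)) = (hess \<xi> w \<bullet> w) / 2 + (hess \<xi>' w' \<bullet> w') / 2"
        unfolding hw hw' by (simp only: distrib_left times_divide_eq_right)
      then have "(hess \<xi> w \<bullet> w) / 2 + (hess \<xi>' w' \<bullet> w') / 2 = (real N)\<^sup>2 * k * (1 - (norm (grad p))\<^sup>2)"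
        by simp
      moreover have "1 - (norm (grad p))\<^sup>2 \<noteq> 0" using norm_grad_sq[of p] by simp
      ultimately have "\<Phi> (p, (\<xi>, w), (\<xi>', w')) = ((real N)\<^sup>2 * k) *\<^sub>R grad p"
        by (simp add: \<Phi>_def)
      also have "\<dots> = (real N)\<^sup>2 *\<^sub>R (k *\<^sub>R grad p)" by simp
      also have "k *\<^sub>R grad p = r - 2 *\<^sub>R p + q"
        using geodesic_second_difference(3)[OF geo] by (simp add: k_def p_def q_def r_def)
      finally show ?thesis .
    qed
    ultimately show "norm ((real N)\<^sup>2 *\<^sub>R (second_diff Y j) - geodesic_acc c v) < \<epsilon>"
      by (simp add: dist_norm p_def q_def r_def)
  qed
qed

end

context growing_graph begin

lemma limit_geodesic:
  "\<exists>T>0. \<exists>c v. (\<forall>t\<in>{0..<T}. (c has_vector_derivative v t) (at t within {0..<T}) \<and>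
      (v has_vector_derivative geodesic_acc (c t) (v t)) (at t within {0..<T})) \<and>
    ((\<lambda>t. u (c t)) \<longlongrightarrow> 0) (at_left T)"
proof (rule discrete_geodesics_bounded_speed)
  fix E D :: real and a :: plane and M :: "nat \<Rightarrow> nat" and Y :: "nat \<Rightarrow> nat \<Rightarrow> plane"
  assume E: "E > 0" and D: "D > 0" and ev0: "\<forall>\<^sub>F N in sequentially. discrete_geodesic (M N) (Y N) \<and> 0 < N \<and> M N \<le> N \<and>
      Y N 0 \<in> cball a 1 \<and> norm (Y N 1 - Y N 0) \<le> D / real N \<and> energy (M N) (Y N) \<le> E / real N"
    and uM0: "(\<lambda>N. u (Y N (M N))) \<longlonglongrightarrow> 0"
  define V where "V N j = real N *\<^sub>R (Y N (Suc j) - Y N j)" for N j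
  \<comment> \<open>Frozen at the last vertex, so that it makes sense for all times although the
    geodesics end at different indices.\<close>
  define U where "U t N = u (Y N (min (idx N t) (M N)))" for t N
  \<comment> \<open>Position, velocity and \<open>u\<close> at all times form one family, for which
    a single filter is taken. Limits may be infinite until the bounds below exclude it.\<close>
  define comp where "comp N x = (case x of (t, k) \<Rightarrow> if k = (0::nat) then fst (Y N (idx N t)) else if k = 1 then snd (Y N (idx N t))
     else if k = 2 then fst (V N (idx N t)) else if k = 3 then snd (V N (idx N t)) else U t N)" for N and x :: "real \<times> nat"
  obtain G where G: "G \<noteq> bot" "G \<le> sequentially" and lim: "\<And>x. \<exists>l::ereal. ((\<lambda>N. ereal (comp N x)) \<longlongrightarrow> l) G"
    by (rule cluster_filter[of comp]) blast
  note evG = filter_leD[OF G(2)]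
  note ev = evG[OF ev0]
  have uM: "((\<lambda>N. u (Y N (M N))) \<longlongrightarrow> 0) G" using uM0 G(2) by (rule tendsto_mono[rotated])
  define Z where "Z = {t. 0 \<le> t \<and> t \<le> 1 \<and> (U t \<longlongrightarrow> 0) G}"
  have "(U 1 \<longlongrightarrow> 0) G"
    by (rule Lim_transform_eventually[OF uM]) (use ev in eventually_elim, auto simp: U_def min_def)
  then have "1 \<in> Z" by (simp add: Z_def)
  define T where "T = Inf Z"
  have bdd: "bdd_below Z" by (rule bdd_belowI[of _ 0]) (simp add: Z_def)
  have T_le: "T \<le> t" if "t \<in> Z" for t unfolding T_def using bdd that by (rule cInf_lower[rotated])
  have T_ge: "x \<le> T" if "\<And>t. t \<in> Z \<Longrightarrow> x \<le> t" for x unfolding T_def using \<open>1 \<in> Z\<close> that by (intro cInf_greatest) auto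
  have T1: "T \<le> 1" by (rule T_le[OF \<open>1 \<in> Z\<close>])
  \<comment> \<open>The rate \<open>2 * D\<close> at which \<open>u\<close> can fall, inherited from
    the first step, is used twice: for \<open>T > 0\<close> and for the decay of \<open>u\<close> at
    \<open>T\<close>.\<close>
  have U_lower: "\<forall>\<^sub>F N in G. U s N \<le> U t N + 2 * D * (real (idx N t) / real N - real (idx N s) / real N)" if "s \<le> t" for s t
    using ev
  proof eventually_elim
    case (elim N)
    define i j where "i = min (idx N s) (M N)" and "j = min (idx N t) (M N)"
    have le: "idx N s \<le> idx N t" using that by (rule idx_mono)
    have ij: "i \<le> j" "j \<le> M N" "j - i \<le> idx N t - idx N s" using le by (auto simp: i_def j_def)
    have "u (Y N i) - 2 * (D / real N) * real (j - i) \<le> u (Y N j)"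
      using geodesic_u_lower[of "M N" "Y N" "D / real N" i j] elim ij by simp
    moreover have "2 * (D / real N) * real (j - i) \<le> 2 * (D / real N) * real (idx N t - idx N s)"
      using ij D by (intro mult_left_mono) auto
    moreover have "2 * (D / real N) * real (idx N t - idx N s) = 2 * D * (real (idx N t) / real N - real (idx N s) / real N)"
      using le by (simp add: of_nat_diff diff_divide_distrib[symmetric])
    ultimately show ?case by (simp add: U_def i_def j_def)
  qed
  have rate: "((\<lambda>N. U t N + 2 * D * (real (idx N t) / real N - real (idx N s) / real N)) \<longlongrightarrow> 0 + 2 * D * (t - s)) G"
    if "t \<in> Z" "0 \<le> s" for s t
    using that by (intro tendsto_add tendsto_mult_left tendsto_diff tendsto_mono[OF G(2) idx_tendsto]) (auto simp: Z_def)
  obtain \<mu> where \<mu>: "\<mu> > 0" "\<And>p. p \<in> cball a 1 \<Longrightarrow> \<mu> \<le> u p"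
  proof -
    obtain x where "x \<in> cball a 1" "\<And>p. p \<in> cball a 1 \<Longrightarrow> u x \<le> u p"
      using continuous_attains_inf[OF compact_cball _ continuous_u, of a 1] by auto
    then show thesis using that[of "u x"] u_pos by blast
  qed
  have T_pos: "T > 0"
  proof -
    have "\<mu> / (2 * D) \<le> T"
    proof (rule T_ge)
      fix t assume t: "t \<in> Z"
      then have t0: "0 \<le> t" by (simp add: Z_def)
      have "\<forall>\<^sub>F N in G. \<mu> \<le> U t N + 2 * D * (real (idx N t) / real N - real (idx N 0) / real N)"
        using U_lower[OF t0] ev
      proof eventually_elim
        case (elim N)
        have "\<mu> \<le> U 0 N" using \<mu>(2)[of "Y N 0"] elim(2) by (simp add: U_def)
        then show ?case using elim(1) by linarith
      qed
      from tendsto_lowerbound[OF rate[OF t order_refl] this G(1)]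
      have "\<mu> \<le> 0 + 2 * D * (t - 0)" .
      then show "\<mu> / (2 * D) \<le> t" using D by (simp add: field_simps)
    qed
    then show ?thesis using \<mu> D by (smt (verit) divide_pos_pos)
  qed
  \<comment> \<open>Before \<open>T\<close> the limit of \<open>U t\<close> is positive or infinite,
    while the values at the last vertices tend to 0. A number between them shows that the time
    \<open>t\<close> comes before the last vertex.\<close>
  have above: "\<exists>\<delta>>0. \<forall>\<^sub>F N in G. idx N t \<le> M N \<and> \<delta> \<le> u (Y N (idx N t)) \<and> u (Y N (M N)) < \<delta>"
    if t: "0 \<le> t" "t < T" for t
  proof -
    obtain l :: ereal where l: "((\<lambda>N. ereal (U t N)) \<longlongrightarrow> l) G"
      using lim[of "(t, 4)"] by (auto simp: comp_def)
    have "0 \<le> l"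
      by (rule tendsto_lowerbound[OF l _ G(1)]) (simp add: U_def u_pos less_imp_le)
    moreover have "l \<noteq> 0"
    proof
      assume "l = 0"
      then have "(U t \<longlongrightarrow> 0) G" using l by (simp add: zero_ereal_def)
      then have "t \<in> Z" using t T1 by (simp add: Z_def)
      then show False using T_le[of t] t by simp
    qed
    ultimately have "0 < l" by (simp add: less_le)
    then obtain \<delta> where \<delta>: "0 < ereal \<delta>" "ereal \<delta> < l" using ereal_dense2[of 0 l] by auto
    then have "\<delta> > 0" by simp
    have "\<forall>\<^sub>F N in G. u (Y N (M N)) < \<delta>" using order_tendstoD(2)[OF uM \<open>\<delta> > 0\<close>] .
    moreover have "\<forall>\<^sub>F N in G. ereal \<delta> < ereal (U t N)" using order_tendstoD(1)[OF l \<delta>(2)] .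
    ultimately have "\<forall>\<^sub>F N in G. idx N t \<le> M N \<and> \<delta> \<le> u (Y N (idx N t)) \<and> u (Y N (M N)) < \<delta>"
      by eventually_elim (auto simp: U_def min_def split: if_splits)
    then show ?thesis using \<open>\<delta> > 0\<close> by blast
  qed
  define good where "good t R C N \<longleftrightarrow> N > 0 \<and> discrete_geodesic (M N) (Y N) \<and> idx N t \<le> M N \<and> (\<forall>j\<le>idx N t. norm (Y N j) \<le> R) \<and>
     (\<forall>j<idx N t. norm (Y N (Suc j) - Y N j) \<le> C / real N) \<and>
     (\<forall>j. Suc j < idx N t \<longrightarrow> norm (second_diff (Y N) j) \<le> C / (real N)\<^sup>2)" for t R C N
  have bounds: "\<exists>R C. C \<ge> 0 \<and> (\<forall>\<^sub>F N in G. good t R C N)"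
    if t: "0 \<le> t" "t < T" for t
  proof -
    obtain \<delta> where \<delta>: "\<delta> > 0" "\<forall>\<^sub>F N in G. idx N t \<le> M N \<and> \<delta> \<le> u (Y N (idx N t)) \<and> u (Y N (M N)) < \<delta>"
      using above[OF t] by blast
    show ?thesis
    proof (rule discrete_geodesic_bounds[OF \<delta>(1) less_imp_le[OF D] less_imp_le[OF E], of a])
      fix R C :: real
      assume C: "C \<ge> 0" and b: "\<And>N M Y J. N > 0 \<Longrightarrow> discrete_geodesic M Y \<Longrightarrow> M \<le> N \<Longrightarrow> Y 0 \<in> cball a 1 \<Longrightarrow>
         norm (Y 1 - Y 0) \<le> D / real N \<Longrightarrow> energy M Y \<le> E / real N \<Longrightarrow> J \<le> M \<Longrightarrow> u (Y M) < \<delta> \<Longrightarrow> \<delta> \<le> u (Y J) \<Longrightarrow>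
         (\<forall>j\<le>J. norm (Y j) \<le> R) \<and> (\<forall>j<J. norm (Y (Suc j) - Y j) \<le> C / real N) \<and>
         (\<forall>j. Suc j < J \<longrightarrow> norm (second_diff Y j) \<le> C / (real N)\<^sup>2)"
      have "\<forall>\<^sub>F N in G. good t R C N"
        using ev \<delta>(2)
      proof eventually_elim
        case (elim N)
        then show ?case using b[of N "M N" "Y N" "idx N t"] unfolding good_def by blast
      qed
      then show ?thesis using C by blast
    qed
  qed
  have limits: "\<exists>c v. ((\<lambda>N. Y N (idx N t)) \<longlongrightarrow> c) G \<and> ((\<lambda>N. V N (idx N t)) \<longlongrightarrow> v) G" if t: "0 \<le> t" "t < T" for t
  proof -
    define t' where "t' = (t + T) / 2"
    have t': "t < t'" "t' < T" using t by (auto simp: t'_def)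
    obtain R C where b: "C \<ge> 0" "\<forall>\<^sub>F N in G. good t' R C N"
      using bounds[of t'] t t' by auto
    note b = b[unfolded good_def]
    have bd: "\<forall>\<^sub>F N in G. norm (Y N (idx N t)) \<le> R \<and> norm (V N (idx N t)) \<le> C"
      using b(2) evG[OF eventually_idx_less[OF t(1) t'(1), of 0]]
      by eventually_elim (auto simp: V_def pos_le_divide_eq mult.commute)
    have "\<exists>r. ((\<lambda>N. comp N (t, k)) \<longlongrightarrow> r) G" if "k \<in> {0, 1, 2, 3}" for k
    proof -
      obtain l where "((\<lambda>N. ereal (comp N (t, k))) \<longlongrightarrow> l) G" using lim by blast
      then show ?thesis
      proof (rule bounded_ereal_limit[OF _ G(1)])
        show "\<forall>\<^sub>F N in G. \<bar>comp N (t, k)\<bar> \<le> max R C"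
          using bd
        proof eventually_elim
          case (elim N)
          have fs: "\<bar>fst x\<bar> \<le> norm x" "\<bar>snd x\<bar> \<le> norm x" for x :: plane
            using norm_fst_le[of "fst x" "snd x"] norm_snd_le[of "snd x" "fst x"] by simp_all
          show ?case
            using fs[of "Y N (idx N t)"] fs[of "V N (idx N t)"] elim that by (auto simp: comp_def)
        qed
      qed
    qed
    from this[of 0] this[of 1] this[of 2] this[of 3] obtain c0 c1 v0 v1 where
      "((\<lambda>N. fst (Y N (idx N t))) \<longlongrightarrow> c0) G" "((\<lambda>N. snd (Y N (idx N t))) \<longlongrightarrow> c1) G"
      "((\<lambda>N. fst (V N (idx N t))) \<longlongrightarrow> v0) G" "((\<lambda>N. snd (V N (idx N t))) \<longlongrightarrow> v1) G"
      by (auto simp: comp_def)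
    from tendsto_Pair[OF this(1,2)] tendsto_Pair[OF this(3,4)] show ?thesis by auto
  qed
  then obtain c v where cv: "\<And>t. 0 \<le> t \<Longrightarrow> t < T \<Longrightarrow> ((\<lambda>N. Y N (idx N t)) \<longlongrightarrow> c t) G"
    "\<And>t. 0 \<le> t \<Longrightarrow> t < T \<Longrightarrow> ((\<lambda>N. V N (idx N t)) \<longlongrightarrow> v t) G"
    by metis
  have ode: "(c has_vector_derivative v s) (at s within {0..<T}) \<and>
      (v has_vector_derivative geodesic_acc (c s) (v s)) (at s within {0..<T})" if s: "0 \<le> s" "s < T" for s
  proof -
    \<comment> \<open>The two later times leave room for the vertices \<open>j + 1\<close> and
      \<open>j + 2\<close> in second differences.\<close>
    define t0 where "t0 = (s + T) / 2"
    define t1 where "t1 = (s + t0) / 2"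
    have t01: "s < t1" "t1 < t0" "t0 < T" "0 \<le> t0" "0 \<le> t1" using s by (auto simp: t0_def t1_def field_simps)
    obtain R C where C: "C \<ge> 0" and b: "\<forall>\<^sub>F N in G. good t0 R C N"
      using bounds[OF t01(4,3)] by blast
    note b = b[unfolded good_def]
    note less = evG[OF eventually_idx_less[OF t01(5,2), of 2]]
    have Y_near: "\<exists>\<delta>>0. \<forall>\<^sub>F N in G. \<forall>j \<le> idx N t0. \<bar>real j / real N - s\<bar> < \<delta> \<longrightarrow> norm (Y N j - c s) < \<gamma>" if "\<gamma> > 0" for \<gamma>
    proof (rule near_limit[where Z = Y, OF G(2) s(1) _ C cv(1)[OF s] _ that])
      show "s < t0" using t01 by simp
      show "\<forall>\<^sub>F N in G. \<forall>j<idx N t0. norm (Y N (Suc j) - Y N j) \<le> C / real N"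
        using b by eventually_elim blast
    qed
    have V_step: "V N (Suc j) - V N j = real N *\<^sub>R (second_diff (Y N) j)" for N j
      by (simp add: V_def algebra_simps scaleR_2)
    have V_lip: "\<forall>\<^sub>F N in G. \<forall>j < idx N t1. norm (V N (Suc j) - V N j) \<le> C / real N"
      using b less
    proof eventually_elim
      case (elim N)
      show ?case
      proof (intro allI impI)
        fix j assume "j < idx N t1"
        then have "norm (second_diff (Y N) j) \<le> C / (real N)\<^sup>2" using elim by auto
        then have "real N * norm (second_diff (Y N) j) \<le> real N * (C / (real N)\<^sup>2)"
          by (rule mult_left_mono) simp
        also have "\<dots> = C / real N" using elim(1) by (simp add: power2_eq_square)
        finally show "norm (V N (Suc j) - V N j) \<le> C / real N" unfolding V_step by simp
      qed
    qed
    have V_near: "\<exists>\<delta>>0. \<forall>\<^sub>F N in G. \<forall>j \<le> idx N t1. \<bar>real j / real N - s\<bar> < \<delta> \<longrightarrow> norm (V N j - v s) < \<gamma>" if "\<gamma> > 0" for \<gamma>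
      by (rule near_limit[where Z = V, OF G(2) s(1) t01(1) C cv(2)[OF s] V_lip that])
    have "(c has_vector_derivative v s) (at s within {0..<t1})"
    proof (rule limit_has_vector_derivative[OF G s(1) t01(1), where Z = Y])
      show "((\<lambda>N. Y N (idx N t)) \<longlongrightarrow> c t) G" if "0 \<le> t" "t < t1" for t using cv(1) that t01 by simp
      fix \<epsilon> :: real assume "\<epsilon> > 0"
      then obtain \<delta> where "\<delta> > 0" "\<forall>\<^sub>F N in G. \<forall>j \<le> idx N t1. \<bar>real j / real N - s\<bar> < \<delta> \<longrightarrow> norm (V N j - v s) < \<epsilon>"
        using V_near by blast
      then show "\<exists>\<delta>>0. \<forall>\<^sub>F N in G. \<forall>j<idx N t1. \<bar>real j / real N - s\<bar> < \<delta> \<longrightarrow> norm (real N *\<^sub>R (Y N (Suc j) - Y N j) - v s) \<le> \<epsilon>"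
        by (intro exI[of _ \<delta>]) (auto simp: V_def less_imp_le elim!: eventually_mono)
    qed
    moreover have "(v has_vector_derivative geodesic_acc (c s) (v s)) (at s within {0..<t1})"
    proof (rule limit_has_vector_derivative[OF G s(1) t01(1), where Z = V])
      show "((\<lambda>N. V N (idx N t)) \<longlongrightarrow> v t) G" if "0 \<le> t" "t < t1" for t using cv(2) that t01 by simp
      fix \<epsilon> :: real assume "\<epsilon> > 0"
      then obtain \<gamma> where \<gamma>: "\<gamma> > 0" and acc: "\<And>M Y j N. discrete_geodesic M Y \<Longrightarrow> Suc j < M \<Longrightarrow> N > 0 \<Longrightarrow>
        norm (Y j - c s) < \<gamma> \<Longrightarrow> norm (Y (Suc j) - c s) < \<gamma> \<Longrightarrow> norm (Y (Suc (Suc j)) - c s) < \<gamma> \<Longrightarrow>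
        norm (real N *\<^sub>R (Y (Suc j) - Y j) - v s) < \<gamma> \<Longrightarrow> norm (real N *\<^sub>R (Y (Suc (Suc j)) - Y (Suc j)) - v s) < \<gamma> \<Longrightarrow>
        norm ((real N)\<^sup>2 *\<^sub>R (second_diff Y j) - geodesic_acc (c s) (v s)) < \<epsilon>"
        using discrete_acc_near[of \<epsilon> "c s" "v s"] by blast
      obtain \<delta>1 where \<delta>1: "\<delta>1 > 0" and Yn: "\<forall>\<^sub>F N in G. \<forall>j \<le> idx N t0. \<bar>real j / real N - s\<bar> < \<delta>1 \<longrightarrow> norm (Y N j - c s) < \<gamma>"
        using Y_near[OF \<gamma>] by blast
      obtain \<delta>2 where \<delta>2: "\<delta>2 > 0" and Vn: "\<forall>\<^sub>F N in G. \<forall>j \<le> idx N t1. \<bar>real j / real N - s\<bar> < \<delta>2 \<longrightarrow> norm (V N j - v s) < \<gamma>"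
        using V_near[OF \<gamma>] by blast
      define \<delta> where "\<delta> = min \<delta>1 \<delta>2 / 2"
      have \<delta>: "\<delta> > 0" "2 * \<delta> \<le> \<delta>1" "2 * \<delta> \<le> \<delta>2" using \<delta>1 \<delta>2 by (auto simp: \<delta>_def)
      have "\<forall>\<^sub>F N in G. \<forall>j<idx N t1. \<bar>real j / real N - s\<bar> < \<delta> \<longrightarrow> norm (real N *\<^sub>R (V N (Suc j) - V N j) - geodesic_acc (c s) (v s)) \<le> \<epsilon>"
        using b less Yn Vn evG[OF eventually_real_gt[of "2 / \<delta>"]]
      proof eventually_elim
        case (elim N)
        show ?case
        proof (intro allI impI)
          fix j assume j: "j < idx N t1" "\<bar>real j / real N - s\<bar> < \<delta>"
          have N: "N > 0" using elim(1) by blast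
          have "2 / real N < \<delta>" using elim(5) \<delta>(1) N by (simp add: field_simps)
          then have near: "\<bar>real (j + i) / real N - s\<bar> < 2 * \<delta>" if "i \<le> 2" for i
          proof -
            have "real i / real N \<le> 2 / real N" "0 \<le> real i / real N" using that by (auto intro: divide_right_mono)
            moreover have "real (j + i) / real N = real j / real N + real i / real N"
              by (simp add: add_divide_distrib)
            ultimately show ?thesis using j(2) \<open>2 / real N < \<delta>\<close> by linarith
          qed
          have Y3: "norm (Y N (j + i) - c s) < \<gamma>" if "i \<le> 2" for i
            using elim(3) near[OF that] \<delta>(2) j(1) elim(2) that by auto
          have V2: "norm (V N (j + i) - v s) < \<gamma>" if "i \<le> 1" for i
            using elim(4) near[of i] \<delta>(3) j(1) that by auto
          have "norm ((real N)\<^sup>2 *\<^sub>R (second_diff (Y N) j) - geodesic_acc (c s) (v s)) < \<epsilon>"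
            using Y3[of 0] Y3[of 1] Y3[of 2] V2[of 0] V2[of 1] elim(1,2) j(1)
            by (intro acc[of "M N"]) (auto simp: V_def)
          then show "norm (real N *\<^sub>R (V N (Suc j) - V N j) - geodesic_acc (c s) (v s)) \<le> \<epsilon>"
            unfolding V_step by (simp add: power2_eq_square)
        qed
      qed
      then show "\<exists>\<delta>>0. \<forall>\<^sub>F N in G. \<forall>j<idx N t1. \<bar>real j / real N - s\<bar> < \<delta> \<longrightarrow> norm (real N *\<^sub>R (V N (Suc j) - V N j) - geodesic_acc (c s) (v s)) \<le> \<epsilon>"
        using \<delta>(1) by blast
    qed
    moreover have "at s within {0..<T} = at s within {0..<t1}"
      by (rule at_within_nhd[of s "{..<t1}"]) (use t01 in auto)
    ultimately show ?thesis by simp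
  qed
  have u_le: "u (c s) \<le> 2 * D * (T - s)" if s: "0 \<le> s" "s < T" for s
  proof -
    have cu: "isCont u (c s)" using continuous_on_eq_continuous_at[of UNIV u] continuous_u open_UNIV by blast
    have lim_u: "(U s \<longlongrightarrow> u (c s)) G"
    proof (rule Lim_transform_eventually[OF isCont_tendsto_compose[OF cu cv(1)[OF s]]])
      obtain \<delta> where "\<forall>\<^sub>F N in G. idx N s \<le> M N \<and> \<delta> \<le> u (Y N (idx N s)) \<and> u (Y N (M N)) < \<delta>" using above[OF s] by blast
      then show "\<forall>\<^sub>F N in G. u (Y N (idx N s)) = U s N" by eventually_elim (simp add: U_def min_def)
    qed
    \<comment> \<open>\<open>T\<close> is only an infimum and need not lie in \<open>Z\<close>, so
      the estimate is first made at the times in \<open>Z\<close>.\<close>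
    have "s + u (c s) / (2 * D) \<le> T"
    proof (rule T_ge)
      fix t assume t: "t \<in> Z"
      then have "s \<le> t" using T_le[OF t] s by simp
      have "u (c s) \<le> 0 + 2 * D * (t - s)"
        by (rule tendsto_le[OF G(1) rate[OF t s(1)] lim_u U_lower[OF \<open>s \<le> t\<close>]])
      then show "s + u (c s) / (2 * D) \<le> t" using D by (simp add: field_simps)
    qed
    then show ?thesis using D by (simp add: field_simps)
  qed
  have "((\<lambda>t. u (c t)) \<longlongrightarrow> 0) (at_left T)"
  proof (rule tendsto_sandwich)
    have "\<forall>\<^sub>F t in at_left T. 0 < t \<and> t < T" using T_pos unfolding eventually_at_left_field by blast
    then show "\<forall>\<^sub>F t in at_left T. u (c t) \<le> 2 * D * (T - t)" by eventually_elim (use u_le in auto)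
    show "\<forall>\<^sub>F t in at_left T. 0 \<le> u (c t)" by (simp add: u_pos less_imp_le)
    have "((\<lambda>t. 2 * D * (T - t)) \<longlongrightarrow> 2 * D * (T - T)) (at_left T)" by (intro tendsto_intros)
    then show "((\<lambda>t. 2 * D * (T - t)) \<longlongrightarrow> 0) (at_left T)" by simp
  qed simp
  then show ?thesis using T_pos ode by (intro exI[of _ T] conjI exI[of _ c] exI[of _ v]) auto
qed

end

section \<open>Curvature of a graph\<close>

text \<open>After subtracting the exact form \<open>Q(p) dP\<close> and the linear part of \<open>Q - Q(p)\<close>, the integrand on the
  boundary of the square is \<open>o(r)\<close>.\<close>

lemma circulation_limit:
  fixes Q P :: "plane \<Rightarrow> real"
  assumes dP: "\<And>q. (P has_derivative DP q) (at q)"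
    and cont_DP: "\<And>d. continuous_on UNIV (\<lambda>q. DP q d)"
    and cont_Q: "continuous_on UNIV Q" and dQ: "(Q has_derivative DQ) (at p)"
  shows "((\<lambda>r. circulation (\<lambda>q d. Q q * DP q d) p r / (2 * r)\<^sup>2) \<longlongrightarrow>
    DQ (1, 0) * DP p (0, 1) - DQ (0, 1) * DP p (1, 0)) (at_right 0)"
proof (rule tendstoI)
  fix \<epsilon> :: real assume \<epsilon>: "\<epsilon> > 0"
  obtain x y where p: "p = (x, y)" by fastforce
  define L where "L = DQ (1, 0) * DP p (0, 1) - DQ (0, 1) * DP p (1, 0)"
  have blQ: "bounded_linear DQ" using dQ has_derivative_bounded_linear by blast
  obtain K where K: "K > 0" "\<And>v. norm (DQ v) \<le> norm v * K" using bounded_linear.pos_bounded[OF blQ] by blast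
  \<comment> \<open>A bound for the coefficients of \<open>dP\<close> near \<open>p\<close>; the 1
    allows for their variation.\<close>
  define B where "B = \<bar>DP p (1, 0)\<bar> + \<bar>DP p (0, 1)\<bar> + 1"
  define \<epsilon>' where "\<epsilon>' = min 1 (\<epsilon> / (8 * (B + K)))"
  have B: "B \<ge> 1" by (simp add: B_def)
  have BK: "8 * (B + K) > 0" using B K(1) by simp
  then have \<epsilon>': "\<epsilon>' > 0" "\<epsilon>' \<le> 1" "\<epsilon>' \<le> \<epsilon> / (8 * (B + K))"
    using \<epsilon> B K(1) by (auto simp: \<epsilon>'_def)
  then have \<epsilon>'B: "\<epsilon>' * (8 * (B + K)) \<le> \<epsilon>" using BK by (simp only: pos_le_divide_eq)
  obtain d1 where d1: "d1 > 0" "\<And>q. norm (q - p) < d1 \<Longrightarrow> norm (Q q - Q p - DQ (q - p)) \<le> \<epsilon>' * norm (q - p)"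
    using dQ \<epsilon>'(1) unfolding has_derivative_at_alt by blast
  have "\<exists>d>0. \<forall>q. dist q p < d \<longrightarrow> dist (DP q v) (DP p v) < \<epsilon>'" for v
    using cont_DP[of v] \<epsilon>'(1) unfolding continuous_on_iff by blast
  then obtain d2 d3 where d2: "d2 > 0" "\<And>q. norm (q - p) < d2 \<Longrightarrow> \<bar>DP q (1, 0) - DP p (1, 0)\<bar> < \<epsilon>'"
    and d3: "d3 > 0" "\<And>q. norm (q - p) < d3 \<Longrightarrow> \<bar>DP q (0, 1) - DP p (0, 1)\<bar> < \<epsilon>'"
    by (metis dist_norm real_norm_def)
  define err where "err q d = Q q * DP q d - Q p * DP q d - DQ (q - p) * DP p d" for q d
  have err: "\<bar>err q d\<bar> \<le> \<epsilon>' * (B + K) * norm (q - p)"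
    if "norm (q - p) < min d1 (min d2 d3)" "d = (1, 0) \<or> d = (0, 1)" for q d
  proof -
    have dd: "\<bar>DP q d - DP p d\<bar> \<le> \<epsilon>'" using d2(2)[of q] d3(2)[of q] that by auto
    then have "\<bar>DP q d\<bar> \<le> B" using \<epsilon>'(2) that(2) unfolding B_def by auto
    then have "\<bar>(Q q - Q p - DQ (q - p)) * DP q d\<bar> \<le> (\<epsilon>' * norm (q - p)) * B"
      unfolding abs_mult using d1(2)[of q] that \<epsilon>' by (intro mult_mono) auto
    moreover have "\<bar>DQ (q - p) * (DP q d - DP p d)\<bar> \<le> (norm (q - p) * K) * \<epsilon>'"
      unfolding abs_mult using K(2)[of "q - p"] dd K(1) by (intro mult_mono) auto
    moreover have "err q d = (Q q - Q p - DQ (q - p)) * DP q d + DQ (q - p) * (DP q d - DP p d)"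
      by (simp add: err_def algebra_simps)
    moreover have "\<epsilon>' * (B + K) * norm (q - p) = (\<epsilon>' * norm (q - p)) * B + (norm (q - p) * K) * \<epsilon>'"
      by (simp add: algebra_simps)
    ultimately show ?thesis by linarith
  qed
  define m where "m = min d1 (min d2 d3) / 2"
  have m: "m > 0" using d1 d2 d3 by (simp add: m_def)
  have main: "dist (circulation (\<lambda>q d. Q q * DP q d) p r / (2 * r)\<^sup>2) L < \<epsilon>" if r: "0 < r" "r < m" for r
  proof -
    define b1 b2 b3 b4 where "b1 s = (x + s, y - r)" and "b2 s = (x + r, y + s)" and "b3 s = (x + s, y + r)" and "b4 s = (x - r, y + s)" for s
    note bs = b1_def b2_def b3_def b4_def
    have cont: "continuous_on S (\<lambda>s. DP (b s) d)" "continuous_on S (\<lambda>s. Q (b s) * DP (b s) d)"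
      if "continuous_on UNIV b" for b :: "real \<Rightarrow> plane" and d S
    proof -
      have b: "continuous_on S b" using that continuous_on_subset by blast
      show "continuous_on S (\<lambda>s. DP (b s) d)"
        by (rule continuous_on_compose2[OF cont_DP b]) simp
      then show "continuous_on S (\<lambda>s. Q (b s) * DP (b s) d)"
        by (intro continuous_on_mult continuous_on_compose2[OF cont_Q b]) simp_all
    qed
    have cb: "continuous_on UNIV b1" "continuous_on UNIV b2" "continuous_on UNIV b3" "continuous_on UNIV b4"
      unfolding bs by (intro continuous_intros)+
    note conts = cont[OF cb(1)] cont[OF cb(2)] cont[OF cb(3)] cont[OF cb(4)]
    define W V where "W s = Q (b1 s) * DP (b1 s) (1, 0) + Q (b2 s) * DP (b2 s) (0, 1) - Q (b3 s) * DP (b3 s) (1, 0) - Q (b4 s) * DP (b4 s) (0, 1)"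
      and "V s = DP (b1 s) (1, 0) + DP (b2 s) (0, 1) - DP (b3 s) (1, 0) - DP (b4 s) (0, 1)" for s
    have circ: "circulation (\<lambda>q d. Q q * DP q d) p r = integral {-r..r} W"
      unfolding circulation_def p W_def bs[symmetric] prod.case
      by (simp add: integral_add integral_diff integrable_add integrable_diff integrable_continuous_interval conts)
    have ftc: "((\<lambda>s. DP (b s) d) has_integral P (b r) - P (b (- r))) {-r..r}"
      if "\<And>s. (b has_vector_derivative d) (at s within {-r..r})" for b d
    proof (rule fundamental_theorem_of_calculus)
      fix s assume "s \<in> {-r..r}"
      have "(P \<circ> b has_vector_derivative DP (b s) d) (at s within {-r..r})"
        by (rule vector_derivative_diff_chain_within[OF that]) (use dP has_derivative_at_withinI in blast)
      then show "((\<lambda>a. P (b a)) has_vector_derivative DP (b s) d) (at s within {-r..r})" by (simp add: o_def)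
    qed (use r in simp)
    have "(V has_integral (P (b1 r) - P (b1 (- r))) + (P (b2 r) - P (b2 (- r))) - (P (b3 r) - P (b3 (- r))) - (P (b4 r) - P (b4 (- r)))) {-r..r}"
      unfolding V_def
      by (intro has_integral_add has_integral_diff ftc)
         (auto simp: bs has_vector_derivative_def intro!: derivative_eq_intros)
    then have V0: "(V has_integral 0) {-r..r}" by (simp add: bs)
    have Wint: "(W has_integral integral {-r..r} W) {-r..r}"
      unfolding W_def by (intro integrable_integral integrable_continuous_interval continuous_intros conts)
    have "((\<lambda>s. W s - Q p * V s - 2 * r * L) has_integral integral {-r..r} W - Q p * 0 - 2 * r * L * (2 * r)) {-r..r}"
      using has_integral_const_real[of "2 * r * L" "-r" r] r
      by (intro has_integral_diff Wint has_integral_mult_right V0) (simp add: mult.commute)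
    moreover have "norm (W s - Q p * V s - 2 * r * L) \<le> 8 * \<epsilon>' * (B + K) * r" if s: "s \<in> {-r..r}" for s
    proof -
      have DQ_lin: "DQ (a, b) = a * DQ (1, 0) + b * DQ (0, 1)" for a b
      proof -
        have "DQ (a *\<^sub>R (1, 0) + b *\<^sub>R (0, 1)) = a * DQ (1, 0) + b * DQ (0, 1)"
          by (simp only: linear_simps[OF blQ] real_scaleR_def)
        then show ?thesis by simp
      qed
      \<comment> \<open>The linear part of \<open>Q\<close> adds up to the constant
        \<open>2 * r * L\<close> for each \<open>s\<close> separately, since opposite sides of the
        square differ by a translation of length \<open>2 * r\<close>.\<close>
      have "W s - Q p * V s - 2 * r * L = err (b1 s) (1, 0) + err (b2 s) (0, 1) - err (b3 s) (1, 0) - err (b4 s) (0, 1)"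
        unfolding W_def V_def err_def L_def p bs diff_Pair
        by (simp add: DQ_lin[of s] DQ_lin[of r] DQ_lin[of "- r"] algebra_simps)
      moreover have e: "\<bar>err q d\<bar> \<le> \<epsilon>' * (B + K) * (2 * r)"
        if q: "q = (x + a, y + b)" "\<bar>a\<bar> \<le> r" "\<bar>b\<bar> \<le> r" "d = (1, 0) \<or> d = (0, 1)" for q d a b
      proof -
        have "norm (q - p) \<le> \<bar>a\<bar> + \<bar>b\<bar>" using norm_Pair_le[of a b] by (simp add: q p)
        then have n: "norm (q - p) \<le> 2 * r" using q by simp
        then have "\<bar>err q d\<bar> \<le> \<epsilon>' * (B + K) * norm (q - p)" using r by (intro err q(4)) (simp add: m_def)
        also have "\<dots> \<le> \<epsilon>' * (B + K) * (2 * r)" using n \<epsilon>' B K by (intro mult_left_mono) auto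
        finally show ?thesis .
      qed
      moreover have "\<bar>err (b1 s) (1, 0)\<bar> \<le> \<epsilon>' * (B + K) * (2 * r)" using s r by (intro e[of _ s "- r"]) (auto simp: bs)
      moreover have "\<bar>err (b2 s) (0, 1)\<bar> \<le> \<epsilon>' * (B + K) * (2 * r)" using s r by (intro e[of _ r s]) (auto simp: bs)
      moreover have "\<bar>err (b3 s) (1, 0)\<bar> \<le> \<epsilon>' * (B + K) * (2 * r)" using s r by (intro e[of _ s r]) (auto simp: bs)
      moreover have "\<bar>err (b4 s) (0, 1)\<bar> \<le> \<epsilon>' * (B + K) * (2 * r)" using s r by (intro e[of _ "- r" s]) (auto simp: bs)
      moreover have "8 * \<epsilon>' * (B + K) * r = 4 * (\<epsilon>' * (B + K) * (2 * r))" by simp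
      ultimately show ?thesis unfolding real_norm_def by linarith
    qed
    ultimately have "norm (integral {-r..r} W - Q p * 0 - 2 * r * L * (2 * r)) \<le> 8 * \<epsilon>' * (B + K) * r * measure lborel {-r..r}"
      using \<epsilon>' B K r by (intro has_integral_bound_real[where f = "\<lambda>s. W s - Q p * V s - 2 * r * L"]) auto
    also have "\<dots> = \<epsilon>' * (8 * (B + K)) * (2 * r\<^sup>2)" using r by (simp add: power2_eq_square)
    also have "\<dots> \<le> \<epsilon> * (2 * r\<^sup>2)" using \<epsilon>'B by (intro mult_right_mono) auto
    also have "\<dots> < \<epsilon> * (2 * r)\<^sup>2" using \<epsilon> r by (simp add: power2_eq_square)
    finally have "\<bar>circulation (\<lambda>q d. Q q * DP q d) p r - L * (2 * r)\<^sup>2\<bar> < \<epsilon> * (2 * r)\<^sup>2"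
      unfolding circ by (simp add: power2_eq_square algebra_simps)
    moreover have "circulation (\<lambda>q d. Q q * DP q d) p r / (2 * r)\<^sup>2 - L = (circulation (\<lambda>q d. Q q * DP q d) p r - L * (2 * r)\<^sup>2) / (2 * r)\<^sup>2"
      using r by (simp add: diff_divide_distrib)
    ultimately show ?thesis using r by (simp add: dist_real_def abs_divide pos_divide_less_eq)
  qed
  then show "\<forall>\<^sub>F r in at_right 0. dist (circulation (\<lambda>q d. Q q * DP q d) p r / (2 * r)\<^sup>2) (DQ (1, 0) * DP p (0, 1) - DQ (0, 1) * DP p (1, 0)) < \<epsilon>"
    unfolding L_def[symmetric] eventually_at_right_field using m by blast
qed

section \<open>Levi-Civita connection and curvature of the induced metric\<close>

context spacelike_graph begin

lemma first_fundamental_form_graph: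
  "first_fundamental_form f p v w = v \<bullet> w - (grad p \<bullet> v) * (grad p \<bullet> w)"
proof -
  have "(graph_param f has_derivative (\<lambda>v. (fst v, snd v, grad p \<bullet> v))) (at p)"
    unfolding graph_param_def[abs_def]
    by (intro has_derivative_Pair deriv_f has_derivative_fst has_derivative_snd has_derivative_ident)
  then have "frechet_derivative (graph_param f) (at p) = (\<lambda>v. (fst v, snd v, grad p \<bullet> v))"
    by (rule frechet_derivative_at[symmetric])
  then show ?thesis
    by (simp add: first_fundamental_form_def lorentz_def inner_prod_def)
qed

lemma metric_deriv_graph:
  "metric_deriv (first_fundamental_form f) p x v w = - ((hess p x \<bullet> v) * (grad p \<bullet> w) + (grad p \<bullet> v) * (hess p x \<bullet> w))"
proof -
  have "((\<lambda>q. first_fundamental_form f q v w) has_derivative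
      (\<lambda>x. - ((hess p x \<bullet> v) * (grad p \<bullet> w) + (grad p \<bullet> v) * (hess p x \<bullet> w)))) (at p)"
    unfolding first_fundamental_form_graph
    by (rule derivative_eq_intros deriv_grad refl | simp add: algebra_simps)+
  from frechet_derivative_at[OF this, symmetric] show ?thesis by (simp add: metric_deriv_def)
qed

lemma christoffel_graph:
  "christoffel (first_fundamental_form f) p x y = - ((hess p x \<bullet> y) / (1 - (norm (grad p))\<^sup>2)) *\<^sub>R grad p"
proof -
  define a where "a = - ((hess p x \<bullet> y) / (1 - (norm (grad p))\<^sup>2)) *\<^sub>R grad p"
  let ?g = "first_fundamental_form f p"
  have nz: "1 - (norm (grad p))\<^sup>2 \<noteq> 0" using norm_grad_sq[of p] by simp
  have ga: "?g a w = - (hess p x \<bullet> y) * (grad p \<bullet> w)" for w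
  proof -
    have "?g a w = - ((hess p x \<bullet> y) / (1 - (norm (grad p))\<^sup>2)) * ((1 - (norm (grad p))\<^sup>2) * (grad p \<bullet> w))"
      unfolding first_fundamental_form_graph a_def
      by (simp add: power2_norm_eq_inner left_diff_distrib right_diff_distrib del: minus_divide_left)
    then show ?thesis using nz by simp
  qed
  have rhs: "metric_deriv (first_fundamental_form f) p x y w + metric_deriv (first_fundamental_form f) p y x w
      - metric_deriv (first_fundamental_form f) p w x y = - 2 * (hess p x \<bullet> y) * (grad p \<bullet> w)" for w
    unfolding metric_deriv_graph using hess_sym[of p x y] hess_sym[of p w x] hess_sym[of p w y] by simp
  have "(THE a. \<forall>w. 2 * ?g a w = - 2 * (hess p x \<bullet> y) * (grad p \<bullet> w)) = a"
  proof (rule the_equality)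
    show "\<forall>w. 2 * ?g a w = - 2 * (hess p x \<bullet> y) * (grad p \<bullet> w)" by (simp add: ga)
    fix b assume b: "\<forall>w. 2 * ?g b w = - 2 * (hess p x \<bullet> y) * (grad p \<bullet> w)"
    define d where "d = b - a"
    have "?g b d = ?g a d" using spec[OF b, of d] ga[of d] by linarith
    then have "d \<bullet> d = (grad p \<bullet> d)\<^sup>2"
      by (simp add: first_fundamental_form_graph d_def inner_diff_left inner_diff_right power2_eq_square algebra_simps)
    also have "\<dots> \<le> (norm (grad p))\<^sup>2 * (d \<bullet> d)"
      using Cauchy_Schwarz_ineq[of "grad p" d] by (simp add: power2_norm_eq_inner)
    finally have "(1 - (norm (grad p))\<^sup>2) * (d \<bullet> d) \<le> 0" by (simp add: algebra_simps)
    moreover have "1 - (norm (grad p))\<^sup>2 > 0" by (simp add: norm_grad_sq)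
    ultimately have "d \<bullet> d \<le> 0" by (simp add: mult_le_0_iff)
    then have "d = 0" by (metis inner_ge_zero inner_eq_zero_iff antisym)
    then show "b = a" by (simp add: d_def)
  qed
  then show ?thesis by (simp only: christoffel_def rhs a_def)
qed

lemma area_density_graph: "area_density (first_fundamental_form f) p = sqrt (1 - (norm (grad p))\<^sup>2)"
proof -
  obtain a b where "grad p = (a, b)" by fastforce
  then show ?thesis
    by (simp add: area_density_def first_fundamental_form_graph norm_Pair power2_eq_square algebra_simps)
qed

text \<open>The form is a function of the gradient times the differential of the first gradient
  component. Both are of class \<open>C\<^sup>1\<close>, so \<open>circulation_limit\<close> applies
  without third derivatives of \<open>f\<close>.\<close>

lemma connection_form_graph:
  "connection_form (first_fundamental_form f) p v =
     - (snd (grad p) * inverse (1 - (fst (grad p))\<^sup>2) * inverse (sqrt (1 - (fst (grad p))\<^sup>2 - (snd (grad p))\<^sup>2))) * fst (hess p v)"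
proof -
  obtain a b where g: "grad p = (a, b)" by fastforce
  have n: "(norm (grad p))\<^sup>2 = a\<^sup>2 + b\<^sup>2" by (simp add: g norm_Pair)
  define N where "N = 1 - a\<^sup>2 - b\<^sup>2"
  have N: "N > 0" "1 - (norm (grad p))\<^sup>2 = N" using norm_grad_sq[of p] n by (auto simp: N_def)
  have sN: "sqrt N / N = inverse (sqrt N)"
    using N(1) real_sqrt_mult_self[of N] by (simp add: field_simps)
  have "connection_form (first_fundamental_form f) p v = sqrt N / (1 - a\<^sup>2) * (- (fst (hess p v) / N) * b)"
    unfolding connection_form_def area_density_graph christoffel_graph N(2)
    by (simp add: g first_fundamental_form_graph power2_eq_square inner_prod_def)
  also have "\<dots> = - (b * inverse (1 - a\<^sup>2) * (sqrt N / N)) * fst (hess p v)"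
    by (simp add: divide_inverse)
  finally show ?thesis unfolding sN by (simp add: g N_def)
qed

text \<open>With \<open>\<omega> = Q da\<close> the part \<open>A da\<close> of \<open>dQ\<close>
  drops out of the exterior derivative. The coefficient \<open>- r ^ 3\<close> of \<open>db\<close>
  gives \<open>r ^ 3\<close> times the Hessian determinant, and the area density is
  \<open>1 / r\<close>, so \<open>K\<close> is \<open>- r ^ 4\<close> times the determinant.\<close>

lemma gauss_curvature_graph:
  assumes "has_gauss_curvature (first_fundamental_form f) p K"
  shows "K * (1 - (norm (grad p))\<^sup>2)\<^sup>2 = - hess_determinant p"
proof -
  define a b where "a q = fst (grad q)" and "b q = snd (grad q)" for q
  define N t where "N q = 1 - (a q)\<^sup>2 - (b q)\<^sup>2" and "t q = 1 - (a q)\<^sup>2" for q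
  define r where "r q = inverse (sqrt (N q))" for q
  define Q where "Q q = - (b q * inverse (t q) * r q)" for q
  have Nn: "N q = 1 - (norm (grad q))\<^sup>2" for q
    by (cases "grad q") (simp add: N_def a_def b_def norm_Pair)
  have N_pos: "N q > 0" for q using norm_grad_sq[of q] by (simp add: Nn)
  have t_pos: "t q > 0" for q using N_pos[of q] zero_le_power2[of "b q"] unfolding N_def t_def by linarith
  have da: "(a has_derivative (\<lambda>x. fst (hess q x))) (at q)" and db: "(b has_derivative (\<lambda>x. snd (hess q x))) (at q)" for q
    unfolding a_def[abs_def] b_def[abs_def] by (rule has_derivative_fst[OF deriv_grad] has_derivative_snd[OF deriv_grad])+
  define A where "A = - b p * (2 * a p * (inverse (t p))\<^sup>2 * r p + a p * inverse (t p) * r p ^ 3)"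
  have dQ: "(Q has_derivative (\<lambda>x. A * fst (hess p x) - r p ^ 3 * snd (hess p x))) (at p)"
  proof -
    have dt: "(t has_derivative (\<lambda>x. - (2 * a p * fst (hess p x)))) (at p)"
      unfolding t_def[abs_def] by (rule derivative_eq_intros da refl | simp add: mult_ac)+
    have dN: "(N has_derivative (\<lambda>x. - (2 * a p * fst (hess p x)) - 2 * b p * snd (hess p x))) (at p)"
      unfolding N_def[abs_def] by (rule derivative_eq_intros da db refl | simp add: mult_ac)+
    have dr: "(r has_derivative (\<lambda>x. (- (2 * a p * fst (hess p x)) - 2 * b p * snd (hess p x)) * (- (1 / 2) * r p ^ 3))) (at p)"
      using DERIV_compose_FDERIV[OF DERIV_inverse_sqrt_power[OF N_pos[of p], of 1] dN]
      by (simp add: r_def[abs_def] numeral_eq_Suc)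
    have dti: "((\<lambda>q. inverse (t q)) has_derivative (\<lambda>x. (- (2 * a p * fst (hess p x))) * (- (inverse (t p))\<^sup>2))) (at p)"
      using DERIV_compose_FDERIV[OF DERIV_inverse[of "t p"] dt] t_pos[of p] by (simp add: numeral_eq_Suc)
    have "(Q has_derivative (\<lambda>x. - ((b p * inverse (t p)) * ((- (2 * a p * fst (hess p x)) - 2 * b p * snd (hess p x)) * (- (1 / 2) * r p ^ 3))
        + (b p * ((- (2 * a p * fst (hess p x))) * (- (inverse (t p))\<^sup>2)) + snd (hess p x) * inverse (t p)) * r p))) (at p)"
      unfolding Q_def[abs_def] by (intro has_derivative_minus has_derivative_mult db dti dr)
    moreover have "inverse (t p) * r p * snd (hess p x) + b p * b p * inverse (t p) * r p ^ 3 * snd (hess p x) = r p ^ 3 * snd (hess p x)" for x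
    proof -
      have "r p * r p * N p = 1"
        using N_pos[of p] by (simp add: r_def field_simps flip: real_sqrt_mult)
      then have "r p = r p ^ 3 * N p" by (simp add: power3_eq_cube mult.assoc)
      then have "inverse (t p) * r p + b p * b p * inverse (t p) * r p ^ 3 = inverse (t p) * r p ^ 3 * (N p + b p * b p)"
        by (simp add: algebra_simps)
      also have "N p + b p * b p = t p" by (simp add: N_def t_def power2_eq_square)
      also have "inverse (t p) * r p ^ 3 * t p = r p ^ 3" using t_pos[of p] by simp
      finally show ?thesis by (simp flip: distrib_right)
    qed
    ultimately show ?thesis
      by (elim has_derivative_eq_rhs) (simp add: fun_eq_iff A_def algebra_simps power2_eq_square)
  qed
  obtain h11 h12 h21 h22 where h: "hess p (1, 0) = (h11, h12)" "hess p (0, 1) = (h21, h22)" by fastforce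
  have h12: "h12 = h21" using hess_sym[of p "(1, 0)" "(0, 1)"] by (simp add: h)
  have "((\<lambda>s. circulation (\<lambda>q d. Q q * fst (hess q d)) p s / (2 * s)\<^sup>2) \<longlongrightarrow>
    (A * fst (hess p (1, 0)) - r p ^ 3 * snd (hess p (1, 0))) * fst (hess p (0, 1)) -
    (A * fst (hess p (0, 1)) - r p ^ 3 * snd (hess p (0, 1))) * fst (hess p (1, 0))) (at_right 0)"
  proof (rule circulation_limit[OF da _ _ dQ])
    show "continuous_on UNIV (\<lambda>q. fst (hess q d))" for d
    proof -
      have "continuous_on UNIV (\<lambda>q :: plane. (q, d))" by (intro continuous_intros)
      from continuous_on_fst[OF continuous_on_compose2[OF cont_hess this]] show ?thesis by simp
    qed
    show "continuous_on UNIV Q"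
      unfolding Q_def[abs_def] r_def t_def N_def a_def b_def
      using N_pos t_pos unfolding N_def t_def a_def b_def
      by (intro continuous_intros continuous_grad) (auto simp: less_le)
  qed
  then have "((\<lambda>s. circulation (\<lambda>q d. Q q * fst (hess q d)) p s / (2 * s)\<^sup>2) \<longlongrightarrow> r p ^ 3 * (h11 * h22 - h12\<^sup>2)) (at_right 0)"
    by (simp add: h h12 algebra_simps power2_eq_square)
  then have "((\<lambda>s. - (circulation (\<lambda>q d. Q q * fst (hess q d)) p s / (2 * s)\<^sup>2) * r p) \<longlongrightarrow> - (r p ^ 3 * (h11 * h22 - h12\<^sup>2)) * r p) (at_right 0)"
    by (intro tendsto_intros)
  then have "((\<lambda>s. - circulation (connection_form (first_fundamental_form f)) p s /
      (area_density (first_fundamental_form f) p * (2 * s)\<^sup>2)) \<longlongrightarrow> - (r p ^ 3 * (h11 * h22 - h12\<^sup>2)) * r p) (at_right 0)"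
  proof -
    assume *: "((\<lambda>s. - (circulation (\<lambda>q d. Q q * fst (hess q d)) p s / (2 * s)\<^sup>2) * r p) \<longlongrightarrow> - (r p ^ 3 * (h11 * h22 - h12\<^sup>2)) * r p) (at_right 0)"
    have conn: "connection_form (first_fundamental_form f) = (\<lambda>q d. Q q * fst (hess q d))"
      unfolding fun_eq_iff connection_form_graph Q_def r_def t_def N_def a_def b_def by simp
    have area: "area_density (first_fundamental_form f) p = inverse (r p)"
      by (simp add: area_density_graph r_def Nn)
    have eq: "- x / (inverse (r p) * y) = - (x / y) * r p" for x y :: real by (simp add: divide_inverse)
    show ?thesis unfolding conn area eq by (rule *)
  qed
  then have K: "K = - (r p ^ 3 * (h11 * h22 - h12\<^sup>2)) * r p"
    by (rule tendsto_unique[OF trivial_limit_at_right_real assms[unfolded has_gauss_curvature_def]])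
  have one: "r p ^ 3 * r p * (N p)\<^sup>2 = 1"
  proof -
    have "r p * r p * N p = 1" using N_pos[of p] by (simp add: r_def field_simps flip: real_sqrt_mult)
    then have "(r p * r p * N p)\<^sup>2 = 1" by simp
    then show ?thesis by (simp add: power2_eq_square power3_eq_cube mult_ac)
  qed
  have swap: "- (x * y) * z * w = - y * (x * z * w)" for x y z w :: real by simp
  have "K * (N p)\<^sup>2 = - (h11 * h22 - h12\<^sup>2)"
    unfolding K swap one by (rule mult_1_right)
  then show ?thesis by (simp add: h Nn)
qed

end

section \<open>Incompleteness\<close>

lemma circle_dist_near:
  assumes "\<bar>t\<bar> \<le> 1"
  shows "circle_dist (\<theta> + t) \<theta> = \<bar>t\<bar>"
  unfolding circle_dist_def
proof (rule cInf_eq_minimum)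
  show "\<bar>t\<bar> \<in> range (\<lambda>k::int. \<bar>\<theta> + t - \<theta> + 2 * pi * of_int k\<bar>)"
    by (rule image_eqI[of _ _ 0]) auto
  fix x assume "x \<in> range (\<lambda>k::int. \<bar>\<theta> + t - \<theta> + 2 * pi * of_int k\<bar>)"
  then obtain k :: int where x: "x = \<bar>t + 2 * pi * of_int k\<bar>" by auto
  show "\<bar>t\<bar> \<le> x"
  proof (cases "k = 0")
    case False
    then have "1 \<le> \<bar>real_of_int k\<bar>" by linarith
    then have "2 * pi * 1 \<le> 2 * pi * \<bar>real_of_int k\<bar>" by (intro mult_left_mono) auto
    also have "\<dots> = \<bar>2 * pi * real_of_int k\<bar>" by (simp add: abs_mult)
    finally show ?thesis using assms pi_gt3 unfolding x by linarith
  qed (simp add: x)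
qed

lemma lorentz_null_vec: "lorentz (x, y, z) (null_vec \<theta>) = (x, y) \<bullet> (cos \<theta>, sin \<theta>) - z"
  by (simp add: lorentz_def null_vec_def)

text \<open>The cosets of the direction space are the level sets of a linear function
  \<open>l\<close>, and \<open>l m = 1\<close>. So modulo \<open>W\<close> the curve equals
  \<open>l (\<gamma> t)\<close> times \<open>m\<close>, which converges in the ordinary
  sense.\<close>

lemma asymptotic_to_null_plane:
  assumes lim: "((\<lambda>t. lorentz (\<gamma> t) (null_vec \<theta>)) \<longlongrightarrow> c) (at_left T)"
  shows "asymptotic_to \<gamma> T {p. lorentz p (null_vec \<theta>) = c}"
proof -
  define l where "l p = lorentz p (null_vec \<theta>)" for p
  have l_eq: "l p = fst p * cos \<theta> + fst (snd p) * sin \<theta> - snd (snd p)" for p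
    by (simp add: l_def lorentz_def null_vec_def case_prod_beta')
  have l_add: "l (p + q) = l p + l q" and l_diff: "l (p - q) = l p - l q" and l_scale: "l (s *\<^sub>R p) = s * l p" for p q s
    by (simp_all add: l_eq algebra_simps)
  define V where "V = {p. l p = c}"
  define W where "W = {p - q |p q. p \<in> V \<and> q \<in> V}"
  define m :: mink where "m = (0, 0, - 1)"
  have m: "l m = 1" by (simp add: l_eq m_def)
  have V: "c *\<^sub>R m \<in> V" by (simp add: V_def l_scale m)
  have W: "W = {p. l p = 0}"
  proof (intro equalityI subsetI)
    fix p assume "p \<in> {p. l p = 0}"
    then have "p + c *\<^sub>R m \<in> V" by (simp add: V_def l_add l_scale m)
    then show "p \<in> W"
      using V unfolding W_def by (intro CollectI exI[of _ "p + c *\<^sub>R m"] exI[of _ "c *\<^sub>R m"]) simp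
  next
    fix p assume "p \<in> W"
    then obtain q r where "p = q - r" "l q = c" "l r = c" unfolding W_def V_def by blast
    then show "p \<in> {p. l p = 0}" by (simp add: l_diff)
  qed
  have coset: "coset W p = {q. l q = l p}" for p
  proof (intro equalityI subsetI)
    fix q assume "q \<in> {q. l q = l p}"
    then have "q - p \<in> W" by (simp add: W l_diff)
    then show "q \<in> coset W p" unfolding coset_def by (rule image_eqI[rotated]) simp
  next
    fix q assume "q \<in> coset W p"
    then obtain r where "q = p + r" "l r = 0" unfolding coset_def W by blast
    then show "q \<in> {q. l q = l p}" by (simp add: l_add)
  qed
  have cV: "coset W (c *\<^sub>R m) = V" by (simp add: coset V_def l_scale m)
  have "limitin (quotient_topology W) (\<lambda>t. coset W (\<gamma> t)) V (at_left T)"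
    unfolding limitin_def
  proof (intro conjI allI impI)
    have "openin (quotient_topology W) (range (coset W))"
      by (simp add: openin_quotient_topology vimage_def)
    then show "V \<in> topspace (quotient_topology W)"
      using cV openin_subset by (metis rangeI subsetD)
    fix U assume U: "openin (quotient_topology W) U \<and> V \<in> U"
    then have op: "open (coset W -` U)" by (simp add: openin_quotient_topology)
    have "((\<lambda>t. l (\<gamma> t) *\<^sub>R m) \<longlongrightarrow> c *\<^sub>R m) (at_left T)"
      using lim by (intro tendsto_intros) (simp add: l_def)
    moreover have "c *\<^sub>R m \<in> coset W -` U" using U cV by simp
    ultimately have "\<forall>\<^sub>F t in at_left T. l (\<gamma> t) *\<^sub>R m \<in> coset W -` U"
      using op topological_tendstoD by blast
    then show "\<forall>\<^sub>F t in at_left T. coset W (\<gamma> t) \<in> U"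
      by eventually_elim (simp add: coset l_scale m)
  qed
  then show ?thesis by (simp add: asymptotic_to_def Let_def W_def V_def l_def)
qed

text \<open>On a compact set \<open>h\<close> has a positive minimum, below which the curve falls
  near \<open>T\<close>; preimages of compact sets thus lie in a compact interval.\<close>

lemma proper_map_into_graph:
  fixes \<gamma> :: "real \<Rightarrow> 'a::metric_space" and h :: "'a \<Rightarrow> real"
  assumes cont: "continuous_on {0..<T} \<gamma>" and into: "\<And>t. t \<in> {0..<T} \<Longrightarrow> \<gamma> t \<in> S"
    and h: "continuous_on S h" "\<And>p. p \<in> S \<Longrightarrow> h p > 0" and lim: "((\<lambda>t. h (\<gamma> t)) \<longlongrightarrow> 0) (at_left T)" and T: "T > 0"
  shows "proper_map (top_of_set {0..<T}) (top_of_set S) \<gamma>"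
proof (rule compact_imp_proper_map)
  have met: "metrizable_space (top_of_set S)"
    by (simp add: metrizable_space_euclidean metrizable_space_subtopology)
  show "k_space (top_of_set S)" by (rule metrizable_imp_k_space[OF met])
  show "kc_space (top_of_set S)" by (simp add: Hausdorff_imp_kc_space metrizable_imp_Hausdorff_space[OF met])
  show "\<gamma> \<in> topspace (top_of_set {0..<T}) \<rightarrow> topspace (top_of_set S)" using into by auto
  show "continuous_map (top_of_set {0..<T}) (top_of_set S) \<gamma> \<or> kc_space (top_of_set {0..<T})"
    using cont into by (simp add: continuous_map_in_subtopology image_subset_iff)
  fix K assume "compactin (top_of_set S) K"
  then have K: "compact K" "K \<subseteq> S" by (auto simp: compactin_subtopology)
  obtain \<delta> where \<delta>: "\<delta> > 0" "\<And>p. p \<in> K \<Longrightarrow> \<delta> \<le> h p"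
  proof (cases "K = {}")
    case True
    then show thesis using that[of 1] by simp
  next
    case False
    then obtain x where "x \<in> K" "\<And>p. p \<in> K \<Longrightarrow> h x \<le> h p"
      using continuous_attains_inf[OF K(1) False continuous_on_subset[OF h(1) K(2)]] by blast
    then show thesis using that[of "h x"] h(2) K(2) by blast
  qed
  have "\<forall>\<^sub>F t in at_left T. h (\<gamma> t) < \<delta>" using order_tendstoD(2)[OF lim \<delta>(1)] .
  then obtain b where b: "b < T" "\<And>t. b < t \<Longrightarrow> t < T \<Longrightarrow> h (\<gamma> t) < \<delta>"
    unfolding eventually_at_left_field by blast
  have eq: "{t \<in> {0..<T}. \<gamma> t \<in> K} = {0..max 0 b} \<inter> \<gamma> -` K"
    using b T \<delta>(2) by (auto simp: not_less[symmetric]) (smt (verit) max_def)+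
  have "continuous_on {0..max 0 b} \<gamma>" using b(1) T by (intro continuous_on_subset[OF cont]) auto
  then have "closed ({0..max 0 b} \<inter> \<gamma> -` K)"
    by (intro continuous_closed_preimage compact_imp_closed K) auto
  moreover have "bounded ({0..max 0 b} \<inter> \<gamma> -` K)" by (rule bounded_subset[of "{0..max 0 b}"]) auto
  ultimately have "compact {t \<in> {0..<T}. \<gamma> t \<in> K}" unfolding eq by (simp add: compact_eq_bounded_closed)
  then show "compactin (top_of_set {0..<T}) {t \<in> topspace (top_of_set {0..<T}). \<gamma> t \<in> K}"
    by (auto simp: compactin_subtopology)
qed

context spacelike_graph begin

lemma null_support_graph:
  "null_support (graph_surface f) \<theta> = (SUP p. ereal (p \<bullet> (cos \<theta>, sin \<theta>) - f p))"
proof -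
  have "lorentz (graph_param f p) (null_vec \<theta>) = p \<bullet> (cos \<theta>, sin \<theta>) - f p" for p
    by (simp add: graph_param_def lorentz_null_vec)
  then show ?thesis
    unfolding null_support_def graph_surface_def by (simp add: image_image)
qed

text \<open>The derivative of the squared speed is a multiple of
  \<open>k * (1 - (norm g)\<^sup>2) - h\<close>, which vanishes by the choice of \<open>k\<close>.
  Constant speed on a bounded interval yields finite length.\<close>

lemma geodesic_speed_constant:
  assumes c: "\<And>t. t \<in> {0..<T} \<Longrightarrow> (c has_vector_derivative v t) (at t within {0..<T})"
    and v: "\<And>t. t \<in> {0..<T} \<Longrightarrow> (v has_vector_derivative geodesic_acc (c t) (v t)) (at t within {0..<T})"
  shows "\<exists>s. \<forall>t\<in>{0..<T}. v t \<bullet> v t - (grad (c t) \<bullet> v t)\<^sup>2 = s"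
proof (rule has_field_derivative_zero_constant)
  fix t assume t: "t \<in> {0..<T}"
  define g h k where "g = grad (c t)" and "h = hess (c t) (v t) \<bullet> v t" and "k = h / (1 - (norm g)\<^sup>2)"
  have acc: "geodesic_acc (c t) (v t) = k *\<^sub>R g" by (simp add: geodesic_acc_def k_def h_def g_def)
  have kG: "k * (1 - (norm g)\<^sup>2) = h" using norm_grad_sq[of "c t"] by (simp add: k_def g_def)
  have dg: "((\<lambda>t. grad (c t)) has_derivative (\<lambda>x. x *\<^sub>R hess (c t) (v t))) (at t within {0..<T})"
    using has_derivative_compose[OF c[OF t, unfolded has_vector_derivative_def] deriv_grad]
    by (simp add: linear_simps[OF hess_linear])
  have dv: "(v has_derivative (\<lambda>x. x *\<^sub>R (k *\<^sub>R g))) (at t within {0..<T})"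
    using v[OF t] by (simp add: has_vector_derivative_def acc)
  let ?D = "\<lambda>x. (v t \<bullet> (x *\<^sub>R (k *\<^sub>R g)) + (x *\<^sub>R (k *\<^sub>R g)) \<bullet> v t) -
     ((grad (c t) \<bullet> v t) * (grad (c t) \<bullet> (x *\<^sub>R (k *\<^sub>R g)) + (x *\<^sub>R hess (c t) (v t)) \<bullet> v t) +
      (grad (c t) \<bullet> (x *\<^sub>R (k *\<^sub>R g)) + (x *\<^sub>R hess (c t) (v t)) \<bullet> v t) * (grad (c t) \<bullet> v t))"
  have "((\<lambda>t. v t \<bullet> v t - (grad (c t) \<bullet> v t) * (grad (c t) \<bullet> v t)) has_derivative ?D) (at t within {0..<T})"
    by (intro has_derivative_diff has_derivative_mult has_derivative_inner dg dv)
  moreover have "?D x = 0" for x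
  proof -
    have "?D x =
      2 * x * (g \<bullet> v t) * (k * (1 - (norm g)\<^sup>2) - h)"
      by (simp add: g_def h_def inner_commute[of "v t"] power2_norm_eq_inner algebra_simps)
    then show ?thesis by (simp add: kG)
  qed
  ultimately show "((\<lambda>t. v t \<bullet> v t - (grad (c t) \<bullet> v t)\<^sup>2) has_real_derivative 0) (at t within {0..<T})"
    unfolding has_field_derivative_def power2_eq_square by (elim has_derivative_eq_rhs) (simp add: fun_eq_iff)
qed simp

end

theorem theoremC:
  fixes \<phi> :: "real \<Rightarrow> ereal" and \<theta>\<^sub>0 \<epsilon> \<alpha> \<kappa> :: real and U :: "real set"
    and f :: "real \<times> real \<Rightarrow> real"
  assumes periodic: "\<And>\<theta>. \<phi> (\<theta> + 2 * pi) = \<phi> \<theta>"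
    and not_MInf: "\<And>\<theta>. \<phi> \<theta> \<noteq> -\<infinity>"
    and lsc: "lower_semicontinuous \<phi>"
    and three_points: "\<exists>A\<subseteq>{0..<2 * pi}. card A = 3 \<and> (\<forall>\<theta>\<in>A. \<phi> \<theta> < \<infinity>)"
    and finite_at: "\<phi> \<theta>\<^sub>0 < \<infinity>"
    and nhd: "open U" "\<theta>\<^sub>0 \<in> U"
    and constants: "\<epsilon> > 0" "0 < \<alpha>" "\<alpha> < 1"
    and growth: "\<And>\<theta>. \<theta> \<in> U \<Longrightarrow> \<not> [\<theta> = \<theta>\<^sub>0] (rmod (2 * pi)) \<Longrightarrow>
                   \<phi> \<theta> - \<phi> \<theta>\<^sub>0 > ereal (\<epsilon> * circle_dist \<theta> \<theta>\<^sub>0 powr \<alpha>)"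
    and surface: "convex_entire_spacelike f"
    and support: "\<And>\<theta>. null_support (graph_surface f) \<theta> = \<phi> \<theta>"
    and curvature: "\<kappa> > 0" "curvature_bounded_above (first_fundamental_form f) (- \<kappa>)"
  shows "incomplete_at f \<theta>\<^sub>0"
proof -
  obtain grad hess where "spacelike_graph f grad hess"
    using convex_entire_spacelike_imp[OF surface] by blast
  then interpret S: spacelike_graph f grad hess .
  obtain c0 where c0: "\<phi> \<theta>\<^sub>0 = ereal c0" using finite_at not_MInf[of \<theta>\<^sub>0] by (cases "\<phi> \<theta>\<^sub>0") auto
  define e n :: plane where "e = (cos \<theta>\<^sub>0, sin \<theta>\<^sub>0)" and "n = (- sin \<theta>\<^sub>0, cos \<theta>\<^sub>0)"
  have \<phi>: "\<phi> \<theta> = (SUP p. ereal (p \<bullet> (cos \<theta>, sin \<theta>) - f p))" for \<theta>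
    using support[of \<theta>] by (simp add: S.null_support_graph)
  have \<phi>_less: "\<exists>p. m < p \<bullet> (cos \<theta>, sin \<theta>) - f p" if "ereal m < \<phi> \<theta>" for m \<theta>
    using that unfolding \<phi> less_SUP_iff by auto
  obtain \<rho>' where \<rho>': "\<rho>' > 0" "ball \<theta>\<^sub>0 \<rho>' \<subseteq> U" using nhd open_contains_ball by blast
  \<comment> \<open>For angles below 1 the distance on the circle is \<open>\<bar>t\<bar>\<close>,
    and \<open>t\<close> is no multiple of \<open>2 * pi\<close>.\<close>
  define \<rho> where "\<rho> = min 1 \<rho>'"
  interpret G: growing_graph f grad hess e n c0 \<kappa> \<epsilon> \<alpha> \<rho>
  proof unfold_locales
    show "norm e = 1" by (simp add: e_def norm_Pair)
    show "n = (- snd e, fst e)" by (simp add: e_def n_def)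
    show "\<kappa> > 0" by (fact curvature)
    fix p
    obtain K where K: "K \<le> - \<kappa>" "has_gauss_curvature (first_fundamental_form f) p K"
      using curvature(2) unfolding curvature_bounded_above_def by blast
    have "\<kappa> * (1 - (norm (grad p))\<^sup>2)\<^sup>2 \<le> - K * (1 - (norm (grad p))\<^sup>2)\<^sup>2"
      using K(1) by (intro mult_right_mono) auto
    then show "\<kappa> * (1 - (norm (grad p))\<^sup>2)\<^sup>2 \<le> S.hess_determinant p"
      using S.gauss_curvature_graph[OF K(2)] by simp
    have "ereal (p \<bullet> e - f p) \<le> \<phi> \<theta>\<^sub>0" unfolding \<phi> e_def by (rule SUP_upper) simp
    then show "p \<bullet> e - f p \<le> c0" by (simp add: c0)
    show "\<epsilon> > 0" "0 < \<alpha>" "\<alpha> < 1" by (fact constants)+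
    show "0 < \<rho>" "\<rho> \<le> 1" using \<rho>' by (auto simp: \<rho>_def)
    show "\<exists>p. m < p \<bullet> e - f p" if "m < c0" for m
      using \<phi>_less[of m \<theta>\<^sub>0] that by (simp add: c0 e_def)
    fix t m assume t: "0 < \<bar>t\<bar>" "\<bar>t\<bar> < \<rho>" and m: "m < c0 + \<epsilon> * \<bar>t\<bar> powr \<alpha>"
    have "\<theta>\<^sub>0 + t \<in> U" using t \<rho>'(2) by (auto simp: \<rho>_def dist_real_def)
    moreover have "\<not> [\<theta>\<^sub>0 + t = \<theta>\<^sub>0] (rmod (2 * pi))"
    proof
      assume "[\<theta>\<^sub>0 + t = \<theta>\<^sub>0] (rmod (2 * pi))"
      then obtain k :: int where "\<theta>\<^sub>0 = \<theta>\<^sub>0 + t + of_int k * (2 * pi)" unfolding rcong_altdef by blast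
      then have k: "t = - (of_int k * (2 * pi))" by linarith
      then have "k \<noteq> 0" using t by auto
      then have "1 \<le> \<bar>real_of_int k\<bar>" by linarith
      then have "1 * (2 * pi) \<le> \<bar>real_of_int k\<bar> * (2 * pi)" by (intro mult_right_mono) auto
      also have "\<dots> = \<bar>t\<bar>" by (simp add: k abs_mult)
      finally show False using t pi_gt3 by (simp add: \<rho>_def)
    qed
    moreover have "circle_dist (\<theta>\<^sub>0 + t) \<theta>\<^sub>0 = \<bar>t\<bar>" using t by (intro circle_dist_near) (simp add: \<rho>_def)
    ultimately have "ereal (\<epsilon> * \<bar>t\<bar> powr \<alpha>) < \<phi> (\<theta>\<^sub>0 + t) - ereal c0"
      using growth[of "\<theta>\<^sub>0 + t"] by (simp add: c0)
    then have "ereal m < \<phi> (\<theta>\<^sub>0 + t)" using m by (cases "\<phi> (\<theta>\<^sub>0 + t)") auto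
    moreover have "cos t *\<^sub>R e + sin t *\<^sub>R n = (cos (\<theta>\<^sub>0 + t), sin (\<theta>\<^sub>0 + t))"
      by (simp add: e_def n_def cos_add sin_add mult.commute)
    ultimately show "\<exists>p. m < p \<bullet> (cos t *\<^sub>R e + sin t *\<^sub>R n) - f p" using \<phi>_less by simp
  qed
  let ?g = "first_fundamental_form f"
  obtain T c v where T: "T > 0" and c: "\<And>t. t \<in> {0..<T} \<Longrightarrow> (c has_vector_derivative v t) (at t within {0..<T})"
    and v: "\<And>t. t \<in> {0..<T} \<Longrightarrow> (v has_vector_derivative S.geodesic_acc (c t) (v t)) (at t within {0..<T})"
    and u: "((\<lambda>t. G.u (c t)) \<longlongrightarrow> 0) (at_left T)"
    using G.limit_geodesic by blast
  define P where "P = {p. lorentz p (null_vec \<theta>\<^sub>0) = c0}"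
  have "- christoffel ?g (c t) (v t) (v t) = S.geodesic_acc (c t) (v t)" for t
    by (simp add: S.christoffel_graph S.geodesic_acc_def)
  then have geo: "geodesic_on ?g c {0..<T}"
    unfolding geodesic_on_def using c v by (intro exI[of _ v]) auto
  have len: "curve_length ?g c {0..<T} < \<infinity>"
  proof -
    obtain s where s: "\<And>t. t \<in> {0..<T} \<Longrightarrow> v t \<bullet> v t - (grad (c t) \<bullet> v t)\<^sup>2 = s"
      using S.geodesic_speed_constant[OF c v] by blast
    have "curve_length ?g c {0..<T} \<le> (\<integral>\<^sup>+ t. ennreal (sqrt s) * indicator {0..<T} t \<partial>lborel)"
      unfolding curve_length_def
    proof (rule nn_integral_mono)
      fix t
      show "(let v = vector_derivative c (at t within {0..<T}) in ennreal (sqrt (?g (c t) v v))) * indicator {0..<T} t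
        \<le> ennreal (sqrt s) * indicator {0..<T} t"
      proof (cases "t \<in> {0..<T}")
        case True
        then have "at t within {0..<T} \<noteq> bot" by (simp add: trivial_limit_within)
        then have "vector_derivative c (at t within {0..<T}) = v t"
          by (rule vector_derivative_within[OF _ c[OF True]])
        then show ?thesis using s[OF True] by (simp add: S.first_fundamental_form_graph power2_eq_square)
      qed simp
    qed
    also have "\<dots> = ennreal (sqrt s) * ennreal T"
      using T by (simp add: nn_integral_cmult_indicator)
    also have "\<dots> < \<infinity>" by (simp add: ennreal_mult_less_top)
    finally show ?thesis .
  qed
  have lor: "lorentz (graph_param f p) (null_vec \<theta>\<^sub>0) = c0 - G.u p" for p
    by (simp add: graph_param_def lorentz_null_vec G.u_def e_def[symmetric])
  have lor_lim: "((\<lambda>t. lorentz ((graph_param f \<circ> c) t) (null_vec \<theta>\<^sub>0)) \<longlongrightarrow> c0) (at_left T)"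
    using tendsto_diff[OF tendsto_const u, of c0] by (simp add: lor)
  have "continuous_on {0..<T} c"
    unfolding continuous_on_eq_continuous_within by (blast intro: has_vector_derivative_continuous c)
  then have "continuous_on {0..<T} (graph_param f \<circ> c)"
    unfolding graph_param_def[abs_def] o_def
    by (intro continuous_intros continuous_on_compose2[OF S.continuous_f[of UNIV]]) auto
  then have "proper_map (top_of_set {0..<T}) (top_of_set (graph_surface f)) (graph_param f \<circ> c)"
  \<comment> \<open>This \<open>h\<close> is \<open>u\<close>, expressed as a function on Minkowski
    space.\<close>
  proof (rule proper_map_into_graph[where h = "\<lambda>p. c0 - lorentz p (null_vec \<theta>\<^sub>0)", OF _ _ _ _ _ T])
    show "continuous_on (graph_surface f) (\<lambda>p. c0 - lorentz p (null_vec \<theta>\<^sub>0))"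
      unfolding lorentz_def null_vec_def case_prod_beta' by (intro continuous_intros)
    show "((\<lambda>t. c0 - lorentz ((graph_param f \<circ> c) t) (null_vec \<theta>\<^sub>0)) \<longlongrightarrow> 0) (at_left T)"
      using tendsto_diff[OF tendsto_const lor_lim, of c0] by simp
  qed (auto simp: graph_surface_def lor G.u_pos)
  moreover have "is_null_support_plane (graph_surface f) \<theta>\<^sub>0 P"
    by (simp add: is_null_support_plane_def support c0 P_def)
  moreover have "asymptotic_to (graph_param f \<circ> c) T P"
    unfolding P_def by (rule asymptotic_to_null_plane[OF lor_lim])
  ultimately show ?thesis
    unfolding incomplete_at_def using T geo len by blast
qed

end
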